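(* Let $n\ge2$. We have \[\bigcup_{T} P_T=\bigcup_{\mathfrak T} P_{T(\mathfrak T)},\] where $T$ ranges over realizable flag types of degree $n$ and $\mathfrak T$ over tower types of degree $n$, if and only if $n=p^k$ with $p$ prime and $k\ge1$, or $n=pq$ with $p,q$ distinct primes, or $n=12$.
   Context: Let $[n]=\{0,\dots,n-1\}$. A flag type of degree $n$ is a function $T:[n]\times[n]\to[n]$ such that $T(i,j)=T(j,i)$, $T(i,0)=i$, and $T(i,j)\le T(i+1,j)$ for $i<n-1$. A flag of a finite abelian group $G$ of order $n$ (written multiplicatively) is a chain of subsets $\{1\}=F_0\subset\cdots\subset F_{n-1}=G$ with $|F_i|=i+1$; a flag of a degree $n$ field extension $L/K$ is a chain of $K$-subspaces $K=F_0\subset\cdots\subset F_{n-1}=L$ with $\dim_KF_i=i+1$. The flag type of a flag is $T_{\mathcal F}(i,j)=\min\{k: F_iF_j\subseteq F_k\}$, where $F_iF_j$ is the set of products (groups) or the $K$-span of products (fields). A flag type is realizable if it equals $T_{\mathcal F}$ for some flag of a finite abelian group or of a finite field extension. For a flag type $T$, $P_T$ is the set of $\mathbf x\in\mathbb R^{n-1}$ with $0\le x_1\le\cdots\le x_{n-1}$ and $x_{T(i,j)}\le x_i+x_j$ for all $1\le i,j<n$. A tower type of degree $n$ is a tuple $(n_1,\dots,n_t)$ of integers $>1$ with product $n$. Writing $i\in[n]$ in mixed radix notation $i=i_1+i_2n_1+\cdots+i_tn_1\cdots n_{t-1}$ ($0\le i_s<n_s$), let $H=C_{n_1}\times\cdots\times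 C_{n_t}$, $e_s$ a generator of the $s$-th factor, $v_i=e_1^{i_1}\cdots e_t^{i_t}$, $F_i=\{v_0,\dots,v_i\}$; $T(\mathfrak T)$ is the flag type of this flag of $H$. *)

theory Defs
  imports Complex_Main "HOL-Computational_Algebra.Primes" "HOL-Algebra.Algebra"
begin

text \<open>
  Functions on \<open>[n] = {0,\<dots>,n-1}\<close> are HOL functions on \<open>nat\<close> (or \<open>nat \<times> nat\<close>, curried) of which
  only the values at arguments below \<open>n\<close> are used.
\<close>

definition flag_type :: "nat \<Rightarrow> (nat \<Rightarrow> nat \<Rightarrow> nat) \<Rightarrow> bool" where
  "flag_type n T \<longleftrightarrow>
     (\<forall>i<n. \<forall>j<n. T i j < n) \<and>
     (\<forall>i<n. \<forall>j<n. T i j = T j i) \<and>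
     (\<forall>i<n. T i 0 = i) \<and>
     (\<forall>i j. Suc i < n \<and> j < n \<longrightarrow> T i j \<le> T (Suc i) j)"

definition group_flag :: "('a, 'b) monoid_scheme \<Rightarrow> nat \<Rightarrow> (nat \<Rightarrow> 'a set) \<Rightarrow> bool" where
  "group_flag G n F \<longleftrightarrow>
     F 0 = {\<one>\<^bsub>G\<^esub>} \<and> F (n - 1) = carrier G \<and>
     (\<forall>i. Suc i < n \<longrightarrow> F i \<subset> F (Suc i)) \<and>
     (\<forall>i<n. card (F i) = i + 1)"

definition group_flag_type ::
    "('a, 'b) monoid_scheme \<Rightarrow> (nat \<Rightarrow> 'a set) \<Rightarrow> nat \<Rightarrow> nat \<Rightarrow> nat" where
  "group_flag_type G F i j = (LEAST k. F i <#>\<^bsub>G\<^esub> F j \<subseteq> F k)"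

text \<open>
  The library predicate \<open>ring.dimension L d K V\<close> says that \<open>V\<close> is a \<open>K\<close>-subspace of \<open>L\<close> of
  dimension \<open>d\<close>.
\<close>

definition field_flag ::
    "'a set \<Rightarrow> ('a, 'b) ring_scheme \<Rightarrow> nat \<Rightarrow> (nat \<Rightarrow> 'a set) \<Rightarrow> bool" where
  "field_flag K L n F \<longleftrightarrow>
     F 0 = K \<and> F (n - 1) = carrier L \<and>
     (\<forall>i. Suc i < n \<longrightarrow> F i \<subset> F (Suc i)) \<and>
     (\<forall>i<n. ring.dimension L (i + 1) K (F i))"

text \<open>
  The library's \<open>Span\<close> takes a finite list of vectors; the span of an arbitrary set is the union
  of the spans of the finite lists of its elements.
\<close>

definition span_set :: "'a set \<Rightarrow> ('a, 'b) ring_scheme \<Rightarrow> 'a set \<Rightarrow> 'a set" where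
  "span_set K L S = (\<Union>us\<in>lists S. ring.Span L K us)"

definition field_flag_type ::
    "'a set \<Rightarrow> ('a, 'b) ring_scheme \<Rightarrow> (nat \<Rightarrow> 'a set) \<Rightarrow> nat \<Rightarrow> nat \<Rightarrow> nat" where
  "field_flag_type K L F i j = (LEAST k. span_set K L (F i <#>\<^bsub>L\<^esub> F j) \<subseteq> F k)"

text \<open>
  HOL cannot quantify over types inside a formula, so the type \<open>'a\<close> containing the underlying sets
  of the groups and fields is a parameter.
\<close>

definition group_realizable ::
    "'a itself \<Rightarrow> nat \<Rightarrow> (nat \<Rightarrow> nat \<Rightarrow> nat) \<Rightarrow> bool" where
  "group_realizable _ n T \<longleftrightarrow>
     (\<exists>(G :: 'a monoid) F. comm_group G \<and> finite (carrier G) \<and> order G = n \<and>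
        group_flag G n F \<and> (\<forall>i<n. \<forall>j<n. T i j = group_flag_type G F i j))"

definition field_realizable ::
    "'a itself \<Rightarrow> nat \<Rightarrow> (nat \<Rightarrow> nat \<Rightarrow> nat) \<Rightarrow> bool" where
  "field_realizable _ n T \<longleftrightarrow>
     (\<exists>(L :: 'a ring) K F. field L \<and> subfield K L \<and> ring.dimension L n K (carrier L) \<and>
        field_flag K L n F \<and> (\<forall>i<n. \<forall>j<n. T i j = field_flag_type K L F i j))"

definition realizable :: "'a itself \<Rightarrow> nat \<Rightarrow> (nat \<Rightarrow> nat \<Rightarrow> nat) \<Rightarrow> bool" where
  "realizable A n T \<longleftrightarrow> flag_type n T \<and> (group_realizable A n T \<or> field_realizable A n T)"

text \<open>
  Points of \<open>\<real>\<^sup>n\<^sup>-\<^sup>1\<close> are functions on the index set \<open>{1..<n}\<close>, with the value \<open>undefined\<close> elsewhere.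
  The index \<open>T i j\<close> lies in \<open>{1..<n}\<close> for a flag type \<open>T\<close> and \<open>i, j\<close> in \<open>{1..<n}\<close>, by monotonicity.
\<close>

definition flag_polyhedron :: "nat \<Rightarrow> (nat \<Rightarrow> nat \<Rightarrow> nat) \<Rightarrow> (nat \<Rightarrow> real) set" where
  "flag_polyhedron n T = {x \<in> {1..<n} \<rightarrow>\<^sub>E UNIV.
     (\<forall>i\<in>{1..<n}. 0 \<le> x i) \<and>
     (\<forall>i j. 1 \<le> i \<and> i \<le> j \<and> j < n \<longrightarrow> x i \<le> x j) \<and>
     (\<forall>i\<in>{1..<n}. \<forall>j\<in>{1..<n}. x (T i j) \<le> x i + x j)}"

definition tower_type :: "nat \<Rightarrow> nat list \<Rightarrow> bool" where
  "tower_type n ns \<longleftrightarrow> (\<forall>m\<in>set ns. m > 1) \<and> prod_list ns = n"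

text \<open>
  The entries of a tower type are numbered from \<open>0\<close> here, so that the mixed radix expansion reads
  \<open>i = (\<Sum>s<t. radix_digit ns i s * prod_list (take s ns))\<close> for \<open>i < prod_list ns\<close>.
\<close>

definition radix_digit :: "nat list \<Rightarrow> nat \<Rightarrow> nat \<Rightarrow> nat" where
  "radix_digit ns i s = (i div prod_list (take s ns)) mod (ns ! s)"

definition tower_group :: "nat list \<Rightarrow> (nat \<Rightarrow> int) monoid" where
  "tower_group ns = product_group {..<length ns} (\<lambda>s. integer_mod_group (ns ! s))"

definition tower_gen :: "nat list \<Rightarrow> nat \<Rightarrow> (nat \<Rightarrow> int)" where
  "tower_gen ns s = (\<lambda>r\<in>{..<length ns}. if r = s then 1 else 0)"

definition tower_elem :: "nat list \<Rightarrow> nat \<Rightarrow> (nat \<Rightarrow> int)" where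
  "tower_elem ns i =
     (\<Otimes>\<^bsub>tower_group ns\<^esub>s\<in>{..<length ns}. tower_gen ns s [^]\<^bsub>tower_group ns\<^esub> radix_digit ns i s)"

definition tower_flag :: "nat list \<Rightarrow> nat \<Rightarrow> (nat \<Rightarrow> int) set" where
  "tower_flag ns i = tower_elem ns ` {..i}"

definition tower_flag_type :: "nat list \<Rightarrow> nat \<Rightarrow> nat \<Rightarrow> nat" where
  "tower_flag_type ns = group_flag_type (tower_group ns) (tower_flag ns)"

end

theory Submission
  imports Defs
begin

text \<open>
  A point \<open>x\<close> of \<open>P\<^bsub>T\<^esub>\<close> makes the flag of \<open>T\<close> a filtration that is subadditive with weights \<open>x\<close>, and \<open>x\<close>
  lies in \<open>P\<^bsub>T(\<tau>)\<^esub>\<close> if and only if \<open>x (i + j) \<le> x i + x j\<close> whenever \<open>i + j\<close> is formed without carry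
  in the mixed radix of \<open>\<tau>\<close>. So one has to find a tower with a carry at every pair violating this
  inequality. At such a pair \<open>F\<^sub>iF\<^sub>j\<close> has dimension at most \<open>i + j\<close>, and by Kneser's theorem there is a
  carry modulo the order (degree) of its stabilizer \<open>H\<close>.

  Kneser's theorem is proved for groups and field extensions at once. Around each product \<open>ab\<close> the
  Dyson transform gives a part \<open>C\<close> of \<open>AB\<close> with \<open>dim C + dim (stab C) \<ge> dim A + dim B\<close>, and these parts
  are joined by showing that the bound passes from two parts to their sum. The latter
  needs a numerical hypothesis on \<open>n\<close>, which holds for prime powers, products of two primes and \<open>12\<close>;
  this is what makes inseparable field extensions harmless.

  If \<open>n = p\<^sup>k\<close>, the tower \<open>(p, \<dots>, p)\<close> has carries modulo every divisor of \<open>n\<close>. If \<open>n = pq\<close> or \<open>n = 12\<close>,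
  a dimension count excludes pairs of violations that call for incompatible stabilizers. All other \<open>n\<close>
  have the form \<open>pqc\<close> with \<open>p < q\<close> primes and \<open>c \<ge> 3\<close>, or \<open>4q\<close> with \<open>q \<ge> 5\<close> prime; there an explicit
  subadditive weight on \<open>C\<^sub>p \<times> C\<^sub>q \<times> C\<^sub>c\<close> or \<open>C\<^sub>2 \<times> C\<^sub>2 \<times> C\<^sub>q\<close> has violations that no tower accommodates.
\<close>

section \<open>Subspaces of a commutative group\<close>

text \<open>Kneser's theorem is needed only for the degrees in the list, since the counterexamples
  for all others are flags of groups; so a version with a numerical hypothesis on \<open>n\<close>
  is enough. Nothing is assumed about the number of intermediate fields, which can be infinite in
  the inseparable case. The hard point is a sum of two parts neither of which contains the other:
  only the intersection of their stabilizers is certain to act on the sum. For pq there are two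
  towers of maximal length, for 12 there are three, the orderings of 2, 2, 3. If all of them fail,
  each supplies one violating pair, and the contradiction has to come from two or three products
  F_iF_j within one flag. In the counterexamples only the cardinalities of the sublevel sets of a
  weight matter; the values are spaced so that chosen levels exceed the sum of two lower
  ones.\<close>

text \<open>
  For a finite group, \<open>S\<close> consists of all subsets and \<open>d\<close> is the cardinality. For a field extension
  \<open>L / K\<close>, the group is the multiplicative group of \<open>L\<close>, the members of \<open>S\<close> are the \<open>K\<close>-subspaces with
  zero removed and \<open>d\<close> is the dimension over \<open>K\<close>. The intersection of all members of \<open>S\<close> containing a
  set is its span.
\<close>

locale dim_group = comm_group G for G (structure) +
  fixes S :: "'a set set" and d :: "'a set \<Rightarrow> nat"
  assumes S_carrier: "V \<in> S \<Longrightarrow> V \<subseteq> carrier G"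
    and carrier_S: "carrier G \<in> S"
    and empty_S: "{} \<in> S"
    and Inter_S: "M \<noteq> {} \<Longrightarrow> M \<subseteq> S \<Longrightarrow> \<Inter>M \<in> S"
    and coset_S: "g \<in> carrier G \<Longrightarrow> V \<in> S \<Longrightarrow> l_coset G g V \<in> S"
    and d_coset: "g \<in> carrier G \<Longrightarrow> V \<in> S \<Longrightarrow> d (l_coset G g V) = d V"
    and d_empty: "d {} = 0"
    and d_strict: "V \<in> S \<Longrightarrow> Y \<in> S \<Longrightarrow> V \<subset> Y \<Longrightarrow> d V < d Y"
    and d_modular: "V \<in> S \<Longrightarrow> Y \<in> S \<Longrightarrow> d (V \<inter> Y) + d (\<Inter>{Z \<in> S. V \<union> Y \<subseteq> Z}) = d V + d Y"
    and d_one: "d (\<Inter>{Z \<in> S. {\<one>} \<subseteq> Z}) = 1"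
begin

abbreviation cset :: "'a \<Rightarrow> 'a set \<Rightarrow> 'a set" (infixr "\<cdot>" 75) where
  "g \<cdot> V \<equiv> l_coset G g V"

definition sp :: "'a set \<Rightarrow> 'a set" where "sp A = \<Inter>{Z \<in> S. A \<subseteq> Z}"

definition prod_sp :: "'a set \<Rightarrow> 'a set \<Rightarrow> 'a set" (infixl "\<bullet>" 70) where
  "A \<bullet> B = sp (A <#> B)"

definition stable :: "'a set \<Rightarrow> 'a set \<Rightarrow> bool" where
  "stable H V \<longleftrightarrow> (\<forall>h\<in>H. \<forall>x\<in>V. h \<otimes> x \<in> V)"

definition stab :: "'a set \<Rightarrow> 'a set" where
  "stab V = {g \<in> carrier G. \<forall>x\<in>V. g \<otimes> x \<in> V}"

definition subf :: "'a set \<Rightarrow> bool" where "subf H \<longleftrightarrow> H \<in> S \<and> subgroup H G"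

abbreviation "n \<equiv> d (carrier G)"

section \<open>Spans, stability and stabilizers\<close>

lemma sp_S: "A \<subseteq> carrier G \<Longrightarrow> sp A \<in> S"
  unfolding sp_def by (rule Inter_S) (use carrier_S in auto)

lemma sp_superset: "A \<subseteq> sp A"
  unfolding sp_def by auto

lemma sp_least: "A \<subseteq> Z \<Longrightarrow> Z \<in> S \<Longrightarrow> sp A \<subseteq> Z"
  unfolding sp_def by auto

lemma sp_mono: "A \<subseteq> B \<Longrightarrow> B \<subseteq> carrier G \<Longrightarrow> sp A \<subseteq> sp B"
  by (meson sp_S sp_least sp_superset subset_trans)

lemma sp_id: "V \<in> S \<Longrightarrow> sp V = V"
  by (simp add: sp_least sp_superset subset_antisym)

lemma sp_carrier: "A \<subseteq> carrier G \<Longrightarrow> sp A \<subseteq> carrier G"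
  using sp_S S_carrier by blast

lemma Int_S: "V \<in> S \<Longrightarrow> Y \<in> S \<Longrightarrow> V \<inter> Y \<in> S"
  using Inter_S[of "{V,Y}"] by auto

lemma Un_sp_S: "V \<in> S \<Longrightarrow> Y \<in> S \<Longrightarrow> sp (V \<union> Y) \<in> S"
  by (rule sp_S) (use S_carrier in blast)

lemma d_mod: "V \<in> S \<Longrightarrow> Y \<in> S \<Longrightarrow> d (V \<inter> Y) + d (sp (V \<union> Y)) = d V + d Y"
  using d_modular unfolding sp_def by auto

lemma d_mono: "V \<in> S \<Longrightarrow> Y \<in> S \<Longrightarrow> V \<subseteq> Y \<Longrightarrow> d V \<le> d Y"
  using d_strict[of V Y] by (cases "V = Y") (auto simp: psubset_eq)

lemma d_eq: "V \<in> S \<Longrightarrow> Y \<in> S \<Longrightarrow> V \<subseteq> Y \<Longrightarrow> d Y \<le> d V \<Longrightarrow> V = Y"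
  using d_strict[of V Y] by (auto simp: psubset_eq)

lemma d_pos: "V \<in> S \<Longrightarrow> V \<noteq> {} \<Longrightarrow> 0 < d V"
  using d_strict[of "{}" V] empty_S d_empty by (auto simp: psubset_eq)

lemma mem_coset: "g \<in> carrier G \<Longrightarrow> V \<subseteq> carrier G \<Longrightarrow> y \<in> g \<cdot> V \<longleftrightarrow> y \<in> carrier G \<and> inv g \<otimes> y \<in> V"
  unfolding l_coset_def
  by (auto simp: m_assoc[symmetric] subset_iff) (metis inv_closed inv_solve_left' m_assoc r_inv l_one)

lemma pre_eq: "g \<in> carrier G \<Longrightarrow> V \<subseteq> carrier G \<Longrightarrow> {y \<in> carrier G. g \<otimes> y \<in> V} = inv g \<cdot> V"
  using mem_coset[of "inv g" V] by auto

lemma pre_S: "g \<in> carrier G \<Longrightarrow> V \<in> S \<Longrightarrow> {y \<in> carrier G. g \<otimes> y \<in> V} \<in> S"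
  using pre_eq S_carrier coset_S by simp

lemma d_pre: "g \<in> carrier G \<Longrightarrow> V \<in> S \<Longrightarrow> d {y \<in> carrier G. g \<otimes> y \<in> V} = d V"
  using pre_eq S_carrier d_coset by simp

lemma sp_image_le:
  assumes "g \<in> carrier G" "A \<subseteq> carrier G" "Z \<in> S" "\<And>a. a \<in> A \<Longrightarrow> g \<otimes> a \<in> Z" "x \<in> sp A"
  shows "g \<otimes> x \<in> Z"
proof -
  have "sp A \<subseteq> {y \<in> carrier G. g \<otimes> y \<in> Z}"
    by (rule sp_least) (use assms pre_S in auto)
  with assms show ?thesis by auto
qed

lemma stable_sp:
  assumes "H \<subseteq> carrier G" "A \<subseteq> carrier G" "\<And>h a. h \<in> H \<Longrightarrow> a \<in> A \<Longrightarrow> h \<otimes> a \<in> sp A"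
  shows "stable H (sp A)"
  unfolding stable_def using sp_image_le[of _ A "sp A"] assms sp_S by blast

lemma stable_Int: "stable H V \<Longrightarrow> stable H Y \<Longrightarrow> stable H (V \<inter> Y)"
  unfolding stable_def by auto

lemma stable_sp_Un:
  assumes "H \<subseteq> carrier G" "stable H V" "stable H Y" "V \<subseteq> carrier G" "Y \<subseteq> carrier G"
  shows "stable H (sp (V \<union> Y))"
  by (rule stable_sp) (use assms sp_superset[of "V \<union> Y"] in \<open>auto simp: stable_def\<close>)

lemma stable_mono: "stable H V \<Longrightarrow> H' \<subseteq> H \<Longrightarrow> stable H' V"
  unfolding stable_def by auto

lemma subfD: assumes "subf H"
  shows "H \<in> S" "subgroup H G" "H \<subseteq> carrier G" "\<one> \<in> H" "stable H H" "0 < d H" "H \<noteq> {}"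
    "\<And>x y. x \<in> H \<Longrightarrow> y \<in> H \<Longrightarrow> x \<otimes> y \<in> H" "\<And>x. x \<in> H \<Longrightarrow> inv x \<in> H"
proof -
  show 1: "H \<in> S" "subgroup H G" using assms unfolding subf_def by auto
  then show "H \<subseteq> carrier G" "\<one> \<in> H" "stable H H" "\<And>x y. x \<in> H \<Longrightarrow> y \<in> H \<Longrightarrow> x \<otimes> y \<in> H"
     "\<And>x. x \<in> H \<Longrightarrow> inv x \<in> H"
    unfolding stable_def by (auto simp: subgroup.subset subgroup.one_closed subgroup.m_closed subgroup.m_inv_closed dest: subgroup.mem_carrier)
  then show "H \<noteq> {}" by auto
  with 1 show "0 < d H" using d_pos by auto
qed

text \<open>A subspace closed under multiplication is closed under inversion, since translation by one of
  its elements preserves its dimension.\<close>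

lemma translate_eq:
  assumes "V \<in> S" "g \<in> carrier G" "\<And>x. x \<in> V \<Longrightarrow> g \<otimes> x \<in> V" "y \<in> V"
  shows "inv g \<otimes> y \<in> V"
proof -
  have "g \<cdot> V \<subseteq> V" using assms(3) by (auto simp: l_coset_def)
  then have "g \<cdot> V = V" by (intro d_eq) (use assms coset_S d_coset in auto)
  then show ?thesis using mem_coset[of g V y] assms S_carrier by auto
qed

text \<open>The stabilizer is the intersection of the preimages of \<open>V\<close> under
  multiplication by the points of \<open>V\<close>, hence a member of \<open>S\<close>. It contains
  inverses because a translation of \<open>V\<close> into itself is onto.\<close>

lemma stab_subf:
  assumes "V \<in> S" "V \<noteq> {}" shows "subf (stab V)"
proof -
  have Xc: "V \<subseteq> carrier G" using assms S_carrier by auto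
  have "stab V = \<Inter>((\<lambda>x. {y \<in> carrier G. x \<otimes> y \<in> V}) ` V)"
    using assms Xc m_comm by (fastforce simp: stab_def)
  moreover have "(\<lambda>x. {y \<in> carrier G. x \<otimes> y \<in> V}) ` V \<subseteq> S"
    using Xc by (intro image_subsetI pre_S[OF _ assms(1)]) auto
  ultimately have "stab V \<in> S"
    using Inter_S[of "(\<lambda>x. {y \<in> carrier G. x \<otimes> y \<in> V}) ` V"] assms(2) by simp
  moreover have "subgroup (stab V) G"
  proof (rule subgroupI)
    show "stab V \<subseteq> carrier G" by (auto simp: stab_def)
    have "\<one> \<in> stab V" using Xc by (auto simp: stab_def subset_iff)
    then show "stab V \<noteq> {}" by auto
    show "inv a \<in> stab V" if "a \<in> stab V" for a
      using that translate_eq[OF assms(1)] by (auto simp: stab_def)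
    show "a \<otimes> b \<in> stab V" if "a \<in> stab V" "b \<in> stab V" for a b
      using that Xc by (auto simp: stab_def m_assoc subset_iff)
  qed
  ultimately show ?thesis unfolding subf_def by auto
qed

lemma stable_stab: "stable (stab V) V"
  by (auto simp: stable_def stab_def)

lemma stab_max: "stable H V \<Longrightarrow> H \<subseteq> carrier G \<Longrightarrow> H \<subseteq> stab V"
  by (auto simp: stable_def stab_def)

lemma subf_Int: "subf H \<Longrightarrow> subf K \<Longrightarrow> subf (H \<inter> K)"
  unfolding subf_def using Int_S subgroups_Inter_pair by auto

lemma subf_closed:
  assumes "V \<in> S" "\<one> \<in> V" "stable V V" shows "subf V"
proof -
  have "subgroup V G"
  proof (rule subgroupI)
    show "V \<subseteq> carrier G" "V \<noteq> {}" using assms S_carrier by auto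
    show "inv a \<in> V" if "a \<in> V" for a
      using translate_eq[OF assms(1), of a \<one>] that assms S_carrier[OF assms(1)] by (auto simp: stable_def)
  qed (use assms in \<open>auto simp: stable_def\<close>)
  with assms show ?thesis unfolding subf_def by auto
qed

section \<open>Spans of products\<close>

lemma prod_S: "A \<subseteq> carrier G \<Longrightarrow> B \<subseteq> carrier G \<Longrightarrow> A \<bullet> B \<in> S"
  unfolding prod_sp_def by (rule sp_S) (auto simp: set_mult_def)

lemma prod_carrier: "A \<subseteq> carrier G \<Longrightarrow> B \<subseteq> carrier G \<Longrightarrow> A \<bullet> B \<subseteq> carrier G"
  using prod_S S_carrier by blast

lemma prod_mem: "a \<in> A \<Longrightarrow> b \<in> B \<Longrightarrow> a \<otimes> b \<in> A \<bullet> B"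
  unfolding prod_sp_def using sp_superset[of "A <#> B"] by (auto simp: set_mult_def)

lemma prod_nonempty: "A \<noteq> {} \<Longrightarrow> B \<noteq> {} \<Longrightarrow> A \<bullet> B \<noteq> {}"
  using prod_mem[of _ A _ B] by blast

lemma prod_least: "Z \<in> S \<Longrightarrow> (\<And>a b. a \<in> A \<Longrightarrow> b \<in> B \<Longrightarrow> a \<otimes> b \<in> Z) \<Longrightarrow> A \<bullet> B \<subseteq> Z"
  unfolding prod_sp_def by (rule sp_least) (auto simp: set_mult_def)

lemma prod_comm: "A \<subseteq> carrier G \<Longrightarrow> B \<subseteq> carrier G \<Longrightarrow> A \<bullet> B = B \<bullet> A"
  by (intro equalityI prod_least prod_S) (metis m_comm prod_mem subsetD)+

lemma prod_mono: "A \<subseteq> A' \<Longrightarrow> B \<subseteq> B' \<Longrightarrow> A' \<subseteq> carrier G \<Longrightarrow> B' \<subseteq> carrier G \<Longrightarrow> A \<bullet> B \<subseteq> A' \<bullet> B'"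
  by (rule prod_least) (auto intro: prod_S prod_mem)

lemma prod_least_sp:
  assumes "Z \<in> S" "A \<subseteq> carrier G" "B \<subseteq> carrier G" "\<And>a b. a \<in> A \<Longrightarrow> b \<in> B \<Longrightarrow> a \<otimes> b \<in> Z"
  shows "sp A \<bullet> B \<subseteq> Z"
proof (rule prod_least[OF assms(1)])
  fix a b assume ab: "a \<in> sp A" "b \<in> B"
  have "b \<otimes> a \<in> Z"
    by (rule sp_image_le[OF _ assms(2,1) _ ab(1)]) (use assms ab m_comm in \<open>auto simp: subset_iff\<close>)
  then show "a \<otimes> b \<in> Z" using ab assms sp_carrier m_comm by (metis subsetD)
qed

lemma stable_prod:
  assumes "H \<subseteq> carrier G" "A \<subseteq> carrier G" "B \<subseteq> carrier G" "stable H A"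
  shows "stable H (A \<bullet> B)"
  unfolding prod_sp_def
proof (rule stable_sp)
  fix h a assume "h \<in> H" "a \<in> A <#> B"
  then obtain x y where "x \<in> A" "y \<in> B" "a = x \<otimes> y" by (auto simp: set_mult_def)
  then have "h \<otimes> a = (h \<otimes> x) \<otimes> y" "h \<otimes> x \<in> A" using assms \<open>h \<in> H\<close> by (auto simp: m_assoc subset_iff stable_def)
  then show "h \<otimes> a \<in> sp (A <#> B)" using \<open>y \<in> B\<close> prod_mem unfolding prod_sp_def by metis
qed (use assms in \<open>auto simp: set_mult_def\<close>)

lemma subset_prod: "\<one> \<in> A \<Longrightarrow> A \<subseteq> carrier G \<Longrightarrow> B \<subseteq> carrier G \<Longrightarrow> B \<subseteq> A \<bullet> B"
  using prod_mem[of \<one> A _ B] by (auto simp: subset_iff)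

lemma subset_prod': "\<one> \<in> B \<Longrightarrow> A \<subseteq> carrier G \<Longrightarrow> B \<subseteq> carrier G \<Longrightarrow> A \<subseteq> A \<bullet> B"
  using prod_mem[of _ A \<one> B] by (auto simp: subset_iff)

lemma stable_prodI: "A \<subseteq> carrier G \<Longrightarrow> B \<subseteq> carrier G \<Longrightarrow> V \<in> S \<Longrightarrow> stable A V \<Longrightarrow> stable B V \<Longrightarrow> stable (A \<bullet> B) V"
proof -
  assume a: "A \<subseteq> carrier G" "B \<subseteq> carrier G" "V \<in> S" "stable A V" "stable B V"
  show ?thesis
  proof (cases "V = {}")
    case False
    then have "A \<bullet> B \<subseteq> stab V"
      using stab_subf[OF a(3)] stab_max[OF a(4,1)] stab_max[OF a(5,2)]
      by (intro prod_least) (auto simp: subf_def subset_iff intro: subgroup.m_closed)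
    then show ?thesis using stable_stab stable_mono by blast
  qed (auto simp: stable_def)
qed

lemma prod_subf: "subf H \<Longrightarrow> subf K \<Longrightarrow> subf (H \<bullet> K)"
proof (rule subf_closed)
  assume a: "subf H" "subf K"
  note h = subfD[OF a(1)] and k = subfD[OF a(2)]
  show "H \<bullet> K \<in> S" using h k prod_S by auto
  show "\<one> \<in> H \<bullet> K" using prod_mem[of \<one> H \<one> K] h k by auto
  have "stable H (H \<bullet> K)" using h k by (intro stable_prod) auto
  moreover have "stable K (H \<bullet> K)" using h k by (subst prod_comm) (auto intro: stable_prod)
  ultimately show "stable (H \<bullet> K) (H \<bullet> K)" using h k prod_S by (intro stable_prodI) auto
qed

text \<open>Enlarging a factor by multipliers that already stabilize the product leaves the product
  unchanged. This allows \<open>A\<close> and \<open>B\<close> to be replaced by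
  \<open>H \<bullet> A\<close> and \<open>H \<bullet> B\<close> in Kneser's theorem.\<close>

lemma prod_assoc_stable:
  assumes "H \<subseteq> carrier G" "A \<subseteq> carrier G" "B \<subseteq> carrier G" "stable H (A \<bullet> B)" "\<one> \<in> H"
  shows "(H \<bullet> A) \<bullet> B = A \<bullet> B"
proof
  show "A \<bullet> B \<subseteq> (H \<bullet> A) \<bullet> B" by (intro prod_mono subset_prod prod_carrier) (use assms in auto)
  show "(H \<bullet> A) \<bullet> B \<subseteq> A \<bullet> B"
    unfolding prod_sp_def[of H A]
  proof (rule prod_least_sp)
    fix x b assume "x \<in> H <#> A" "b \<in> B"
    then obtain h a where *: "h \<in> H" "a \<in> A" "x = h \<otimes> a" by (auto simp: set_mult_def)
    then have "x \<otimes> b = h \<otimes> (a \<otimes> b)" using assms \<open>b \<in> B\<close> by (auto simp: m_assoc subset_iff)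
    then show "x \<otimes> b \<in> A \<bullet> B" using assms(4) * \<open>b \<in> B\<close> prod_mem unfolding stable_def by metis
  qed (use assms in \<open>auto simp: set_mult_def intro!: prod_S\<close>)
qed

section \<open>Cosets and divisibility of dimensions\<close>

lemma coset_disjoint:
  assumes "subf H" "stable H Y" "Y \<subseteq> carrier G" "x \<in> carrier G" "x \<notin> Y"
  shows "(x \<cdot> H) \<inter> Y = {}"
proof (rule ccontr)
  assume "(x \<cdot> H) \<inter> Y \<noteq> {}"
  then obtain h where h: "h \<in> H" "x \<otimes> h \<in> Y" by (auto simp: l_coset_def)
  note H = subfD[OF assms(1)]
  have "inv h \<otimes> (x \<otimes> h) \<in> Y" using assms h H by (auto simp: stable_def)
  moreover have hc: "h \<in> carrier G" using h H by blast
  have "inv h \<otimes> (x \<otimes> h) = (inv h \<otimes> h) \<otimes> x"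
    using hc assms(4) m_comm[of x h] m_assoc[of "inv h" h x] by simp
  then have "inv h \<otimes> (x \<otimes> h) = x" using hc assms(4) by simp
  ultimately show False using assms(5) by auto
qed

lemma coset_stable:
  assumes "subf H" "x \<in> carrier G" shows "stable H (x \<cdot> H)"
proof -
  note H = subfD[OF assms(1)]
  have "h \<otimes> (x \<otimes> k) = x \<otimes> (h \<otimes> k)" if "h \<in> H" "k \<in> H" for h k
    using that H(3) assms m_lcomm[of h x k] by auto
  then show ?thesis using H(8) by (auto simp: stable_def l_coset_def)
qed

lemma mem_own_coset: "subf H \<Longrightarrow> x \<in> carrier G \<Longrightarrow> x \<in> x \<cdot> H"
  using subfD(4)[of H] by (force simp: l_coset_def)

lemma coset_subset: "stable H Y \<Longrightarrow> x \<in> Y \<Longrightarrow> Y \<subseteq> carrier G \<Longrightarrow> H \<subseteq> carrier G \<Longrightarrow> x \<cdot> H \<subseteq> Y"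
  by (auto simp: l_coset_def stable_def) (metis m_comm subsetD)

lemma d_Un_disjoint: "V \<in> S \<Longrightarrow> Y \<in> S \<Longrightarrow> V \<inter> Y = {} \<Longrightarrow> d (sp (V \<union> Y)) = d V + d Y"
  using d_mod[of V Y] d_empty by simp

lemma extend_coset:
  assumes "subf H" "Y \<in> S" "stable H Y" "x \<in> carrier G" "x \<notin> Y"
  shows "d (sp (Y \<union> (x \<cdot> H))) = d Y + d H" "stable H (sp (Y \<union> (x \<cdot> H)))"
proof -
  note H = subfD[OF assms(1)]
  have c: "x \<cdot> H \<in> S" "d (x \<cdot> H) = d H" using H assms coset_S d_coset by auto
  show "d (sp (Y \<union> (x \<cdot> H))) = d Y + d H"
    using d_Un_disjoint[of Y "x \<cdot> H"] coset_disjoint[of H Y x] assms c S_carrier by auto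
  show "stable H (sp (Y \<union> (x \<cdot> H)))"
    using assms c coset_stable H S_carrier by (intro stable_sp_Un) auto
qed

text \<open>\<open>V\<close> is exhausted by cosets of \<open>H\<close>: a point outside a stable
  part \<open>Y\<close> brings a whole coset disjoint from \<open>Y\<close>, which adds exactly
  \<open>d H\<close>. This covers both Lagrange's theorem and the multiplicativity of
  degrees.\<close>

lemma d_dvd:
  assumes "subf H" "V \<in> S" "stable H V" shows "d H dvd d V"
proof -
  have "d H dvd d V" if "Y \<in> S" "Y \<subseteq> V" "stable H Y" "d H dvd d Y" for Y
    using that
  proof (induction "d V - d Y" arbitrary: Y rule: less_induct)
    case less
    show ?case
    proof (cases "Y = V")
      case False
      then obtain x where x: "x \<in> V" "x \<notin> Y" using less by auto
      then have xc: "x \<in> carrier G" using assms S_carrier by auto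
      note e = extend_coset[OF assms(1) less(2,4) xc x(2)]
      let ?Z = "sp (Y \<union> (x \<cdot> H))"
      have Z: "?Z \<in> S" using less xc assms coset_S Un_sp_S subfD by auto
      have ZX: "?Z \<subseteq> V" using coset_subset[of H V x] assms x less subfD S_carrier by (intro sp_least) auto
      show ?thesis
        by (rule less(1)[OF _ Z ZX e(2)])
           (use e(1) less(5) d_mono[OF Z assms(2) ZX] subfD(6)[OF assms(1)] in auto)
    qed (use less in auto)
  qed
  from this[OF empty_S] show ?thesis by (auto simp: stable_def d_empty)
qed

end

section \<open>Kneser's theorem\<close>

text \<open>
  If the bound on \<open>dim C + dim (stab C)\<close> failed to pass from two parts to their sum, then for the orthogonal
  complements \<open>N\<^sub>1\<close>, \<open>N\<^sub>2\<close> of the two parts these inequalities would hold with \<open>s\<close>, \<open>t\<close>, \<open>u\<close> the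
  dimensions of the two stabilizers and of their intersection, \<open>a\<close> and \<open>b\<close> the codimensions of
  \<open>N\<^sub>1 \<inter> N\<^sub>2\<close> in \<open>N\<^sub>1\<close> and \<open>N\<^sub>2\<close>, and \<open>j\<close> the number of further translates of \<open>N\<^sub>1\<close> needed to reach the
  largest subspace of \<open>N\<^sub>1\<close> stable under the other stabilizer.
\<close>

definition gapless :: "nat \<Rightarrow> bool" where
  "gapless m \<longleftrightarrow> (\<forall>s t u j a b. s dvd m \<longrightarrow> t dvd m \<longrightarrow> u dvd s \<longrightarrow> u dvd t \<longrightarrow> 0 < u \<longrightarrow> t < s \<longrightarrow>
     2 \<le> j \<longrightarrow> t dvd (j + 1) * s \<longrightarrow> j * (s - b) \<le> a \<longrightarrow> a + u < s \<longrightarrow> b + u < t \<longrightarrow> False)"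

lemma dvd_less_add_le:
  fixes a b k :: nat
  assumes "k dvd a" "k dvd b" "a < b" shows "a + k \<le> b"
proof -
  have "k \<le> b - a" using assms by (intro dvd_imp_le dvd_diff_nat) auto
  then show ?thesis using assms(3) by simp
qed

context dim_group
begin

section \<open>Points, hyperplanes and orthogonal complements\<close>

lemma stable_base: "V \<in> S \<Longrightarrow> stable (sp {\<one>}) V"
proof -
  assume V: "V \<in> S"
  have "x \<otimes> y \<in> V" if "x \<in> sp {\<one>}" "y \<in> V" for x y
  proof -
    have y: "y \<in> carrier G" using V that S_carrier by auto
    have "y \<otimes> x \<in> V" by (rule sp_image_le[OF y _ V _ that(1)]) (use y that in auto)
    then show ?thesis using y m_comm that sp_carrier[of "{\<one>}"] by (metis empty_subsetI insert_subset one_closed subsetD)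
  qed
  then show ?thesis by (auto simp: stable_def)
qed

text \<open>\<open>sp {\<one>}\<close> is the trivial subgroup for groups and the nonzero scalars
  for field extensions. It stabilizes every member of \<open>S\<close>, so its cosets serve as
  points of dimension one.\<close>

lemma subf_base: "subf (sp {\<one>})" "d (sp {\<one>}) = 1"
proof -
  have "sp {\<one>} \<in> S" by (rule sp_S) auto
  then show "subf (sp {\<one>})" using stable_base sp_superset[of "{\<one>}"] by (intro subf_closed) auto
  show "d (sp {\<one>}) = 1" using d_one unfolding sp_def .
qed

lemma add_point:
  assumes "V \<in> S" "x \<in> carrier G" "x \<notin> V"
  shows "sp (insert x V) \<in> S" "d (sp (insert x V)) = d V + 1"
proof -
  have Vc: "V \<subseteq> carrier G" using assms S_carrier by auto
  show S: "sp (insert x V) \<in> S" by (rule sp_S) (use Vc assms in auto)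
  note e = extend_coset[OF subf_base(1) assms(1) stable_base[OF assms(1)] assms(2,3)]
  have c: "x \<cdot> sp {\<one>} \<in> S" using assms coset_S subfD[OF subf_base(1)] by auto
  have "sp (insert x V) = sp (V \<union> x \<cdot> sp {\<one>})"
  proof
    have "x \<in> x \<cdot> sp {\<one>}" by (rule mem_own_coset[OF subf_base(1) assms(2)])
    then show "sp (insert x V) \<subseteq> sp (V \<union> x \<cdot> sp {\<one>})"
      using S_carrier[OF c] Vc by (intro sp_mono) auto
    have "x \<cdot> sp {\<one>} \<subseteq> sp (insert x V)"
      using sp_superset[of "insert x V"] S_carrier[OF S] subfD[OF subf_base(1)]
      by (intro coset_subset stable_base S) auto
    then show "sp (V \<union> x \<cdot> sp {\<one>}) \<subseteq> sp (insert x V)"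
      using sp_superset[of "insert x V"] S by (intro sp_least) auto
  qed
  with e subf_base show "d (sp (insert x V)) = d V + 1" by simp
qed

lemma hyperplane: "\<exists>Z\<in>S. d Z + 1 = n"
proof -
  let ?P = "\<lambda>Z. Z \<in> S \<and> Z \<noteq> carrier G"
  have "?P {}" using empty_S by auto
  moreover have "\<forall>Z. ?P Z \<longrightarrow> d Z < n + 1" using d_mono S_carrier carrier_S less_Suc_eq_le by auto
  ultimately obtain Z where Z: "?P Z" "\<forall>Y. ?P Y \<longrightarrow> d Y \<le> d Z"
    using ex_has_greatest_nat[of ?P "{}" d "n + 1"] by blast
  obtain x where x: "x \<in> carrier G" "x \<notin> Z" using Z S_carrier by blast
  note a = add_point[OF _ x]
  have "sp (insert x Z) = carrier G" using Z a by fastforce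
  then show ?thesis using a Z by auto
qed

text \<open>
  The orthogonal complement for the pairing defined by a hyperplane \<open>Z\<close>, which is the complement of a
  point in the case of groups. It turns sums of subspaces into intersections.
\<close>

definition perp :: "'a set \<Rightarrow> 'a set \<Rightarrow> 'a set" where
  "perp Z V = {y \<in> carrier G. \<forall>x\<in>V. y \<otimes> x \<in> Z}"

lemma perp_S: assumes "Z \<in> S" "V \<subseteq> carrier G" shows "perp Z V \<in> S"
proof -
  have eq: "perp Z V = \<Inter>(insert (carrier G) ((\<lambda>x. {y \<in> carrier G. x \<otimes> y \<in> Z}) ` V))"
    using assms m_comm by (auto simp: perp_def subset_iff)
  show ?thesis unfolding eq
    using assms by (intro Inter_S) (auto intro: carrier_S pre_S)
qed

lemma perp_mono: "V \<subseteq> W \<Longrightarrow> perp Z W \<subseteq> perp Z V"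
  by (auto simp: perp_def)

lemma perp_sp: assumes "Z \<in> S" "V \<subseteq> carrier G" shows "perp Z (sp V) = perp Z V"
  using sp_superset[of V] sp_image_le[OF _ assms(2,1)] by (auto simp: perp_def subset_iff)

text \<open>Adding a point to \<open>V\<close> cuts \<open>perp Z V\<close> with a translate of the
  hyperplane \<open>Z\<close>. This costs at most one dimension, while \<open>d V\<close> grows by
  exactly one, so \<open>d (perp Z V) + d V\<close> never decreases along a chain of points. It
  equals \<open>n\<close> at the empty set and at the whole group, hence everywhere.\<close>

lemma d_perp:
  assumes Z: "Z \<in> S" "d Z + 1 = n" and V: "V \<in> S"
  shows "d (perp Z V) + d V = n"
proof -
  have drop: "d (perp Z Y) \<le> d (perp Z (sp (insert x Y))) + 1" if "Y \<in> S" "x \<in> carrier G" for Y x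
  proof -
    have Yc: "Y \<subseteq> carrier G" using that S_carrier by auto
    have eq: "perp Z (sp (insert x Y)) = perp Z Y \<inter> {y \<in> carrier G. x \<otimes> y \<in> Z}"
      using that Yc m_comm by (subst perp_sp[OF Z(1)]) (auto simp: perp_def)
    have "d (perp Z Y \<inter> {y \<in> carrier G. x \<otimes> y \<in> Z}) + d (sp (perp Z Y \<union> {y \<in> carrier G. x \<otimes> y \<in> Z}))
        = d (perp Z Y) + d Z"
      using that Z Yc d_pre[OF that(2) Z(1)] by (subst d_mod) (auto intro: perp_S pre_S)
    moreover have "d (sp (perp Z Y \<union> {y \<in> carrier G. x \<otimes> y \<in> Z})) \<le> n"
      by (intro d_mono carrier_S sp_S sp_carrier) (auto simp: perp_def)
    ultimately show ?thesis using eq Z by simp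
  qed
  have top: "perp Z (carrier G) = {}"
  proof (rule ccontr)
    assume "perp Z (carrier G) \<noteq> {}"
    then obtain y where y: "y \<in> carrier G" "\<And>x. x \<in> carrier G \<Longrightarrow> y \<otimes> x \<in> Z" by (auto simp: perp_def)
    have "z \<in> Z" if "z \<in> carrier G" for z
      using y(2)[of "inv y \<otimes> z"] that y(1) by (simp add: m_assoc[symmetric])
    then have "Z = carrier G" using Z S_carrier by blast
    then show False using Z by simp
  qed
  have up: "d (perp Z Y) + d Y \<le> n" if "Y \<in> S" for Y using that
  proof (induction "n - d Y" arbitrary: Y rule: less_induct)
    case less
    show ?case
    proof (cases "Y = carrier G")
      case False
      then obtain x where x: "x \<in> carrier G" "x \<notin> Y" using less S_carrier by blast
      note a = add_point[OF less(2) x]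
      have "d (sp (insert x Y)) \<le> n" using d_mono[OF a(1) carrier_S S_carrier[OF a(1)]] .
      then have "d (perp Z (sp (insert x Y))) + d (sp (insert x Y)) \<le> n"
        using less(1)[OF _ a(1)] a(2) by simp
      then show ?thesis using drop[OF less(2) x(1)] a by simp
    qed (use top d_empty in simp)
  qed
  have low: "n \<le> d (perp Z V) + d V" if "Y \<in> S" "Y \<subseteq> V" "n \<le> d (perp Z Y) + d Y" for Y using that
  proof (induction "d V - d Y" arbitrary: Y rule: less_induct)
    case less
    show ?case
    proof (cases "Y = V")
      case False
      then obtain x where x: "x \<in> V" "x \<notin> Y" using less by auto
      then have xc: "x \<in> carrier G" using V S_carrier by auto
      note a = add_point[OF less(2) xc x(2)]
      have s: "sp (insert x Y) \<subseteq> V" using x less V by (intro sp_least) auto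
      show ?thesis
        by (rule less(1)[OF _ a(1) s]) (use drop[OF less(2) xc] less(4) a(2) d_mono[OF a(1) V s] in auto)
    qed (use less in simp)
  qed
  have "perp Z {} = carrier G" by (auto simp: perp_def)
  then show ?thesis using up[OF V] low[OF empty_S] d_empty by simp
qed

lemma perp_perp:
  assumes "Z \<in> S" "d Z + 1 = n" "V \<in> S" shows "perp Z (perp Z V) = V"
proof -
  have Vc: "V \<subseteq> carrier G" using assms S_carrier by auto
  have P: "perp Z V \<in> S" "perp Z (perp Z V) \<in> S" using assms Vc S_carrier perp_S by auto
  have "V \<subseteq> perp Z (perp Z V)" using Vc by (auto simp: perp_def subset_iff) (metis m_comm)
  then show ?thesis using d_eq[of V "perp Z (perp Z V)"] assms P d_perp[of Z V] d_perp[of Z "perp Z V"] by auto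
qed

lemma perp_Un: "Z \<in> S \<Longrightarrow> V \<in> S \<Longrightarrow> W \<in> S \<Longrightarrow> perp Z (sp (V \<union> W)) = perp Z V \<inter> perp Z W"
  using S_carrier[of V] S_carrier[of W] by (subst perp_sp) (auto simp: perp_def)

lemma stable_perp:
  assumes "stable H V" "H \<subseteq> carrier G" "V \<subseteq> carrier G" shows "stable H (perp Z V)"
proof -
  have "h \<otimes> y \<otimes> x = y \<otimes> (h \<otimes> x)" if "h \<in> H" "y \<in> carrier G" "x \<in> V" for h y x
  proof -
    have "h \<in> carrier G" "x \<in> carrier G" using that assms by auto
    then show ?thesis using that m_comm[of h y] m_assoc[of y h x] by simp
  qed
  then show ?thesis using assms by (auto simp: stable_def perp_def)
qed

text \<open>By \<open>b\<close>, the coset \<open>x \<cdot> T\<close> inside \<open>N2\<close> meets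
  \<open>N1\<close> in more than \<open>d (A \<inter> T)\<close> dimensions. A point
  \<open>v\<close> of the intersection is outside \<open>D\<close>, because \<open>D\<close> is
  stable under \<open>T\<close> and does not contain \<open>x\<close>. So the coset of
  \<open>v\<close> modulo \<open>A \<bullet> T\<close> avoids \<open>D\<close>, which leaves only
  \<open>d A\<close> dimensions for its part in \<open>N1\<close>, and \<open>v \<cdot> A\<close>
  already fills them. Hence \<open>N1\<close> and \<open>x \<cdot> T\<close> meet inside
  \<open>v \<cdot> (A \<inter> T)\<close>, which is too small.\<close>

lemma one_step_contra:
  assumes A: "subf A" and T: "subf T" and N1: "N1 \<in> S" and N2: "N2 \<in> S" "stable T N2"
    and D: "D \<in> S" "D \<subseteq> N1" "stable A D" "stable T D" "stable A N1" "d N1 = d D + d A"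
    and x: "x \<in> N2" "x \<notin> N1"
    and b: "d N2 + d (A \<inter> T) < d (N1 \<inter> N2) + d T"
  shows False
proof -
  note a = subfD[OF A] and t = subfD[OF T]
  have c: "N1 \<subseteq> carrier G" "N2 \<subseteq> carrier G" "D \<subseteq> carrier G" using S_carrier N1 N2 D by auto
  have xc: "x \<in> carrier G" using x c by auto
  have xT: "x \<cdot> T \<in> S" "d (x \<cdot> T) = d T" using coset_S d_coset xc t by auto
  have xT2: "x \<cdot> T \<subseteq> N2" using coset_subset[OF N2(2) x(1)] c t by auto
  have V: "N1 \<inter> N2 \<in> S" using N1 N2 Int_S by auto
  have I: "N1 \<inter> N2 \<inter> x \<cdot> T \<in> S" using V xT Int_S by auto
  have "d (N1 \<inter> N2 \<inter> x \<cdot> T) + d (sp (N1 \<inter> N2 \<union> x \<cdot> T)) = d (N1 \<inter> N2) + d T"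
    using d_mod[OF V xT(1)] xT by simp
  moreover have "d (sp (N1 \<inter> N2 \<union> x \<cdot> T)) \<le> d N2"
    using V xT xT2 N2 by (intro d_mono sp_least Un_sp_S) auto
  ultimately have big: "d (A \<inter> T) < d (N1 \<inter> N2 \<inter> x \<cdot> T)" using b by linarith
  then obtain v where v: "v \<in> N1" "v \<in> x \<cdot> T" using d_empty by (metis Int_iff all_not_in_conv not_less0)
  have vc: "v \<in> carrier G" using v c by auto
  obtain t0 where t0: "t0 \<in> T" "v = x \<otimes> t0" using v by (auto simp: l_coset_def)
  have t0c: "t0 \<in> carrier G" using t0 t by auto
  have xv: "x = v \<otimes> inv t0" using t0 t0c xc by (simp add: m_assoc)
  have vD: "v \<notin> D"
  proof
    assume "v \<in> D"
    then have "inv t0 \<otimes> v \<in> D" using D(4) t(9)[OF t0(1)] by (auto simp: stable_def)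
    then have "x \<in> D" using xv m_comm[of v "inv t0"] vc t0c by simp
    then show False using x D by auto
  qed
  have vT: "x \<cdot> T \<subseteq> v \<cdot> T"
  proof
    fix y assume "y \<in> x \<cdot> T"
    then obtain k where k: "k \<in> T" "y = x \<otimes> k" by (auto simp: l_coset_def)
    have "y = v \<otimes> (inv t0 \<otimes> k)" using k xv t t0c vc by (auto simp: m_assoc subset_iff)
    moreover have "inv t0 \<otimes> k \<in> T" using t(8,9) k t0 by auto
    ultimately show "y \<in> v \<cdot> T" by (auto simp: l_coset_def)
  qed
  define P where "P = A \<bullet> T"
  have P: "subf P" "stable P D"
    unfolding P_def using prod_subf[OF A T] stable_prodI[OF a(3) t(3) D(1) D(3) D(4)] by auto
  have AP: "A \<subseteq> P" "T \<subseteq> P" unfolding P_def using subset_prod' subset_prod a t by auto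
  have vP: "v \<cdot> P \<in> S" using P vc coset_S subfD by auto
  define Y where "Y = N1 \<inter> v \<cdot> P"
  have Y: "Y \<in> S" unfolding Y_def using N1 vP Int_S by auto
  have "Y \<inter> D = {}" using coset_disjoint[OF P c(3) vc vD] unfolding Y_def by auto
  then have "d (sp (D \<union> Y)) = d D + d Y" using d_Un_disjoint[of D Y] D Y by auto
  moreover have "d (sp (D \<union> Y)) \<le> d N1" using D Y N1 by (intro d_mono sp_least Un_sp_S) (auto simp: Y_def)
  ultimately have "d Y \<le> d A" using D by simp
  moreover have "v \<cdot> A \<subseteq> Y" unfolding Y_def
    using coset_subset[OF D(5) v(1)] c a AP by (auto simp: l_coset_def)
  moreover have "v \<cdot> A \<in> S" "d (v \<cdot> A) = d A" using coset_S d_coset a vc by auto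
  ultimately have "v \<cdot> A = Y" using d_eq Y by simp
  moreover have "v \<cdot> T \<subseteq> v \<cdot> P" using AP by (auto simp: l_coset_def)
  ultimately have "N1 \<inter> N2 \<inter> x \<cdot> T \<subseteq> v \<cdot> A \<inter> v \<cdot> T" using vT unfolding Y_def by blast
  also have "\<dots> \<subseteq> v \<cdot> (A \<inter> T)"
    using mem_coset[OF vc a(3)] mem_coset[OF vc t(3)] mem_coset[OF vc, of "A \<inter> T"] a(3) by auto
  finally have "d (N1 \<inter> N2 \<inter> x \<cdot> T) \<le> d (v \<cdot> (A \<inter> T))"
    using a t vc Int_S I by (intro d_mono coset_S) auto
  then show False using big d_coset[OF vc Int_S[OF a(1) t(1)]] by simp
qed

section \<open>Intersections of translates\<close>

definition translates :: "'a set \<Rightarrow> 'a list \<Rightarrow> 'a set" where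
  "translates N ts = {y \<in> N. \<forall>\<tau>\<in>set ts. \<tau> \<otimes> y \<in> N}"

lemma translates_Cons: "N \<subseteq> carrier G \<Longrightarrow> translates N (\<tau> # ts) = translates N ts \<inter> (N \<inter> {y \<in> carrier G. \<tau> \<otimes> y \<in> N})"
  by (auto simp: translates_def)

lemma translates_Nil: "translates N [] = N"
  by (auto simp: translates_def)

lemma translates_S: "N \<in> S \<Longrightarrow> set ts \<subseteq> carrier G \<Longrightarrow> translates N ts \<in> S"
  by (induction ts) (auto simp: translates_Nil translates_Cons S_carrier intro!: Int_S pre_S)

lemma stable_pre:
  assumes "H \<subseteq> carrier G" "stable H N" "\<tau> \<in> carrier G"
  shows "stable H {y \<in> carrier G. \<tau> \<otimes> y \<in> N}"
proof -
  have "\<tau> \<otimes> (h \<otimes> y) = h \<otimes> (\<tau> \<otimes> y)" if "h \<in> H" "y \<in> carrier G" for h y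
    using that assms m_lcomm by auto
  then show ?thesis using assms by (auto simp: stable_def)
qed

lemma stable_translates:
  "H \<subseteq> carrier G \<Longrightarrow> stable H N \<Longrightarrow> N \<subseteq> carrier G \<Longrightarrow> set ts \<subseteq> carrier G \<Longrightarrow> stable H (translates N ts)"
  by (induction ts) (auto simp: translates_Nil translates_Cons intro!: stable_Int stable_pre)

text \<open>For a subgroup \<open>T\<close> this is the largest \<open>T\<close>-stable subset of
  \<open>N\<close>.\<close>

definition core :: "'a set \<Rightarrow> 'a set \<Rightarrow> 'a set" where
  "core T N = {y \<in> N. \<forall>\<tau>\<in>T. \<tau> \<otimes> y \<in> N}"

lemma stable_core:
  assumes "subf T" "N \<subseteq> carrier G" shows "stable T (core T N)"
proof -
  note t = subfD[OF assms(1)]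
  have "\<tau> \<otimes> (\<sigma> \<otimes> y) \<in> N" if "\<tau> \<in> T" "\<sigma> \<in> T" "y \<in> core T N" for \<tau> \<sigma> y
  proof -
    have "\<tau> \<otimes> (\<sigma> \<otimes> y) = (\<tau> \<otimes> \<sigma>) \<otimes> y" using that assms t by (auto simp: core_def m_assoc subset_iff)
    then show ?thesis using that t(8) by (auto simp: core_def)
  qed
  then show ?thesis by (auto simp: stable_def core_def)
qed

text \<open>Take a longest list in which each translate costs at least \<open>d A\<close>. If its
  intersection were larger than the core, one more translate would cut it properly, and again by at
  least \<open>d A\<close>, since all intersections are stable under \<open>A\<close> and have
  dimensions divisible by \<open>d A\<close>.\<close>

lemma translates_core:
  assumes "subf A" "subf T" "N \<in> S" "stable A N"
  obtains ts where "set ts \<subseteq> T" "translates N ts = core T N" "d (core T N) + length ts * d A \<le> d N"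
proof -
  note t = subfD[OF assms(2)] and a = subfD[OF assms(1)]
  have Nc: "N \<subseteq> carrier G" using assms S_carrier by auto
  let ?P = "\<lambda>ts. set ts \<subseteq> T \<and> d (translates N ts) + length ts * d A \<le> d N"
  have "?P []" by (simp add: translates_Nil)
  moreover have "\<forall>ts. ?P ts \<longrightarrow> length ts < d N + 1"
  proof (intro allI impI)
    fix ts assume "?P ts"
    then have "length ts * d A \<le> d N" by simp
    moreover have "length ts * 1 \<le> length ts * d A" using a(6) by (intro mult_le_mono) auto
    ultimately show "length ts < d N + 1" by linarith
  qed
  ultimately obtain ts where ts: "?P ts" "\<forall>us. ?P us \<longrightarrow> length us \<le> length ts"
    using ex_has_greatest_nat[of ?P "[]" length "d N + 1"] by blast
  have tc: "set ts \<subseteq> carrier G" using ts t by auto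
  have "translates N ts = core T N"
  proof (rule ccontr)
    assume ne: "translates N ts \<noteq> core T N"
    have "core T N \<subseteq> translates N ts" using ts by (auto simp: core_def translates_def)
    then obtain y \<tau> where y: "y \<in> translates N ts" "\<tau> \<in> T" "\<tau> \<otimes> y \<notin> N"
      using ne by (auto simp: core_def translates_def)
    have sub: "translates N (\<tau> # ts) \<subset> translates N ts" using y by (auto simp: translates_def)
    have S2: "translates N (\<tau> # ts) \<in> S" "translates N ts \<in> S"
      using y t tc assms by (auto intro!: translates_S)
    have "d A dvd d (translates N (\<tau> # ts))" "d A dvd d (translates N ts)"
      using S2 assms tc y t Nc a by (auto intro!: d_dvd[OF assms(1)] stable_translates)
    moreover have "d (translates N (\<tau> # ts)) < d (translates N ts)" using d_strict S2 sub by auto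
    ultimately have "d (translates N (\<tau> # ts)) + d A \<le> d (translates N ts)"
      by (rule dvd_less_add_le)
    then have "?P (\<tau> # ts)" using ts y by auto
    then show False using ts(2) by fastforce
  qed
  then show ?thesis using that ts by auto
qed

text \<open>Translates of \<open>N \<inter> M\<close> by elements of \<open>T\<close> stay inside
  \<open>M\<close> and keep their dimension, so the codimensions in \<open>M\<close> at most add
  up.\<close>

lemma translates_lower:
  assumes "subf T" "N \<in> S" "M \<in> S" "stable T M" "set ts \<subseteq> T"
  shows "d (N \<inter> M) + length ts * d (N \<inter> M) \<le> d (translates N ts \<inter> M) + length ts * d M"
  using assms(5)
proof (induction ts)
  case (Cons \<tau> ts)
  note t = subfD[OF assms(1)]
  have c: "N \<subseteq> carrier G" "M \<subseteq> carrier G" using assms S_carrier by auto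
  have \<tau>: "\<tau> \<in> T" "\<tau> \<in> carrier G" using Cons t by auto
  let ?Q = "{y \<in> carrier G. \<tau> \<otimes> y \<in> N \<inter> M}"
  have pm: "\<tau> \<otimes> y \<in> M \<longleftrightarrow> y \<in> M" if "y \<in> carrier G" for y
  proof
    assume "\<tau> \<otimes> y \<in> M"
    then have "inv \<tau> \<otimes> (\<tau> \<otimes> y) \<in> M" using assms(4) t(9)[OF \<tau>(1)] by (auto simp: stable_def)
    then show "y \<in> M" using that \<tau> by (simp add: m_assoc[symmetric])
  qed (use assms \<tau> in \<open>auto simp: stable_def\<close>)
  have Q: "?Q \<in> S" "d ?Q = d (N \<inter> M)"
    using pre_S[OF \<tau>(2) Int_S[OF assms(2,3)]] d_pre[OF \<tau>(2) Int_S[OF assms(2,3)]] by auto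
  have W: "translates N ts \<inter> M \<in> S" using assms Cons t by (auto intro!: translates_S Int_S)
  have "translates N (\<tau> # ts) \<inter> M = (translates N ts \<inter> M) \<inter> ?Q"
    using c pm by (auto simp: translates_def)
  moreover have "d ((translates N ts \<inter> M) \<inter> ?Q) + d (sp ((translates N ts \<inter> M) \<union> ?Q)) = d (translates N ts \<inter> M) + d (N \<inter> M)"
    using d_mod[OF W Q(1)] Q(2) by simp
  moreover have "d (sp ((translates N ts \<inter> M) \<union> ?Q)) \<le> d M"
    using W Q assms pm by (intro d_mono sp_least Un_sp_S) auto
  moreover have "d (N \<inter> M) + length ts * d (N \<inter> M) \<le> d (translates N ts \<inter> M) + length ts * d M"
    using Cons by auto
  ultimately show ?case by simp
qed (simp add: translates_Nil)

text \<open>Here the codimensions in \<open>N\<close> add up. Combined with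
  \<open>translates_core\<close>, for \<open>s = d A\<close>, every translate costs exactly
  \<open>d A\<close>.\<close>

lemma translates_upper:
  assumes "N \<in> S" "set (us @ ts) \<subseteq> carrier G"
    and "\<And>\<tau>. \<tau> \<in> set us \<Longrightarrow> d N \<le> d (N \<inter> {y \<in> carrier G. \<tau> \<otimes> y \<in> N}) + s"
  shows "d (translates N ts) \<le> d (translates N (us @ ts)) + length us * s"
  using assms(2,3)
proof (induction us)
  case (Cons \<tau> us)
  let ?Q = "N \<inter> {y \<in> carrier G. \<tau> \<otimes> y \<in> N}"
  have c: "N \<subseteq> carrier G" using assms S_carrier by auto
  have Q: "?Q \<in> S" using assms Cons pre_S Int_S by auto
  have W: "translates N (us @ ts) \<in> S" using assms Cons by (auto intro!: translates_S)
  have "d (translates N (us @ ts) \<inter> ?Q) + d (sp (translates N (us @ ts) \<union> ?Q)) = d (translates N (us @ ts)) + d ?Q"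
    using d_mod[OF W Q] .
  moreover have "d (sp (translates N (us @ ts) \<union> ?Q)) \<le> d N"
    using W Q assms by (intro d_mono sp_least Un_sp_S) (auto simp: translates_def)
  moreover have "translates N ((\<tau> # us) @ ts) = translates N (us @ ts) \<inter> ?Q"
    using translates_Cons[OF c, of \<tau> "us @ ts"] by simp
  moreover have "d N \<le> d ?Q + s" using Cons by auto
  moreover have "d (translates N ts) \<le> d (translates N (us @ ts)) + length us * s" using Cons by auto
  ultimately show ?case by simp
qed simp

end

section \<open>The bound passes from two parts to their sum\<close>

context dim_group
begin

lemma subset_of_sum:
  assumes "N \<in> S" "P \<in> S" "Q \<in> S" "E \<in> S" "P \<subseteq> N" "Q \<subseteq> N" "P \<subseteq> E" "Q \<subseteq> E" "R \<in> S" "P \<inter> Q \<subseteq> R"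
    "d N + d R \<le> d P + d Q"
  shows "N \<subseteq> E"
proof -
  have U: "sp (P \<union> Q) \<in> S" using assms Un_sp_S by auto
  have "d (P \<inter> Q) \<le> d R" using assms Int_S d_mono by auto
  then have "d N \<le> d (sp (P \<union> Q))" using d_mod[OF assms(2,3)] assms(11) by simp
  moreover have "sp (P \<union> Q) \<subseteq> N" using assms sp_least by auto
  ultimately have "sp (P \<union> Q) = N" using d_eq U assms by auto
  moreover have "sp (P \<union> Q) \<subseteq> E" using assms sp_least by auto
  ultimately show ?thesis by auto
qed

text \<open>Subspaces of equal dimension meeting pairwise in codimension \<open>\<le> s\<close>: if three of them do not
  share their intersection, then all lie in the sum of two of them.\<close>

lemma translates_span:
  assumes A: "subf A" and T: "subf T" and N: "N \<in> S" "stable A N"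
    and meet: "\<And>\<tau>. \<tau> \<in> T \<Longrightarrow> d N \<le> d (N \<inter> {y \<in> carrier G. \<tau> \<otimes> y \<in> N}) + d A"
    and three: "\<sigma>1 \<in> T" "\<sigma>2 \<in> T" "d (translates N [\<sigma>1, \<sigma>2]) + 2 * d A \<le> d N"
  obtains E where "E \<in> S" "stable A E" "stable T E" "N \<subseteq> E" "d E = d N + d A"
proof -
  note t = subfD[OF T] and a = subfD[OF A]
  have Nc: "N \<subseteq> carrier G" using N S_carrier by auto
  define f where "f \<tau> = {y \<in> carrier G. \<tau> \<otimes> y \<in> N}" for \<tau>
  have f: "f \<tau> \<in> S" "d (f \<tau>) = d N" "stable A (f \<tau>)" if "\<tau> \<in> T" for \<tau>
    using that t N a unfolding f_def by (auto intro: pre_S d_pre stable_pre)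
  have f1: "f \<one> = N" using Nc by (auto simp: f_def)
  have meet2: "d N \<le> d (f \<sigma> \<inter> f \<tau>) + d A" if "\<sigma> \<in> T" "\<tau> \<in> T" for \<sigma> \<tau>
  proof -
    have c: "\<sigma> \<in> carrier G" "\<tau> \<in> carrier G" using that t by auto
    have \<rho>: "\<tau> \<otimes> inv \<sigma> \<in> T" using that t by auto
    have "(\<tau> \<otimes> inv \<sigma>) \<otimes> (\<sigma> \<otimes> y) = \<tau> \<otimes> y" if "y \<in> carrier G" for y
    proof -
      have "inv \<sigma> \<otimes> (\<sigma> \<otimes> y) = y" using that c by (simp add: m_assoc[symmetric])
      then show ?thesis using that c by (simp add: m_assoc)
    qed
    then have "f \<sigma> \<inter> f \<tau> = {y \<in> carrier G. \<sigma> \<otimes> y \<in> N \<inter> f (\<tau> \<otimes> inv \<sigma>)}"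
      using c by (auto simp: f_def)
    then have "d (f \<sigma> \<inter> f \<tau>) = d (N \<inter> f (\<tau> \<otimes> inv \<sigma>))" using d_pre[OF c(1) Int_S[OF N(1) f(1)[OF \<rho>]]] by simp
    then show ?thesis using meet[OF \<rho>] by (simp add: f_def)
  qed
  define R where "R = translates N [\<sigma>1, \<sigma>2]"
  have R: "R = N \<inter> f \<sigma>1 \<inter> f \<sigma>2" unfolding R_def translates_def f_def using Nc by auto
  have RS: "R \<in> S" unfolding R using N f three Int_S by auto
  define E where "E = sp (N \<union> f \<sigma>1)"
  have E: "E \<in> S" "N \<subseteq> E" "f \<sigma>1 \<subseteq> E" unfolding E_def
    using N f three Un_sp_S sp_superset[of "N \<union> f \<sigma>1"] by auto
  have EA: "stable A E" unfolding E_def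
    using a N f three S_carrier by (intro stable_sp_Un) auto
  have one: "\<one> \<in> T" using t by auto
  have "R \<subseteq> N \<inter> f \<sigma>1" unfolding R by auto
  moreover have sum1: "d (N \<inter> f \<sigma>1) + d E = d N + d N"
    unfolding E_def using d_mod[OF N(1) f(1)[OF three(1)]] f(2)[OF three(1)] by simp
  have dvdN: "d A dvd d N" using d_dvd[OF A N] .
  \<comment> \<open>\<open>f \<sigma>2\<close> meets \<open>N\<close> and \<open>f \<sigma>1\<close>
    in codimension at most \<open>d A\<close> each, and both intersections together share only
    \<open>R\<close>, of codimension at least \<open>2 * d A\<close>. So the two intersections span
    \<open>f \<sigma>2\<close>.\<close>
  have f2E: "f \<sigma>2 \<subseteq> E"
  proof (rule subset_of_sum[of _ "N \<inter> f \<sigma>2" "f \<sigma>1 \<inter> f \<sigma>2" E R])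
    show "d (f \<sigma>2) + d R \<le> d (N \<inter> f \<sigma>2) + d (f \<sigma>1 \<inter> f \<sigma>2)"
      using meet2[OF one three(2)] meet2[OF three(1,2)] f(2)[OF three(2)] three(3) unfolding R_def f1 by simp
  qed (use f three N E RS Int_S in \<open>auto simp: R\<close>)
  \<comment> \<open>If \<open>f \<tau>\<close> leaves \<open>E\<close>, then
    \<open>f \<tau> \<inter> E\<close> has codimension at least \<open>d A\<close> in
    \<open>f \<tau>\<close>, so each of \<open>N\<close>, \<open>f \<sigma>1\<close>,
    \<open>f \<sigma>2\<close> meets \<open>f \<tau>\<close> in exactly this subspace. It would then
    lie in \<open>R\<close>, which is smaller.\<close>
  have all: "f \<tau> \<subseteq> E" if "\<tau> \<in> T" for \<tau>
  proof (rule ccontr)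
    assume not: "\<not> f \<tau> \<subseteq> E"
    define W where "W = f \<tau> \<inter> E"
    have W: "W \<in> S" "stable A W" unfolding W_def using f[OF that] E EA Int_S stable_Int by auto
    have "d W < d N" using d_strict[of W "f \<tau>"] not f[OF that] W unfolding W_def by auto
    moreover have "d A dvd d W" using d_dvd[OF A W] .
    ultimately have "d W + d A \<le> d N" using dvdN dvd_less_add_le by blast
    then have eq: "f \<sigma> \<inter> f \<tau> = W" if "\<sigma> \<in> T" "f \<sigma> \<subseteq> E" for \<sigma>
      using meet2[OF that(1) \<open>\<tau> \<in> T\<close>] f[OF \<open>\<tau> \<in> T\<close>] f[OF that(1)] that W
      by (intro d_eq Int_S) (auto simp: W_def)
    have "W \<subseteq> R" using eq[OF one] eq[OF three(1)] eq[OF three(2)] E f2E f1 unfolding R by auto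
    then have "d W \<le> d R" using d_mono W RS by auto
    moreover have "d N \<le> d W + d A" using meet2[OF one that] eq[OF one] E f1 by simp
    ultimately show False using three(3) a(6) unfolding R_def by simp
  qed
  have ET: "stable T E" unfolding E_def
  proof (rule stable_sp)
    fix h x assume h: "h \<in> T" "x \<in> N \<union> f \<sigma>1"
    have hc: "h \<in> carrier G" "inv h \<in> T" using h t by auto
    have "h \<otimes> x \<in> f (inv h) \<union> f (\<sigma>1 \<otimes> inv h)"
    proof (cases "x \<in> N")
      case True
      then show ?thesis using hc Nc by (auto simp: f_def m_assoc[symmetric] subset_iff)
    next
      case False
      then have x: "x \<in> carrier G" "\<sigma>1 \<otimes> x \<in> N" using h by (auto simp: f_def)
      have "inv h \<otimes> (h \<otimes> x) = x" using x hc by (simp add: m_assoc[symmetric])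
      moreover have "\<sigma>1 \<in> carrier G" using three t by auto
      ultimately have "(\<sigma>1 \<otimes> inv h) \<otimes> (h \<otimes> x) = \<sigma>1 \<otimes> x" using hc x by (simp add: m_assoc)
      then show ?thesis using x hc by (auto simp: f_def)
    qed
    then show "h \<otimes> x \<in> sp (N \<union> f \<sigma>1)" using all[of "inv h"] all[of "\<sigma>1 \<otimes> inv h"] hc three t unfolding E_def by auto
  qed (use t Nc in \<open>auto simp: f_def\<close>)
  have "d E \<le> d N + d A" using sum1 meet2[OF one three(1)] f1 by simp
  moreover have "d N + d A \<le> d E"
  proof -
    have "E \<noteq> N"
    proof
      assume "E = N"
      then have "f \<sigma>1 = N" "f \<sigma>2 = N"
        using E(3) f2E d_eq[OF f(1) N(1)] f(2) three by auto
      then have "R = N" unfolding R by simp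
      then show False using three(3) a(6) unfolding R_def by simp
    qed
    then have "d N < d E" using d_strict N E by blast
    moreover have "d A dvd d E" using d_dvd[OF A E(1) EA] .
    ultimately show ?thesis using dvdN dvd_less_add_le by blast
  qed
  ultimately show ?thesis using that E EA ET by auto
qed

text \<open>Let \<open>j\<close> be the number of translates that cut \<open>N1\<close> down to its
  core. If \<open>j = 0\<close>, then \<open>N1\<close> is stable under \<open>T\<close>, and a
  whole coset of \<open>T\<close> fits into \<open>N2\<close> beside \<open>N1 \<inter> N2\<close>.
  If \<open>j = 1\<close>, there is one step of size \<open>d A\<close> above a subspace stable
  under both stabilizers. If \<open>j \<ge> 2\<close>, the last two translates satisfy the
  hypotheses of \<open>translates_span\<close>, which puts such a subspace \<open>E\<close> one step
  above \<open>N1\<close>.\<close>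

lemma incomparable_contra:
  assumes gap: "gapless n" and A: "subf A" and T: "subf T" and TA: "d T \<le> d A"
    and N1: "N1 \<in> S" "stable A N1" and N2: "N2 \<in> S" "stable T N2"
    and a: "d N1 + d (A \<inter> T) < d (N1 \<inter> N2) + d A"
    and b: "d N2 + d (A \<inter> T) < d (N1 \<inter> N2) + d T"
    and ne: "\<not> N1 \<subseteq> N2" "\<not> N2 \<subseteq> N1"
  shows False
proof -
  note t = subfD[OF T] and aa = subfD[OF A]
  have c: "N1 \<subseteq> carrier G" "N2 \<subseteq> carrier G" using N1 N2 S_carrier by auto
  obtain ts where ts: "set ts \<subseteq> T" "translates N1 ts = core T N1" "d (core T N1) + length ts * d A \<le> d N1"
    using translates_core[OF A T N1] .
  define D where "D = core T N1"
  have tc: "set ts \<subseteq> carrier G" using ts t by auto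
  have D: "D \<in> S" "stable A D" "stable T D" "D \<subseteq> N1"
    using stable_core[OF T c(1)] ts translates_S[OF N1(1) tc] stable_translates[OF aa(3) N1(2) c(1) tc]
    unfolding D_def by (auto simp: core_def)
  obtain x where x: "x \<in> N2" "x \<notin> N1" using ne by auto
  have V: "N1 \<inter> N2 \<in> S" using N1 N2 Int_S by auto
  have Vle: "d (N1 \<inter> N2) \<le> d N1" "d (N1 \<inter> N2) \<le> d N2" using V N1 N2 d_mono by auto
  \<comment> \<open>From \<open>a\<close>, \<open>b\<close> and \<open>TA\<close> the loss is below
    \<open>2 * d A\<close>; being a multiple of \<open>d A\<close>, it is at most
    \<open>d A\<close>.\<close>
  have meet: "d N1 \<le> d (N1 \<inter> {y \<in> carrier G. \<tau> \<otimes> y \<in> N1}) + d A" if "\<tau> \<in> T" for \<tau>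
  proof -
    let ?Q = "N1 \<inter> {y \<in> carrier G. \<tau> \<otimes> y \<in> N1}"
    have \<tau>: "\<tau> \<in> carrier G" using that t by auto
    have Q: "?Q \<in> S" "stable A ?Q" using N1 \<tau> pre_S Int_S stable_Int stable_pre aa by auto
    have "d (N1 \<inter> N2) + d (N1 \<inter> N2) \<le> d (?Q \<inter> N2) + d N2"
      using translates_lower[OF T N1(1) N2, of "[\<tau>]"] that c by (auto simp: translates_Nil translates_Cons)
    moreover have "d (?Q \<inter> N2) \<le> d ?Q" using Q N2 Int_S d_mono by auto
    ultimately have "d N1 < d ?Q + 2 * d A" using a b TA by linarith
    moreover have "d ?Q \<le> d N1" using Q N1 d_mono by auto
    moreover obtain k l where "d ?Q = d A * k" "d N1 = d A * l"
      using d_dvd[OF A Q] d_dvd[OF A N1] by (metis dvdE)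
    ultimately have "d A * l < d A * (k + 2)" "d N1 = d A * l" "d ?Q = d A * k" by (auto simp: algebra_simps)
    then have "l < k + 2" by (simp only: mult_less_cancel1)
    then have "l \<le> k + 1" by simp
    then have "d A * l \<le> d A * (k + 1)" by (rule mult_le_mono2)
    then show ?thesis using \<open>d N1 = d A * l\<close> \<open>d ?Q = d A * k\<close> by simp
  qed
  define j where "j = length ts"
  have exact: "d D + j * d A = d N1"
  proof -
    have "d (translates N1 []) \<le> d (translates N1 (ts @ [])) + length ts * d A"
      by (rule translates_upper[OF N1(1)]) (use tc meet ts in auto)
    then show ?thesis using ts(2,3) unfolding D_def j_def by (simp add: translates_Nil)
  qed
  consider "j = 0" | "j = 1" | "2 \<le> j" by linarith
  then show False
  proof cases
    case 1
    then have st: "stable T N1" using exact D d_eq[OF D(1) N1(1) D(4)] by simp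
    have xc: "x \<in> carrier G" using x c by auto
    have xT: "x \<cdot> T \<in> S" "d (x \<cdot> T) = d T" "x \<cdot> T \<subseteq> N2"
      using coset_S d_coset xc t coset_subset[OF N2(2) x(1) c(2) t(3)] by auto
    have "x \<cdot> T \<inter> N1 = {}" using coset_disjoint[OF T st c(1) xc x(2)] .
    then have "d (sp (N1 \<inter> N2 \<union> x \<cdot> T)) = d (N1 \<inter> N2) + d T"
      using d_Un_disjoint[OF V xT(1)] xT by auto
    moreover have "d (sp (N1 \<inter> N2 \<union> x \<cdot> T)) \<le> d N2"
      using V xT N2 by (intro d_mono sp_least Un_sp_S) auto
    ultimately show False using b by linarith
  next
    case 2
    then show False
      using one_step_contra[OF A T N1(1) N2 D(1,4,2,3) N1(2) _ x b] exact by simp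
  next
    case 3
    have "d (N1 \<inter> N2) + j * d (N1 \<inter> N2) \<le> d (translates N1 ts \<inter> N2) + j * d N2"
      using translates_lower[OF T N1(1) N2 ts(1)] unfolding j_def .
    moreover have "d (translates N1 ts \<inter> N2) \<le> d D"
      using ts(2) D N2 Int_S d_mono unfolding D_def by auto
    ultimately have low: "d (N1 \<inter> N2) + j * d (N1 \<inter> N2) \<le> d D + j * d N2" by linarith
    have jle: "j * (d A - (d N2 - d (N1 \<inter> N2))) \<le> d N1 - d (N1 \<inter> N2)"
    proof -
      define v where "v = d (N1 \<inter> N2)"
      obtain a' where a': "d N1 = v + a'" using Vle unfolding v_def by (metis le_Suc_ex)
      obtain b' where b': "d N2 = v + b'" using Vle unfolding v_def by (metis le_Suc_ex)
      obtain s' where s': "d A = b' + s'" using b b' TA unfolding v_def[symmetric] by (metis le_Suc_ex add_less_cancel_left less_imp_le le_trans add_lessD1 add.assoc)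
      have "v + j * v \<le> d D + j * (v + b')" using low b' unfolding v_def[symmetric] by simp
      then have "v + j * d A \<le> v + a' + j * b'" using exact a' by (simp add: algebra_simps)
      then show ?thesis unfolding v_def[symmetric] a' b' s' by (simp add: algebra_simps)
    qed
    obtain us \<sigma>1 \<sigma>2 where us: "ts = us @ [\<sigma>1, \<sigma>2]"
    proof -
      have "length ts = Suc (Suc (j - 2))" using 3 unfolding j_def by simp
      then show ?thesis using that by (metis append.assoc append_Cons append_Nil length_Suc_conv_rev)
    qed
    have "d (translates N1 [\<sigma>1, \<sigma>2]) \<le> d (translates N1 (us @ [\<sigma>1, \<sigma>2])) + length us * d A"
      by (rule translates_upper[OF N1(1)]) (use tc us ts meet in auto)
    moreover have "j = length us + 2" using us unfolding j_def by simp
    ultimately have "d (translates N1 [\<sigma>1, \<sigma>2]) + 2 * d A \<le> d N1"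
      using exact ts(2) unfolding us D_def by (simp add: algebra_simps)
    then obtain E where E: "E \<in> S" "stable A E" "stable T E" "N1 \<subseteq> E" "d E = d N1 + d A"
      using translates_span[OF A T N1 meet, of \<sigma>1 \<sigma>2] ts us by auto
    \<comment> \<open>If \<open>d T = d A\<close>, the situation is dualized: the complement of
      \<open>E\<close> lies one step below that of \<open>N1\<close>, and for the complements
      \<open>a\<close> takes the role of \<open>b\<close>. If \<open>d T < d A\<close>, the
      divisibility required by \<open>gapless\<close> comes from \<open>E\<close> and the core,
      which are both stable under \<open>T\<close> and differ by
      \<open>(j + 1) * d A\<close>.\<close>
    show False
    proof (cases "d T = d A")
      case True
      obtain Z where Z: "Z \<in> S" "d Z + 1 = n" using hyperplane by auto
      have Ec: "E \<subseteq> carrier G" using E S_carrier by auto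
      have P: "perp Z N1 \<in> S" "perp Z N2 \<in> S" "perp Z E \<in> S" using perp_S Z c Ec by auto
      obtain y where y: "y \<in> perp Z N2" "y \<notin> perp Z N1"
      proof -
        have "\<not> perp Z N2 \<subseteq> perp Z N1"
          using perp_mono[of "perp Z N2" "perp Z N1" Z] perp_perp[OF Z] N1 N2 ne by auto
        then show ?thesis using that by auto
      qed
      have dims: "d (perp Z N1) + d N1 = n" "d (perp Z N2) + d N2 = n" "d (perp Z E) + d E = n"
         "d (perp Z N1 \<inter> perp Z N2) + d (sp (N1 \<union> N2)) = n"
        using d_perp[OF Z N1(1)] d_perp[OF Z N2(1)] d_perp[OF Z E(1)] d_perp[OF Z Un_sp_S[OF N1(1) N2(1)]]
          perp_Un[OF Z(1) N1(1) N2(1)] by simp_all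
      have mod: "d (N1 \<inter> N2) + d (sp (N1 \<union> N2)) = d N1 + d N2" using d_mod N1 N2 by auto
      show False
        by (rule one_step_contra[OF A T P(1,2) _ P(3) _ _ _ _ _ y])
           (use stable_perp t aa c Ec N1 N2 E perp_mono dims mod a b True in auto)
    next
      case False
      have Esub: "d T dvd d E" "d T dvd d D" using d_dvd[OF T E(1,3)] d_dvd[OF T D(1,3)] by auto
      have "d E = d D + (j + 1) * d A" using E exact by simp
      then have "d T dvd (j + 1) * d A" using Esub by (metis dvd_add_right_iff)
      moreover have "d A dvd n" "d T dvd n"
        using d_dvd[OF A carrier_S] d_dvd[OF T carrier_S] aa t by (auto simp: stable_def subset_iff)
      moreover have U: "subf (A \<inter> T)" using subf_Int A T by auto
      have "d (A \<inter> T) dvd d A" "d (A \<inter> T) dvd d T"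
        using d_dvd[OF U] aa t stable_mono[of A A "A \<inter> T"] stable_mono[of T T "A \<inter> T"] by auto
      moreover have "0 < d (A \<inter> T)" using subfD[OF U] by auto
      moreover have "d N1 - d (N1 \<inter> N2) + d (A \<inter> T) < d A" "d N2 - d (N1 \<inter> N2) + d (A \<inter> T) < d T"
        using a b Vle by linarith+
      moreover have "d T < d A" using False TA by auto
      ultimately show False
        using gap[unfolded gapless_def, rule_format, OF _ _ _ _ _ _ 3 _ jle, of "d T" "d (A \<inter> T)"] by simp
    qed
  qed
qed

text \<open>If one part contains the other there is nothing to do. Otherwise a failure of the bound,
  in which the stabilizer of the sum is only estimated from below by \<open>A \<inter> T\<close>,
  becomes for the orthogonal complements the pair of strict inequalities in
  \<open>incomparable_contra\<close>.\<close>

lemma union_stab: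
  assumes gap: "gapless n" and C1: "C1 \<in> S" "C1 \<noteq> {}" and C2: "C2 \<in> S" "C2 \<noteq> {}"
    and e: "e \<le> d C1 + d (stab C1)" "e \<le> d C2 + d (stab C2)"
  shows "e \<le> d (sp (C1 \<union> C2)) + d (stab (sp (C1 \<union> C2)))"
proof -
  define C where "C = sp (C1 \<union> C2)"
  have c: "C1 \<subseteq> carrier G" "C2 \<subseteq> carrier G" using C1 C2 S_carrier by auto
  have C: "C \<in> S" "C \<noteq> {}" unfolding C_def using Un_sp_S C1 C2 sp_superset[of "C1 \<union> C2"] by auto
  define A T where "A = stab C1" and "T = stab C2"
  have A: "subf A" and T: "subf T" unfolding A_def T_def using stab_subf C1 C2 by auto
  note a = subfD[OF A] and t = subfD[OF T]
  consider "C1 \<subseteq> C2" | "C2 \<subseteq> C1" | "\<not> C1 \<subseteq> C2" "\<not> C2 \<subseteq> C1" by blast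
  then show ?thesis
  proof cases
    case 1
    then have "C1 \<union> C2 = C2" by auto
    then show ?thesis using e sp_id C2 by simp
  next
    case 2
    then have "C1 \<union> C2 = C1" by auto
    then show ?thesis using e sp_id C1 by simp
  next
    case 3
    show ?thesis
    proof (rule ccontr)
      assume "\<not> ?thesis"
      then have lt: "d C + d (stab C) < e" unfolding C_def by simp
      have U: "subf (A \<inter> T)" using subf_Int A T by auto
      have "stable (A \<inter> T) C" unfolding C_def
        using stable_stab[of C1] stable_stab[of C2] a t c
        by (intro stable_sp_Un) (auto intro: stable_mono simp: A_def T_def)
      then have "A \<inter> T \<subseteq> stab C" using stab_max a by auto
      then have "d (A \<inter> T) \<le> d (stab C)" using d_mono stab_subf[OF C] U by (auto simp: subf_def)
      then have lt2: "d C + d (A \<inter> T) < d C1 + d A" "d C + d (A \<inter> T) < d C2 + d T"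
        using lt e unfolding A_def T_def by auto
      obtain Z where Z: "Z \<in> S" "d Z + 1 = n" using hyperplane by auto
      have P: "perp Z C1 \<in> S" "perp Z C2 \<in> S" using perp_S Z c by auto
      have ne: "\<not> perp Z C1 \<subseteq> perp Z C2" "\<not> perp Z C2 \<subseteq> perp Z C1"
        using perp_mono[of "perp Z C2" "perp Z C1" Z] perp_mono[of "perp Z C1" "perp Z C2" Z]
          perp_perp[OF Z] C1 C2 3 by auto
      have dims: "d (perp Z C1) + d C1 = n" "d (perp Z C2) + d C2 = n"
         "d (perp Z C1 \<inter> perp Z C2) + d C = n"
        using d_perp[OF Z C1(1)] d_perp[OF Z C2(1)] d_perp[OF Z C(1)] perp_Un[OF Z(1) C1(1) C2(1)]
        unfolding C_def by simp_all
      have st: "stable A (perp Z C1)" "stable T (perp Z C2)"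
        using stable_perp stable_stab a t c unfolding A_def T_def by auto
      show False
      proof (cases "d T \<le> d A")
        case True
        show False
          by (rule incomparable_contra[OF gap A T True P(1) st(1) P(2) st(2) _ _ ne]) (use dims lt2 in linarith)+
      next
        case False
        show False
          by (rule incomparable_contra[OF gap T A _ P(2) st(2) P(1) st(1) _ _ ne(2,1)])
             (use dims lt2 False in \<open>simp_all add: Int_commute\<close>)
      qed
    qed
  qed
qed

text \<open>If \<open>B\<close> stabilizes \<open>A\<close>, then \<open>A\<close> itself is the
  part sought. Otherwise \<open>b \<otimes> a\<close> is outside \<open>A\<close> for some
  \<open>a\<close> and \<open>b\<close>, and the pair consisting of A + aB and the preimage of
  \<open>A\<close> in \<open>B\<close> under multiplication by \<open>a\<close> has the same total
  dimension, a product inside \<open>A \<bullet> B\<close>, and a smaller second member, as it has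
  lost \<open>b\<close>.\<close>

lemma dyson:
  assumes "A \<in> S" "B \<in> S" "\<one> \<in> A" "\<one> \<in> B"
  shows "\<exists>C\<in>S. \<one> \<in> C \<and> C \<subseteq> A \<bullet> B \<and> d A + d B \<le> d C + d (stab C)"
  using assms
proof (induction "d B" arbitrary: A B rule: less_induct)
  case less
  have c: "A \<subseteq> carrier G" "B \<subseteq> carrier G" using less S_carrier by auto
  show ?case
  proof (cases "B \<subseteq> stab A")
    case True
    have "subf (stab A)" using stab_subf[OF less(2)] less(4) by blast
    then have "d B \<le> d (stab A)" using d_mono[OF less(3) _ True] by (simp add: subf_def)
    moreover have "A \<subseteq> A \<bullet> B" using subset_prod' less c by auto
    ultimately show ?thesis using less by (intro bexI[of _ A]) auto
  next
    case False
    then obtain b a where ab: "b \<in> B" "a \<in> A" "b \<otimes> a \<notin> A" using c by (auto simp: stab_def)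
    have ac: "a \<in> carrier G" using ab c by auto
    define A' where "A' = sp (A \<union> a \<cdot> B)"
    define B' where "B' = B \<inter> {y \<in> carrier G. a \<otimes> y \<in> A}"
    have aB: "a \<cdot> B \<in> S" "d (a \<cdot> B) = d B" using coset_S d_coset ac less by auto
    have A': "A' \<in> S" "A \<subseteq> A'" unfolding A'_def using Un_sp_S less aB sp_superset[of "A \<union> a \<cdot> B"] by auto
    have B': "B' \<in> S" "\<one> \<in> B'" unfolding B'_def using pre_S Int_S less ac ab by auto
    have "b \<notin> B'" using ab ac c m_comm[of a b] unfolding B'_def by auto
    then have "d B' < d B" using d_strict[of B' B] B' less ab unfolding B'_def by auto
    moreover have inter: "d (A \<inter> a \<cdot> B) = d B'"
    proof -
      have "{y \<in> carrier G. a \<otimes> y \<in> A \<inter> a \<cdot> B} = B'"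
        using ac c by (auto simp: B'_def mem_coset m_assoc[symmetric])
      then show ?thesis using d_pre[OF ac Int_S[OF less(2) aB(1)]] by simp
    qed
    moreover have "\<one> \<in> A'" using A' less by auto
    ultimately obtain C where C: "C \<in> S" "\<one> \<in> C" "C \<subseteq> A' \<bullet> B'" "d A' + d B' \<le> d C + d (stab C)"
      using less(1)[of B' A'] A' B' by auto
    have "A' \<bullet> B' \<subseteq> A \<bullet> B" unfolding A'_def
    proof (rule prod_least_sp)
      fix x y assume xy: "x \<in> A \<union> a \<cdot> B" "y \<in> B'"
      show "x \<otimes> y \<in> A \<bullet> B"
      proof (cases "x \<in> A")
        case True
        then show ?thesis using xy prod_mem unfolding B'_def by auto
      next
        case False
        then obtain z where z: "z \<in> B" "x = a \<otimes> z" using xy by (auto simp: l_coset_def)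
        have "x \<otimes> y = (a \<otimes> y) \<otimes> z" using z xy ac c m_comm[of z y] by (auto simp: B'_def m_assoc subset_iff)
        then show ?thesis using xy z prod_mem unfolding B'_def by auto
      qed
    qed (use c less prod_S S_carrier[OF aB(1)] in \<open>auto simp: B'_def\<close>)
    moreover have "d A' + d B' = d A + d B"
      using d_mod[OF less(2) aB(1)] inter aB unfolding A'_def by simp
    ultimately show ?thesis using C by (intro bexI[of _ C]) auto
  qed
qed

lemma stab_coset:
  assumes "V \<in> S" "g \<in> carrier G" shows "stab (g \<cdot> V) = stab V"
proof -
  have Xc: "V \<subseteq> carrier G" using assms S_carrier by auto
  have "h \<otimes> (g \<otimes> x) \<in> g \<cdot> V \<longleftrightarrow> h \<otimes> x \<in> V" if "h \<in> carrier G" "x \<in> V" for h x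
  proof -
    have xc: "x \<in> carrier G" using that Xc by auto
    have "h \<otimes> (g \<otimes> x) = g \<otimes> (h \<otimes> x)" using xc that assms m_lcomm by auto
    then show ?thesis using that xc assms Xc by (simp add: mem_coset m_assoc[symmetric])
  qed
  then show ?thesis by (auto simp: stab_def l_coset_def)
qed

lemma dyson_point:
  assumes A: "A \<in> S" "B \<in> S" "a \<in> A" "b \<in> B"
  shows "\<exists>C\<in>S. a \<otimes> b \<in> C \<and> C \<subseteq> A \<bullet> B \<and> d A + d B \<le> d C + d (stab C)"
proof -
  have c: "A \<subseteq> carrier G" "B \<subseteq> carrier G" using assms S_carrier by auto
  have abc: "a \<in> carrier G" "b \<in> carrier G" "a \<otimes> b \<in> carrier G" using c assms by auto
  define A' B' where "A' = {y \<in> carrier G. a \<otimes> y \<in> A}" and "B' = {y \<in> carrier G. b \<otimes> y \<in> B}"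
  have "A' \<in> S" "B' \<in> S" "\<one> \<in> A'" "\<one> \<in> B'" "d A' = d A" "d B' = d B"
    unfolding A'_def B'_def using assms abc pre_S d_pre by auto
  then obtain C where C: "C \<in> S" "\<one> \<in> C" "C \<subseteq> A' \<bullet> B'" "d A + d B \<le> d C + d (stab C)"
    using dyson[of A' B'] by auto
  define C' where "C' = (a \<otimes> b) \<cdot> C"
  have C': "C' \<in> S" "d C' = d C" "stab C' = stab C" unfolding C'_def using coset_S d_coset stab_coset C abc by auto
  moreover have "a \<otimes> b \<in> C'" unfolding C'_def l_coset_def using C(2) abc by force
  moreover have "C' \<subseteq> A \<bullet> B"
  proof -
    have "(a \<otimes> b) \<otimes> y \<in> A \<bullet> B" if "y \<in> A' \<bullet> B'" for y
    proof (rule sp_image_le[OF abc(3) _ prod_S[OF c] _ that[unfolded prod_sp_def]])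
      show "A' <#> B' \<subseteq> carrier G" by (auto simp: set_mult_def A'_def B'_def)
      fix z assume "z \<in> A' <#> B'"
      then obtain x y where xy: "x \<in> A'" "y \<in> B'" "z = x \<otimes> y" by (auto simp: set_mult_def)
      have "x \<in> carrier G" "y \<in> carrier G" using xy by (auto simp: A'_def B'_def)
      then have "(a \<otimes> b) \<otimes> z = (a \<otimes> x) \<otimes> (b \<otimes> y)" using xy abc by (simp add: m_ac)
      then show "(a \<otimes> b) \<otimes> z \<in> A \<bullet> B" using xy prod_mem by (auto simp: A'_def B'_def)
    qed
    then show ?thesis using C(3) by (auto simp: C'_def l_coset_def)
  qed
  ultimately show ?thesis using C by auto
qed

text \<open>Among the parts of the product satisfying the bound, one of maximal dimension absorbs
  the part around any \<open>x \<otimes> y\<close> by \<open>union_stab\<close>, so it is the whole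
  product. The bound is then applied to \<open>H \<bullet> A\<close> and
  \<open>H \<bullet> B\<close>, whose product is the same.\<close>

theorem kneser:
  assumes gap: "gapless n" and A: "A \<in> S" "A \<noteq> {}" and B: "B \<in> S" "B \<noteq> {}"
  defines "H \<equiv> stab (A \<bullet> B)"
  shows "d (H \<bullet> A) + d (H \<bullet> B) \<le> d (A \<bullet> B) + d H"
proof -
  have c: "A \<subseteq> carrier G" "B \<subseteq> carrier G" using A B S_carrier by auto
  have weak: "d A + d B \<le> d (A \<bullet> B) + d (stab (A \<bullet> B))"
    if W: "A \<in> S" "A \<noteq> {}" "B \<in> S" "B \<noteq> {}" for A B
  proof -
    have c: "A \<subseteq> carrier G" "B \<subseteq> carrier G" using W S_carrier by auto
    obtain a b where ab: "a \<in> A" "b \<in> B" using W by blast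
    let ?P = "\<lambda>C. C \<in> S \<and> C \<noteq> {} \<and> C \<subseteq> A \<bullet> B \<and> d A + d B \<le> d C + d (stab C)"
    obtain C0 where "?P C0" using dyson_point[OF W(1,3) ab] by blast
    moreover have "\<forall>C. ?P C \<longrightarrow> d C < d (A \<bullet> B) + 1" using d_mono prod_S[OF c] less_Suc_eq_le by auto
    ultimately obtain C where C: "?P C" "\<forall>C'. ?P C' \<longrightarrow> d C' \<le> d C"
      using ex_has_greatest_nat[of ?P C0 d "d (A \<bullet> B) + 1"] by blast
    have "A \<bullet> B \<subseteq> C"
    proof (rule prod_least)
      show "C \<in> S" using C by auto
      fix x y assume xy: "x \<in> A" "y \<in> B"
      obtain C1 where C1: "C1 \<in> S" "x \<otimes> y \<in> C1" "C1 \<subseteq> A \<bullet> B" "d A + d B \<le> d C1 + d (stab C1)"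
        using dyson_point[OF W(1,3) xy] by blast
      have sup: "C \<union> C1 \<subseteq> sp (C \<union> C1)" by (rule sp_superset)
      have S': "sp (C \<union> C1) \<in> S" using C C1 Un_sp_S by auto
      have "?P (sp (C \<union> C1))"
        using union_stab[OF gap, of C C1] C C1 S' sup sp_least[of "C \<union> C1", OF _ prod_S[OF c]] by auto
      then have "C = sp (C \<union> C1)" using C sup d_eq[of C "sp (C \<union> C1)"] S' by auto
      then show "x \<otimes> y \<in> C" using sup C1 by blast
    qed
    then have "C = A \<bullet> B" using C by auto
    then show ?thesis using C by auto
  qed
  have AB: "A \<bullet> B \<in> S" "A \<bullet> B \<noteq> {}" using prod_S[OF c] prod_nonempty[OF A(2) B(2)] by auto
  have H: "subf H" "stable H (A \<bullet> B)" unfolding H_def using stab_subf[OF AB] stable_stab by auto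
  note h = subfD[OF H(1)]
  have HA: "H \<bullet> A \<in> S" "H \<bullet> A \<noteq> {}" "H \<bullet> B \<in> S" "H \<bullet> B \<noteq> {}"
    using prod_S[OF h(3) c(1)] prod_S[OF h(3) c(2)] prod_nonempty[OF h(7) A(2)] prod_nonempty[OF h(7) B(2)] by auto
  have Hc: "H \<bullet> A \<subseteq> carrier G" "H \<bullet> B \<subseteq> carrier G" using HA S_carrier by auto
  have "(H \<bullet> A) \<bullet> B = A \<bullet> B" by (rule prod_assoc_stable) (use h c H in auto)
  then have "(H \<bullet> B) \<bullet> (H \<bullet> A) = A \<bullet> B"
    using prod_assoc_stable[of H B "H \<bullet> A"] prod_comm[OF Hc(1) c(2)] h c H Hc by auto
  then show ?thesis using weak[of "H \<bullet> B" "H \<bullet> A"] HA unfolding H_def by simp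
qed

end

section \<open>Degrees satisfying the numerical hypothesis\<close>

lemma gapless_prime_power:
  assumes "Factorial_Ring.prime p" shows "gapless (p ^ k)"
  unfolding gapless_def
proof (intro allI impI)
  fix s t u j a b :: nat
  assume h: "s dvd p ^ k" "t dvd p ^ k" "0 < u" "t < s" "2 \<le> j" "j * (s - b) \<le> a" "a + u < s" "b + u < t"
  obtain e where e: "s = p ^ e" using divides_primepow_nat[OF assms, of s k] h(1) by auto
  obtain f where f: "t = p ^ f" using divides_primepow_nat[OF assms, of t k] h(2) by auto
  note ef = e f
  have "1 < p" using assms prime_gt_1_nat by blast
  then have "f < e" using h(4) ef by simp
  then have "p ^ Suc f \<le> p ^ e" using \<open>1 < p\<close> by (intro power_increasing) auto
  moreover have "2 * p ^ f \<le> p ^ Suc f" using \<open>1 < p\<close> by simp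
  ultimately have "2 * t \<le> s" using ef by (metis le_trans)
  moreover have "2 * (s - b) \<le> a" using le_trans[OF mult_le_mono1[OF h(5)] h(6)] .
  \<comment> \<open>For \<open>j \<ge> 2\<close> the inequalities imply
    \<open>s + 3 * u < 2 * t\<close>, whereas a proper divisor among powers of \<open>p\<close> is
    at most half as large.\<close>
  ultimately show False using h(3,4,7,8) by linarith
qed

lemma dvd_two_primes:
  fixes p q m :: nat
  assumes "Factorial_Ring.prime p" "Factorial_Ring.prime q" "m dvd p * q"
  shows "m = 1 \<or> m = p \<or> m = q \<or> m = p * q"
proof -
  obtain a b where "m = a * b" "a dvd p" "b dvd q" using assms(3) division_decomp by blast
  moreover have "a = 1 \<or> a = p" "b = 1 \<or> b = q"
    using calculation assms(1,2) unfolding prime_nat_iff by blast+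
  ultimately show ?thesis by auto
qed

text \<open>Again \<open>s < 2 * t\<close>, which leaves only \<open>{s, t} = {p, q}\<close>. Then
  \<open>t\<close> is coprime to \<open>s\<close> and divides \<open>j + 1\<close>, so
  \<open>j \<ge> t - 1\<close>, and \<open>(t - 1) * (s - t + 2) \<le> a < s\<close> is
  impossible.\<close>

lemma gapless_two_primes:
  assumes p: "Factorial_Ring.prime p" and q: "Factorial_Ring.prime q" and "p \<noteq> q"
  shows "gapless (p * q)"
  unfolding gapless_def
proof (intro allI impI)
  fix s t u j a b :: nat
  assume h: "s dvd p * q" "t dvd p * q" "u dvd s" "u dvd t" "0 < u" "t < s" "2 \<le> j" "t dvd (j + 1) * s"
    "j * (s - b) \<le> a" "a + u < s" "b + u < t"
  have two: "2 * (s - b) \<le> a" using le_trans[OF mult_le_mono1[OF h(7)] h(9)] .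
  have big: "\<not> 2 * t \<le> s" using two h by linarith
  have pq: "2 \<le> p" "2 \<le> q" using p q prime_ge_2_nat by auto
  have t1: "t \<noteq> 1" using h by auto
  have "\<not> (s = p * q)"
  proof
    assume s: "s = p * q"
    then have "t = p \<or> t = q" using dvd_two_primes[OF p q h(2)] t1 h(6) by auto
    then have "2 * t \<le> s" using s pq by auto
    then show False using big by simp
  qed
  moreover have "t \<noteq> p * q" using dvd_two_primes[OF p q h(1)] h(6) pq by (auto dest: dvd_imp_le)
  ultimately have st: "(s = p \<and> t = q) \<or> (s = q \<and> t = p)"
    using dvd_two_primes[OF p q h(1)] dvd_two_primes[OF p q h(2)] t1 h(6) by auto
  then have "coprime t s" using p q \<open>p \<noteq> q\<close> by (auto simp: primes_coprime)
  then have "t dvd j + 1" using h(8) coprime_dvd_mult_left_iff[of t s "j + 1"] by simp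
  then have tj: "t - 1 \<le> j" using dvd_imp_le[of t "j + 1"] by simp
  obtain t' where t': "t = t' + 2" using pq st by (metis add.commute le_Suc_ex)
  obtain e where e: "s = t + 1 + e" using h(6) less_iff_Suc_add[of t s] by auto
  have "3 + e \<le> s - b" using h(5,11) e by linarith
  then have "(t' + 1) * (3 + e) \<le> j * (s - b)" using tj t' by (intro mult_le_mono) auto
  then have "(t' + 1) * (3 + e) \<le> a" using h(9) by linarith
  moreover have "t' + e + 3 \<le> (t' + 1) * (3 + e)" by (simp add: algebra_simps)
  ultimately show False using h(5,10) t' e by linarith
qed

lemma dvd_12: "(m::nat) dvd 12 \<Longrightarrow> m \<in> {1,2,3,4,6,12}"
proof -
  assume m: "m dvd 12"
  then have "m \<le> 12" by (auto dest: dvd_imp_le)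
  then have "m = 0 \<or> m = 1 \<or> m = 2 \<or> m = 3 \<or> m = 4 \<or> m = 5 \<or> m = 6 \<or> m = 7 \<or> m = 8 \<or> m = 9 \<or> m = 10 \<or> m = 11 \<or> m = 12"
    by presburger
  then show ?thesis using m by (elim disjE) simp_all
qed

lemma gapless_12: "gapless 12"
  unfolding gapless_def
proof (intro allI impI)
  fix s t u j a b :: nat
  assume h: "s dvd 12" "t dvd 12" "0 < u" "t < s" "2 \<le> j" "j * (s - b) \<le> a" "a + u < s" "b + u < t"
  have "2 * (s - b) \<le> a" using le_trans[OF mult_le_mono1[OF h(5)] h(6)] .
  \<comment> \<open>No two divisors \<open>t < s\<close> of 12 are that close.\<close>
  then have "s + 6 \<le> 2 * t" using h by linarith
  then show False using dvd_12[OF h(1)] dvd_12[OF h(2)] h(4) by auto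
qed

section \<open>Violations along a flag\<close>

locale flag_group = dim_group +
  fixes F :: "nat \<Rightarrow> 'a set" and x :: "nat \<Rightarrow> real"
  assumes F_S: "i < n \<Longrightarrow> F i \<in> S"
    and d_F: "i < n \<Longrightarrow> d (F i) = i + 1"
    and F_mono: "i \<le> j \<Longrightarrow> j < n \<Longrightarrow> F i \<subseteq> F j"
    and one_F: "\<one> \<in> F 0"
    and x_mono: "1 \<le> i \<Longrightarrow> i \<le> j \<Longrightarrow> j < n \<Longrightarrow> x i \<le> x j"
    and x_mult: "1 \<le> i \<Longrightarrow> i < n \<Longrightarrow> 1 \<le> j \<Longrightarrow> j < n \<Longrightarrow>
        \<exists>k<n. (\<forall>a\<in>F i. \<forall>b\<in>F j. a \<otimes> b \<in> F k) \<and> x k \<le> x i + x j"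
begin

definition violation :: "nat \<Rightarrow> nat \<Rightarrow> bool" where
  "violation i j \<longleftrightarrow> 1 \<le> i \<and> 1 \<le> j \<and> i + j < n \<and> x i + x j < x (i + j)"

text \<open>\<open>H\<close> stands for the stabilizer of the product and the last conjunct is
  Kneser's bound. The condition \<open>k < i + j\<close> says that the product stays below the
  dimension \<open>i + j + 1\<close> expected of it.\<close>

definition critical_pair :: "nat \<Rightarrow> nat \<Rightarrow> 'a set \<Rightarrow> nat \<Rightarrow> bool" where
  "critical_pair i j H k \<longleftrightarrow> 1 \<le> i \<and> 1 \<le> j \<and> i + j < n \<and> k < i + j \<and> F i \<bullet> F j \<subseteq> F k \<and> subf H \<and>
     stable H (F i \<bullet> F j) \<and> d (H \<bullet> F i) + d (H \<bullet> F j) \<le> d (F i \<bullet> F j) + d H"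

lemma F_carrier: "i < n \<Longrightarrow> F i \<subseteq> carrier G"
  using F_S S_carrier by auto

lemma one_mem_F: "i < n \<Longrightarrow> \<one> \<in> F i"
  using F_mono[of 0 i] one_F by auto

lemma violation_critical_pair:
  assumes gap: "gapless n" and v: "violation i j"
  obtains H k where "critical_pair i j H k"
proof -
  have ij: "1 \<le> i" "1 \<le> j" "i < n" "j < n" "i + j < n" using v unfolding violation_def by auto
  have Fij: "F i \<in> S" "F j \<in> S" "F i \<noteq> {}" "F j \<noteq> {}" using F_S one_mem_F[OF ij(3)] one_mem_F[OF ij(4)] ij by auto
  obtain k where k: "k < n" "\<forall>a\<in>F i. \<forall>b\<in>F j. a \<otimes> b \<in> F k" "x k \<le> x i + x j" using x_mult ij by meson
  have sub: "F i \<bullet> F j \<subseteq> F k" using prod_least[of "F k"] F_S k by auto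
  have "k < i + j"
  proof (rule ccontr)
    assume "\<not> k < i + j"
    then have "x (i + j) \<le> x k" using x_mono[of "i + j" k] ij k by auto
    then show False using v k unfolding violation_def by auto
  qed
  moreover have "subf (stab (F i \<bullet> F j))"
    using stab_subf[OF prod_S] Fij prod_nonempty F_carrier ij by auto
  ultimately show ?thesis
    using that[of "stab (F i \<bullet> F j)" k] kneser[OF gap Fij(1,3) Fij(2,4)] ij sub stable_stab
    unfolding critical_pair_def by blast
qed

lemma critical_pair_sym: "critical_pair i j H k \<Longrightarrow> critical_pair j i H k"
  using prod_comm[of "F i" "F j"] F_carrier[of i] F_carrier[of j] unfolding critical_pair_def by (simp add: add.commute)

lemma prod_F_S: "i < n \<Longrightarrow> subf H \<Longrightarrow> H \<bullet> F i \<in> S" "i < n \<Longrightarrow> subf H \<Longrightarrow> stable H (H \<bullet> F i)"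
   "i < n \<Longrightarrow> subf H \<Longrightarrow> F i \<subseteq> H \<bullet> F i" "i < n \<Longrightarrow> subf H \<Longrightarrow> H \<subseteq> H \<bullet> F i"
  using prod_S stable_prod subset_prod subset_prod' F_carrier subfD one_mem_F by simp_all

lemma critical_pairD:
  assumes "critical_pair i j H k"
  shows "i < n" "j < n" "subf H" "d H dvd n" "stable H (F i \<bullet> F j)" "k < i + j" "F i \<bullet> F j \<subseteq> F k" "i + j < n"
    "F i \<bullet> F j \<in> S" "d (F i \<bullet> F j) \<le> i + j" "F i \<subseteq> F i \<bullet> F j" "F j \<subseteq> F i \<bullet> F j" "1 \<le> i" "1 \<le> j"
proof -
  show ij: "i < n" "j < n" "subf H" "stable H (F i \<bullet> F j)" "k < i + j" "F i \<bullet> F j \<subseteq> F k" "i + j < n" "1 \<le> i" "1 \<le> j"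
    using assms unfolding critical_pair_def by auto
  show "d H dvd n" using d_dvd[OF ij(3) carrier_S] subfD(3)[OF ij(3)] by (auto simp: stable_def subset_iff)
  show S: "F i \<bullet> F j \<in> S" using prod_S F_carrier ij by auto
  have "d (F i \<bullet> F j) \<le> d (F k)" using d_mono S F_S ij by auto
  then show "d (F i \<bullet> F j) \<le> i + j" using d_F[of k] ij by auto
  show "F i \<subseteq> F i \<bullet> F j" "F j \<subseteq> F i \<bullet> F j"
    using subset_prod subset_prod' F_carrier ij one_mem_F by auto
qed

text \<open>The dimensions of \<open>H \<bullet> F i\<close> and \<open>H \<bullet> F j\<close> are
  multiples of \<open>m\<close> above \<open>i\<close> and \<open>j\<close>. Kneser's bound and the
  dimension at most \<open>i + j\<close> of the product leave room only for the smallest such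
  multiples, and only if the residues of \<open>i\<close> and \<open>j\<close> carry.\<close>

lemma critical_pair_count:
  assumes v: "critical_pair i j H k"
  defines "m \<equiv> d H"
  shows "m \<le> i mod m + j mod m" "d (H \<bullet> F i) = m * (i div m + 1)" "d (H \<bullet> F j) = m * (j div m + 1)"
    "m * (i div m + j div m + 1) \<le> d (F i \<bullet> F j)"
proof -
  note D = critical_pairD[OF v]
  have m0: "0 < m" unfolding m_def using subfD(6)[OF D(3)] .
  have "m dvd d (H \<bullet> F i)" "m dvd d (H \<bullet> F j)"
    unfolding m_def using d_dvd[OF D(3) prod_F_S(1,2)[OF D(1,3)]] d_dvd[OF D(3) prod_F_S(1,2)[OF D(2,3)]] .
  then obtain a b where ab: "d (H \<bullet> F i) = m * a" "d (H \<bullet> F j) = m * b" by (auto elim!: dvdE)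
  have "i + 1 \<le> m * a" "j + 1 \<le> m * b"
    using ab d_F[OF D(1)] d_F[OF D(2)] d_mono[OF F_S[OF D(1)] prod_F_S(1,3)[OF D(1,3)]]
      d_mono[OF F_S[OF D(2)] prod_F_S(1,3)[OF D(2,3)]] by simp_all
  have q: "i = m * (i div m) + i mod m" "j = m * (j div m) + j mod m" "i mod m < m" "j mod m < m" using m0 by auto
  have ai: "i div m < a" if "i + 1 \<le> m * a" for i a
    using that m0 by (simp add: Suc_le_eq less_mult_imp_div_less mult.commute)
  have a1: "i div m + 1 \<le> a" "j div m + 1 \<le> b" using ai[OF \<open>i + 1 \<le> m * a\<close>] ai[OF \<open>j + 1 \<le> m * b\<close>] by auto
  have tot: "m * a + m * b \<le> d (F i \<bullet> F j) + m" "d (F i \<bullet> F j) \<le> i + j"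
    using v ab D unfolding critical_pair_def m_def by auto
  have "m * (i div m + 1) \<le> m * a" "m * (j div m + 1) \<le> m * b" using a1 by (auto intro: mult_le_mono2 simp del: mult_Suc_right)
  then have le: "m * (i div m) + m * (j div m) + 2 * m \<le> m * a + m * b" by (simp add: algebra_simps)
  have e: "m * (i div m + j div m + 1) = m * (i div m) + m * (j div m) + m"
    "m * (i div m + j div m + 3) = m * (i div m) + m * (j div m) + 3 * m" "m * (a + b) = m * a + m * b"
    by (simp_all add: algebra_simps)
  show "m \<le> i mod m + j mod m" using le tot q by linarith
  show "m * (i div m + j div m + 1) \<le> d (F i \<bullet> F j)" using le tot unfolding e by linarith
  have "m * (a + b) < m * (i div m + j div m + 3)"
    unfolding e using tot q by linarith
  then have "a + b < i div m + j div m + 3" by (simp only: mult_less_cancel1)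
  then have "a = i div m + 1" "b = j div m + 1" using a1 by auto
  then show "d (H \<bullet> F i) = m * (i div m + 1)" "d (H \<bullet> F j) = m * (j div m + 1)" using ab by auto
qed

lemma critical_pair_less: assumes "critical_pair i j H k" "i < d H" shows "F i \<subseteq> H"
proof -
  note D = critical_pairD[OF assms(1)]
  have "d (H \<bullet> F i) = d H" using critical_pair_count(2)[OF assms(1)] assms(2) by simp
  then have "H = H \<bullet> F i" using d_eq[of H "H \<bullet> F i"] prod_F_S[of i H] D subfD[OF D(3)] by auto
  then show ?thesis using prod_F_S(3)[of i H] D by auto
qed

lemma critical_pair_less': "critical_pair i j H k \<Longrightarrow> j < d H \<Longrightarrow> F j \<subseteq> H"
  using critical_pair_less critical_pair_sym by blast

lemma critical_pair_full: assumes "critical_pair i j H k" "i + 1 = d H * (i div d H + 1)" shows "stable H (F i)"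
proof -
  note D = critical_pairD[OF assms(1)]
  have "d (H \<bullet> F i) = d (F i)" using critical_pair_count(2)[OF assms(1)] assms(2) d_F D by simp
  then have "F i = H \<bullet> F i" using d_eq[of "F i" "H \<bullet> F i"] prod_F_S[of i H] D F_S by auto
  then show ?thesis using prod_F_S(2)[of i H] D by auto
qed

lemma critical_pair_full': "critical_pair i j H k \<Longrightarrow> j + 1 = d H * (j div d H + 1) \<Longrightarrow> stable H (F j)"
  using critical_pair_full critical_pair_sym by blast

section \<open>Prime powers and products of two primes\<close>

lemma prime_power_case:
  assumes p: "Factorial_Ring.prime p" and nk: "n = p ^ k" and v: "violation i j"
  shows "\<exists>e\<le>k. p ^ e \<le> i mod p ^ e + j mod p ^ e"
proof -
  obtain H l where H: "critical_pair i j H l" using violation_critical_pair[OF _ v] gapless_prime_power[OF p, of k] nk by auto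
  obtain e where "e \<le> k" "d H = p ^ e" using critical_pairD(4)[OF H] nk divides_primepow_nat[OF p, of "d H" k] by auto
  then show ?thesis using critical_pair_count(1)[OF H] by auto
qed

text \<open>Each point added to \<open>Y\<close> within \<open>K\<close> enlarges
  \<open>H \<bullet> Y\<close> by at most one coset of \<open>H\<close>. If
  \<open>H \<bullet> K\<close> has the full dimension \<open>d H * d K\<close>, it follows that
  \<open>H \<bullet> Y\<close> has dimension at least \<open>d H * d Y\<close>, which is linear
  disjointness.\<close>

lemma lin_disjoint_le:
  assumes H: "subf H" and K: "subf K" and Y: "Y \<in> S" "Y \<subseteq> K"
  shows "d (H \<bullet> K) \<le> d (H \<bullet> Y) + d H * (d K - d Y)"
  using Y
proof (induction "d K - d Y" arbitrary: Y rule: less_induct)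
  case less
  note h = subfD[OF H] and k = subfD[OF K]
  show ?case
  proof (cases "Y = K")
    case False
    then obtain y where y: "y \<in> K" "y \<notin> Y" using less by auto
    then have yc: "y \<in> carrier G" using k by auto
    have Yc: "Y \<subseteq> carrier G" using less S_carrier by auto
    note ap = add_point[OF less(2) yc y(2)]
    define Y1 where "Y1 = sp (insert y Y)"
    have Y1: "Y1 \<in> S" "Y1 \<subseteq> K" "d Y1 = d Y + 1"
      unfolding Y1_def using ap sp_least[of "insert y Y" K] y less(3) k(1) by auto
    have dK: "d Y1 \<le> d K" using d_mono[OF Y1(1) k(1) Y1(2)] .
    have IH: "d (H \<bullet> K) \<le> d (H \<bullet> Y1) + d H * (d K - d Y1)"
      using less(1)[OF _ Y1(1,2)] Y1(3) dK by linarith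
    have HY: "H \<bullet> Y \<in> S" "y \<cdot> H \<in> S" using prod_S h Yc coset_S yc by auto
    have "H \<bullet> Y1 \<subseteq> sp (H \<bullet> Y \<union> y \<cdot> H)"
    proof -
      have sup: "H \<bullet> Y \<union> y \<cdot> H \<subseteq> sp (H \<bullet> Y \<union> y \<cdot> H)" by (rule sp_superset)
      have "sp (insert y Y) \<bullet> H \<subseteq> sp (H \<bullet> Y \<union> y \<cdot> H)"
      proof (rule prod_least_sp)
        fix a b assume ab: "a \<in> insert y Y" "b \<in> H"
        show "a \<otimes> b \<in> sp (H \<bullet> Y \<union> y \<cdot> H)"
        proof (cases "a = y")
          case True
          then have "a \<otimes> b \<in> y \<cdot> H" using ab by (auto simp: l_coset_def)
          then show ?thesis using sup by auto
        next
          case False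
          then have "a \<in> Y" using ab by simp
          moreover from this have "a \<in> carrier G" "b \<in> carrier G" using ab Yc h(3) by blast+
          ultimately have "a \<in> Y" "a \<otimes> b = b \<otimes> a" using m_comm by auto
          then show ?thesis using prod_mem[OF ab(2), of a Y] sup by auto
        qed
      qed (use HY Un_sp_S yc Yc h in auto)
      moreover have "Y1 \<subseteq> carrier G" using Y1 S_carrier by auto
      ultimately show ?thesis using prod_comm[of H Y1] h unfolding Y1_def by simp
    qed
    then have "d (H \<bullet> Y1) \<le> d (sp (H \<bullet> Y \<union> y \<cdot> H))"
      using prod_S[OF h(3) S_carrier[OF Y1(1)]] Un_sp_S[OF HY] d_mono by auto
    also have "\<dots> \<le> d (H \<bullet> Y) + d H" using d_mod[OF HY] d_coset[OF yc h(1)] by simp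
    finally have "d (H \<bullet> K) \<le> d (H \<bullet> Y) + d H + d H * (d K - d Y1)" using IH by simp
    also have "\<dots> = d (H \<bullet> Y) + d H * (d K - d Y1 + 1)" by simp
    also have "d K - d Y1 + 1 = d K - d Y" using dK Y1(3) by simp
    finally show ?thesis .
  qed simp
qed

lemma compositum_full:
  assumes H: "subf H" and K: "subf K" and cop: "coprime (d H) (d K)" and Y: "Y \<in> S" "\<one> \<in> Y" "stable H Y" "stable K Y"
  shows "d H * d K dvd d Y" "d H * d K \<le> d Y"
proof -
  have "d H dvd d Y" "d K dvd d Y" using d_dvd H K Y by auto
  then show "d H * d K dvd d Y" using cop by (simp add: divides_mult)
  then show "d H * d K \<le> d Y" using d_pos[of Y] Y by (auto dest: dvd_imp_le)
qed

lemma compositum_le: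
  assumes H: "subf H" and K: "subf K" and cop: "coprime (d H) (d K)" and Y: "Y \<in> S" "stable H Y" "K \<subseteq> Y"
  shows "d H * d K \<le> d Y" "H \<bullet> K \<subseteq> Y"
proof -
  note h = subfD[OF H] and k = subfD[OF K]
  have HK: "subf (H \<bullet> K)" using prod_subf H K by auto
  have st: "stable H (H \<bullet> K)" "stable K (H \<bullet> K)"
    using stable_prod[of H H K] stable_prod[of K K H] prod_comm[of H K] h k by auto
  show "H \<bullet> K \<subseteq> Y" using Y by (intro prod_least) (auto simp: stable_def)
  then have "d (H \<bullet> K) \<le> d Y" using d_mono Y subfD(1)[OF HK] by auto
  then show "d H * d K \<le> d Y"
    using compositum_full(2)[OF H K cop subfD(1)[OF HK] subfD(4)[OF HK] st] by simp
qed

text \<open>By coprimality \<open>H\<close> and \<open>K\<close> are linearly disjoint and together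
  give everything; as \<open>k1 \<le> k2\<close>, both products lie in \<open>F k2\<close>. If
  \<open>k \<le> j\<close>, the slice \<open>F k \<inter> K\<close> lies in \<open>N1\<close> and is
  multiplied by \<open>H\<close> there, so \<open>N1\<close> is too large for \<open>N1\<close> and
  \<open>N2\<close> to fit into \<open>F k2\<close>. If \<open>j < k\<close>, the slices of
  \<open>F i\<close> and \<open>F j\<close> in \<open>H\<close> are multiplied by \<open>K\<close>
  inside \<open>K \<bullet> F k\<close> and \<open>K \<bullet> F l\<close>, which makes
  \<open>N2\<close> too large.\<close>

lemma pair_contra:
  assumes v: "critical_pair i j H k1" and w: "critical_pair k l K k2" and ij: "i \<le> j" and kl: "k \<le> l" and "k1 \<le> k2"
    and dims: "n = d H * d K" and cop: "coprime (d H) (d K)"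
  shows False
proof -
  note V = critical_pairD[OF v] and W = critical_pairD[OF w]
  note H = V(3) and K = W(3)
  note hh = subfD[OF H] and kk = subfD[OF K]
  define N1 N2 where "N1 = F i \<bullet> F j" and "N2 = F k \<bullet> F l"
  have N: "N1 \<in> S" "N2 \<in> S" "stable H N1" "stable K N2" "N1 \<subseteq> F k2" "N2 \<subseteq> F k2"
    using V W F_mono[OF \<open>k1 \<le> k2\<close>] unfolding N1_def N2_def by auto
  have k2: "k2 < n" "d (F k2) = k2 + 1" using W d_F by auto
  have Nc: "N1 \<subseteq> carrier G" "N2 \<subseteq> carrier G" using N S_carrier by auto
  have le1: "d (H \<bullet> F i) + d (H \<bullet> F j) \<le> d N1 + d H" "d (K \<bullet> F k) + d (K \<bullet> F l) \<le> d N2 + d K"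
    using v w unfolding critical_pair_def N1_def N2_def by auto
  \<comment> \<open>Both \<open>F a\<close> and \<open>L\<close> contain \<open>\<one>\<close>, so
    both lie in \<open>L \<bullet> F a\<close>.\<close>
  have slice: "d (F a) + d L \<le> d (F a \<inter> L) + d (L \<bullet> F a)" "F a \<inter> L \<in> S" if "a < n" "subf L" for a L
  proof -
    note l = subfD[OF that(2)]
    show I: "F a \<inter> L \<in> S" using F_S that l Int_S by auto
    have "d (sp (F a \<union> L)) \<le> d (L \<bullet> F a)"
      using F_S that l prod_F_S by (intro d_mono sp_least Un_sp_S) auto
    then show "d (F a) + d L \<le> d (F a \<inter> L) + d (L \<bullet> F a)" using d_mod[OF F_S[OF that(1)] l(1)] by linarith
  qed
  have full: "d (H \<bullet> K) = d H * d K" "d (K \<bullet> H) = d K * d H" "H \<bullet> K = carrier G"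
  proof -
    have HK: "subf (H \<bullet> K)" using prod_subf H K by auto
    have "d H * d K \<le> d (H \<bullet> K)"
      using compositum_le(1)[OF H K cop subfD(1)[OF HK]] stable_prod[of H H K] subset_prod[of H K] hh kk by auto
    moreover have "d (H \<bullet> K) \<le> n" using d_mono subfD[OF HK] carrier_S by auto
    ultimately show 1: "d (H \<bullet> K) = d H * d K" using dims by simp
    then show "d (K \<bullet> H) = d K * d H" using prod_comm[of H K] hh kk by simp
    show "H \<bullet> K = carrier G" using d_eq[of "H \<bullet> K" "carrier G"] subfD[OF HK] carrier_S 1 dims by auto
  qed
  have ind: "d L * d Y \<le> d (L \<bullet> Y)" if "subf L" "subf M" "d (L \<bullet> M) = d L * d M" "Y \<in> S" "Y \<subseteq> M" for L M Y
  proof -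
    have "d Y \<le> d M" using d_mono that subfD by auto
    then obtain r where "d M = d Y + r" by (metis le_Suc_ex)
    then show ?thesis using lin_disjoint_le[OF that(1,2,4,5)] that(3) by (simp add: algebra_simps)
  qed
  show False
  proof (cases "k \<le> j")
    case True
    define Y where "Y = F k \<inter> K"
    have Y: "Y \<in> S" "d (F k) + d K \<le> d Y + d (K \<bullet> F k)" unfolding Y_def using slice W by auto
    have "Y \<subseteq> N1" unfolding Y_def N1_def using F_mono[OF True] V by auto
    then have "H \<bullet> Y \<subseteq> N1" using N by (intro prod_least) (auto simp: stable_def)
    moreover have "d H * d Y \<le> d (H \<bullet> Y)" using ind[OF H K full(1) Y(1)] unfolding Y_def by auto
    ultimately have HY: "d H * d Y \<le> d N1"
      using d_mono[of "H \<bullet> Y" N1] prod_S[OF hh(3) S_carrier[OF Y(1)]] N by auto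
    define D where "D = core H N2"
    obtain ts where ts: "set ts \<subseteq> H" "translates N2 ts = D" "d D + length ts * d K \<le> d N2"
      unfolding D_def using translates_core[OF K H N(2,4)] .
    have tc: "set ts \<subseteq> carrier G" using ts hh by auto
    have D: "D \<in> S" "stable K D" "stable H D" "D \<subseteq> N2"
      using ts translates_S[OF N(2) tc] stable_translates[OF kk(3) N(4) Nc(2) tc] stable_core[OF H Nc(2)]
      unfolding D_def by (auto simp: core_def)
    have N2n: "d N2 < n" using W unfolding N2_def by auto
    \<comment> \<open>Stable under \<open>H\<close> and under \<open>K\<close>, \<open>D\<close> is
      stable under the whole group, so it is empty or everything.\<close>
    have "D = {}"
    proof (rule ccontr)
      assume "D \<noteq> {}"
      then obtain y where y: "y \<in> D" by auto
      then have yc: "y \<in> carrier G" using D S_carrier by auto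
      have st: "stable (carrier G) D" using stable_prodI[OF hh(3) kk(3) D(1,3,2)] full by simp
      have "z \<in> D" if "z \<in> carrier G" for z
      proof -
        have "(z \<otimes> inv y) \<otimes> y \<in> D" using st y yc that by (auto simp: stable_def)
        then show ?thesis using that yc by (simp add: m_assoc)
      qed
      then have "carrier G \<subseteq> N2" using D by auto
      then show False using N2n d_mono[OF carrier_S N(2)] by auto
    qed
    then have "length ts * d K \<le> d N2" using ts d_empty by simp
    then have "length ts * d K < d H * d K" using N2n dims by linarith
    then have len: "length ts + 1 \<le> d H" by (metis Suc_eq_plus1 Suc_leI mult_le_mono1 not_le)
    \<comment> \<open>\<open>N2\<close> is cut down to nothing by at most \<open>d H - 1\<close>
      translates. Counting codimensions inside \<open>N1\<close>, the codimension \<open>r\<close>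
      of the intersection is therefore at least \<open>d N1\<close> divided by
      \<open>d H\<close>.\<close>
    define r where "r = d N1 - d (N1 \<inter> N2)"
    have Ile: "d (N1 \<inter> N2) \<le> d N1" using d_mono Int_S N by auto
    have "d (N2 \<inter> N1) + length ts * d (N2 \<inter> N1) \<le> d (D \<inter> N1) + length ts * d N1"
      using translates_lower[OF H N(2) N(1) N(3) ts(1)] ts(2) by simp
    then have "d (N1 \<inter> N2) + length ts * d (N1 \<inter> N2) \<le> length ts * (d (N1 \<inter> N2) + r)"
      using \<open>D = {}\<close> d_empty Ile unfolding r_def by (simp add: Int_commute)
    then have "d N1 \<le> (length ts + 1) * r" using Ile unfolding r_def by (simp add: algebra_simps)
    then have "d H * d Y \<le> d H * r" using HY len by (meson le_trans mult_le_mono1)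
    then have Yr: "d Y \<le> r" using hh(6) by simp
    have "d N2 + r = d (sp (N1 \<union> N2))" using d_mod[OF N(1,2)] Ile unfolding r_def by simp
    also have "\<dots> \<le> k2 + 1" using d_mono[OF Un_sp_S[OF N(1,2)] F_S[OF k2(1)]] sp_least N F_S k2 by auto
    finally have "d N2 + d Y \<le> k + l" using Yr W(6) by simp
    moreover have "d (F l) \<le> d (K \<bullet> F l)" using d_mono[OF F_S prod_F_S(1,3)] W by auto
    ultimately show False using le1(2) Y(2) d_F[OF W(1)] d_F[OF W(2)] by linarith
  next
    case False
    have *: "d K * d (F a \<inter> H) \<le> d (K \<bullet> F b)" if "a \<le> b" "b < n" for a b
    proof -
      have "d K * d (F a \<inter> H) \<le> d (K \<bullet> (F a \<inter> H))" using ind[OF K H full(2)] slice(2)[of a H] that H by auto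
      also have "\<dots> \<le> d (K \<bullet> F b)"
        using F_mono[OF that] F_carrier[OF that(2)] kk slice(2)[of a H] that H prod_F_S(1)[OF that(2) K]
        by (intro d_mono prod_mono prod_S) (auto intro: S_carrier)
      finally show ?thesis .
    qed
    have "d K * d (F i \<inter> H) \<le> d (K \<bullet> F k)" "d K * d (F j \<inter> H) \<le> d (K \<bullet> F l)"
      using * False ij kl W by auto
    moreover have "d N2 < n" using W unfolding N2_def by auto
    ultimately have "d K * (d (F i \<inter> H) + d (F j \<inter> H)) < d K * (d H + 1)"
      using le1(2) dims by (simp add: algebra_simps)
    then have "d (F i \<inter> H) + d (F j \<inter> H) < d H + 1" by (simp only: mult_less_cancel1)
    moreover have "d N1 \<le> i + j" using V unfolding N1_def by simp
    ultimately show False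
      using slice(1)[OF V(1) H] slice(1)[OF V(2) H] d_F[OF V(1)] d_F[OF V(2)] le1(1) by linarith
  qed
qed

lemma two_primes_case:
  assumes p: "Factorial_Ring.prime p" and q: "Factorial_Ring.prime q" and "p \<noteq> q" and npq: "n = p * q"
    and v: "violation i j" "i mod q + j mod q < q" and w: "violation k l" "k mod p + l mod p < p"
  shows False
proof -
  have gap: "gapless n" using gapless_two_primes[OF p q \<open>p \<noteq> q\<close>] npq by simp
  obtain H k1 where H: "critical_pair i j H k1" using violation_critical_pair[OF gap v(1)] .
  obtain K k2 where K: "critical_pair k l K k2" using violation_critical_pair[OF gap w(1)] .
  \<comment> \<open>Dimension 1 never carries, \<open>q\<close> is excluded by \<open>v\<close>, and
    \<open>n\<close> exceeds \<open>i + j\<close>.\<close>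
  have dH: "d H = p"
    using dvd_two_primes[OF p q critical_pairD(4)[OF H, unfolded npq]] critical_pair_count(1)[OF H] v(2) npq critical_pairD(8)[OF H]
    by (elim disjE) simp_all
  have dK: "d K = q"
    using dvd_two_primes[OF p q critical_pairD(4)[OF K, unfolded npq]] critical_pair_count(1)[OF K] w(2) npq critical_pairD(8)[OF K]
    by (elim disjE) simp_all
  have cop: "coprime p q" using p q \<open>p \<noteq> q\<close> by (simp add: primes_coprime)
  obtain i' j' where H': "critical_pair i' j' H k1" "i' \<le> j'" using H critical_pair_sym[OF H] nat_le_linear[of i j] by blast
  obtain k' l' where K': "critical_pair k' l' K k2" "k' \<le> l'" using K critical_pair_sym[OF K] nat_le_linear[of k l] by blast
  show False
  proof (cases "k1 \<le> k2")
    case True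
    show False using pair_contra[OF H'(1) K'(1) H'(2) K'(2) True] dH dK npq cop by simp
  next
    case False
    show False using pair_contra[OF K'(1) H'(1) K'(2) H'(2)] dH dK npq cop False by (simp add: coprime_commute mult.commute)
  qed
qed

end

section \<open>Degree twelve, with the index pairs sorted by their carries\<close>

lemma cubic_pairs:
  fixes i j :: nat
  assumes "1 \<le> i" "i \<le> j" "i + j < 12" "i mod 2 + j mod 2 < 2" "i mod 4 + j mod 4 < 4 \<or> i mod 6 + j mod 6 < 6" "3 \<le> i mod 3 + j mod 3"
  shows "i = 2 \<or> j = 2 \<or> (i = 1 \<and> j = 8) \<or> (i = 4 \<and> j = 5)"
proof -
  have *: "\<forall>i\<in>set [1..<12]. \<forall>j\<in>set [1..<12]. i \<le> j \<longrightarrow> i + j < 12 \<longrightarrow> i mod 2 + j mod 2 < 2 \<longrightarrow> i mod 4 + j mod 4 < 4 \<or> i mod 6 + j mod 6 < 6 \<longrightarrow> 3 \<le> i mod 3 + j mod 3 \<longrightarrow> i = 2 \<or> j = 2 \<or> (i = 1 \<and> j = 8) \<or> (i = 4 \<and> j = 5)"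
    by code_simp
  have "i \<in> set [1..<12]" "j \<in> set [1..<12]" using assms(1-3) by simp_all
  then show ?thesis by (rule *[rule_format]) (fact assms)+
qed

lemma sextic_pairs:
  fixes i j :: nat
  assumes "1 \<le> i" "i \<le> j" "i + j < 12" "i mod 2 + j mod 2 < 2" "i mod 4 + j mod 4 < 4" "6 \<le> i mod 6 + j mod 6"
  shows "2 \<le> j \<and> j < 6"
proof -
  have *: "\<forall>i\<in>set [1..<12]. \<forall>j\<in>set [1..<12]. i \<le> j \<longrightarrow> i + j < 12 \<longrightarrow> i mod 2 + j mod 2 < 2 \<longrightarrow> i mod 4 + j mod 4 < 4 \<longrightarrow> 6 \<le> i mod 6 + j mod 6 \<longrightarrow> 2 \<le> j \<and> j < 6"
    by code_simp
  have "i \<in> set [1..<12]" "j \<in> set [1..<12]" using assms(1-3) by simp_all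
  then show ?thesis by (rule *[rule_format]) (fact assms)+
qed

lemma quartic_pairs:
  fixes i j :: nat
  assumes "1 \<le> i" "i \<le> j" "i + j < 12" "i mod 2 + j mod 2 < 2" "i mod 6 + j mod 6 < 6" "4 \<le> i mod 4 + j mod 4"
  shows "2 \<le> i \<and> i < 4"
proof -
  have *: "\<forall>i\<in>set [1..<12]. \<forall>j\<in>set [1..<12]. i \<le> j \<longrightarrow> i + j < 12 \<longrightarrow> i mod 2 + j mod 2 < 2 \<longrightarrow> i mod 6 + j mod 6 < 6 \<longrightarrow> 4 \<le> i mod 4 + j mod 4 \<longrightarrow> 2 \<le> i \<and> i < 4"
    by code_simp
  have "i \<in> set [1..<12]" "j \<in> set [1..<12]" using assms(1-3) by simp_all
  then show ?thesis by (rule *[rule_format]) (fact assms)+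
qed

lemma quartic_pairs2:
  fixes i j :: nat
  assumes "1 \<le> i" "i \<le> j" "i + j < 12" "i mod 3 + j mod 3 < 3" "i mod 6 + j mod 6 < 6" "4 \<le> i mod 4 + j mod 4"
  shows "(j = 3 \<or> 5 \<le> j) \<and> i < 4"
proof -
  have *: "\<forall>i\<in>set [1..<12]. \<forall>j\<in>set [1..<12]. i \<le> j \<longrightarrow> i + j < 12 \<longrightarrow> i mod 3 + j mod 3 < 3 \<longrightarrow> i mod 6 + j mod 6 < 6 \<longrightarrow> 4 \<le> i mod 4 + j mod 4 \<longrightarrow> (j = 3 \<or> 5 \<le> j) \<and> i < 4"
    by code_simp
  have "i \<in> set [1..<12]" "j \<in> set [1..<12]" using assms(1-3) by simp_all
  then show ?thesis by (rule *[rule_format]) (fact assms)+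
qed

lemma quadratic_pairs:
  fixes i j :: nat
  assumes "1 \<le> i" "i \<le> j" "i + j < 12" "i mod 3 + j mod 3 < 3" "i mod 6 + j mod 6 < 6" "2 \<le> i mod 2 + j mod 2"
  shows "i = 1 \<or> (i = 3 \<and> j = 7)"
proof -
  have *: "\<forall>i\<in>set [1..<12]. \<forall>j\<in>set [1..<12]. i \<le> j \<longrightarrow> i + j < 12 \<longrightarrow> i mod 3 + j mod 3 < 3 \<longrightarrow> i mod 6 + j mod 6 < 6 \<longrightarrow> 2 \<le> i mod 2 + j mod 2 \<longrightarrow> i = 1 \<or> (i = 3 \<and> j = 7)"
    by code_simp
  have "i \<in> set [1..<12]" "j \<in> set [1..<12]" using assms(1-3) by simp_all
  then show ?thesis by (rule *[rule_format]) (fact assms)+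
qed

context flag_group
begin

lemma compositum_F:
  assumes H: "subf H" "d H = 3" and K: "subf K" "d K = 2 \<or> d K = 4" and Y: "Y \<in> S" "H \<subseteq> Y" "stable K Y"
  shows "3 * d K \<le> d Y"
proof -
  have "coprime (d K) 3" using K(2) by (auto simp: coprime_iff_gcd_eq_1 gcd_non_0_nat)
  then show ?thesis using compositum_le(1)[OF K(1) H(1) _ Y(1,3,2)] H(2) by (simp add: mult.commute)
qed

lemma d_dvd_sub: "subf H \<Longrightarrow> subf K \<Longrightarrow> H \<subseteq> K \<Longrightarrow> d H dvd d K"
  using d_dvd[of H K] stable_mono[of K K H] subfD[of K] by auto

lemma Int_dvd: "subf H \<Longrightarrow> subf K \<Longrightarrow> d (H \<inter> K) dvd gcd (d H) (d K)"
  using d_dvd_sub[of "H \<inter> K" H] d_dvd_sub[of "H \<inter> K" K] subf_Int[of H K] by auto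

lemma stable_F_contains: "subf H \<Longrightarrow> Y \<subseteq> carrier G \<Longrightarrow> stable H Y \<Longrightarrow> \<one> \<in> Y \<Longrightarrow> H \<subseteq> Y"
  using subfD(3)[of H] by (force simp: stable_def subset_iff)

text \<open>The outcomes correspond to the pairs containing 2, to (1, 8) and to (4, 5). An index
  below 3 puts a member of the flag inside \<open>H\<close>; an index one below a multiple of 3
  makes a member stable under \<open>H\<close>.\<close>

lemma cubic_data:
  assumes n12: "n = 12" and v: "critical_pair i j H k" "d H = 3" "i \<le> j"
    and two: "i mod 2 + j mod 2 < 2" and m: "i mod 4 + j mod 4 < 4 \<or> i mod 6 + j mod 6 < 6"
  shows "F 2 = H \<or> (F 1 \<subseteq> H \<and> stable H (F 8)) \<or> (stable H (F 5) \<and> 9 \<le> d (F 4 \<bullet> F 5))"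
proof -
  note D = critical_pairD[OF v(1)] and c = critical_pair_count[OF v(1)]
  have "i = 2 \<or> j = 2 \<or> (i = 1 \<and> j = 8) \<or> (i = 4 \<and> j = 5)"
    using cubic_pairs[OF D(13) v(3) _ two m] D(8) c(1) v(2) n12 by simp
  moreover have "F 2 = H" if "F 2 \<subseteq> H" using that d_eq[of "F 2" H] F_S[of 2] d_F[of 2] subfD(1)[OF D(3)] v n12 by simp
  ultimately show ?thesis
    using critical_pair_less[OF v(1)] critical_pair_less'[OF v(1)] critical_pair_full'[OF v(1)] c(4) v(2) by auto
qed

text \<open>The pairs come from the towers (2, 2, 3), (2, 3, 2) and (3, 2, 2), with proper partial
  products 2, 4 and 2, 6 and 3, 6. Having no carry there, they leave stabilizers of dimension 3 or
  6, of dimension 3 or 4, and of dimension 2 or 4. The combination 6 and 4 is impossible, so there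
  are \<open>M\<close> of dimension 3 and \<open>K\<close> of dimension 2 or 4. These meet in
  dimension 1, and each possible position of both relative to the flag is refuted by a
  dimension.\<close>

lemma twelve_case:
  assumes n12: "n = 12"
    and v1: "violation i1 j1" "i1 mod 2 + j1 mod 2 < 2" "i1 mod 4 + j1 mod 4 < 4"
    and v2: "violation i2 j2" "i2 mod 2 + j2 mod 2 < 2" "i2 mod 6 + j2 mod 6 < 6"
    and v3: "violation i3 j3" "i3 mod 3 + j3 mod 3 < 3" "i3 mod 6 + j3 mod 6 < 6"
  shows False
proof -
  have gap: "gapless n" using gapless_12 n12 by simp
  have norm: "\<exists>i j H k. critical_pair i j H k \<and> i \<le> j \<and> d H \<in> {2,3,4,6} \<and> (\<forall>m. i mod m + j mod m = a mod m + b mod m) \<and> i + j < 12"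
    if vab: "violation a b" for a b
  proof -
    obtain H k where H: "critical_pair a b H k" using violation_critical_pair[OF gap vab] .
    have *: "d H \<in> {2,3,4,6}" "a + b < 12"
      using dvd_12[of "d H"] critical_pairD(4)[OF H] critical_pair_count(1)[OF H] critical_pairD(8)[OF H] n12 by auto
    show ?thesis
    proof (cases "a \<le> b")
      case True
      then show ?thesis using H * by blast
    next
      case False
      then show ?thesis using critical_pair_sym[OF H] * by (metis add.commute nle_le)
    qed
  qed
  obtain i j H k where A: "critical_pair i j H k" "i \<le> j" "d H \<in> {2,3,4,6}" "i mod 2 + j mod 2 < 2" "i mod 4 + j mod 4 < 4" "i + j < 12"
    using norm[OF v1(1)] v1 by metis
  obtain i' j' H' k' where B: "critical_pair i' j' H' k'" "i' \<le> j'" "d H' \<in> {2,3,4,6}" "i' mod 2 + j' mod 2 < 2" "i' mod 6 + j' mod 6 < 6" "i' + j' < 12"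
    using norm[OF v2(1)] v2 by metis
  obtain p q K l where C: "critical_pair p q K l" "p \<le> q" "d K \<in> {2,3,4,6}" "p mod 3 + q mod 3 < 3" "p mod 6 + q mod 6 < 6" "p + q < 12"
    using norm[OF v3(1)] v3 by metis
  have dH: "d H = 3 \<or> d H = 6" using A critical_pair_count(1)[OF A(1)] by auto
  have dH': "d H' = 3 \<or> d H' = 4" using B critical_pair_count(1)[OF B(1)] by auto
  \<comment> \<open>Otherwise \<open>F 2\<close>, of dimension 3, lies in both stabilizers, which
    intersect in a dimension dividing gcd(6, 4) = 2.\<close>
  have "d H = 3 \<or> d H' = 3"
  proof (rule ccontr)
    assume "\<not> ?thesis"
    then have six: "d H = 6" "d H' = 4" using dH dH' by auto
    have j: "2 \<le> j" "j < 6"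
      using sextic_pairs[OF critical_pairD(13)[OF A(1)] A(2,6,4,5)] critical_pair_count(1)[OF A(1)] six by simp_all
    have i': "2 \<le> i'" "i' < 4"
      using quartic_pairs[OF critical_pairD(13)[OF B(1)] B(2,6,4,5)] critical_pair_count(1)[OF B(1)] six by simp_all
    have "F 2 \<subseteq> H" using critical_pair_less'[OF A(1)] F_mono[of 2 j] j six n12 by auto
    moreover have "F 2 \<subseteq> H'" using critical_pair_less[OF B(1)] F_mono[of 2 i'] i' six n12 by auto
    ultimately have "d (F 2) \<le> d (H \<inter> H')"
      using F_S[of 2] n12 by (intro d_mono Int_S subfD(1)[OF critical_pairD(3)[OF A(1)]] subfD(1)[OF critical_pairD(3)[OF B(1)]]) auto
    moreover have "d (H \<inter> H') dvd 2"
      using Int_dvd[OF critical_pairD(3)[OF A(1)] critical_pairD(3)[OF B(1)]] six by (simp add: gcd_non_0_nat)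
    ultimately show False using d_F[of 2] n12 by (auto dest: dvd_imp_le)
  qed
  then obtain M where M: "subf M" "d M = 3"
    and cub: "F 2 = M \<or> (F 1 \<subseteq> M \<and> stable M (F 8)) \<or> (stable M (F 5) \<and> 9 \<le> d (F 4 \<bullet> F 5))"
    using cubic_data[OF n12 A(1) _ A(2,4)] cubic_data[OF n12 B(1) _ B(2,4)] A(5) B(5) critical_pairD(3)[OF A(1)] critical_pairD(3)[OF B(1)]
    by blast
  note V = critical_pairD[OF C(1)] and cnt = critical_pair_count[OF C(1)]
  have K: "subf K" using V by auto
  have dK: "d K = 2 \<or> d K = 4" using C cnt(1) by auto
  have FS: "F a \<in> S" "d (F a) = a + 1" "\<one> \<in> F a" "F a \<subseteq> carrier G" if "a < 12" for a
    using F_S d_F one_mem_F F_carrier that n12 by auto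
  have Fle: "F a \<subseteq> F b" if "a \<le> b" "b < 12" for a b using F_mono that n12 by auto
  have notMK: "\<not> M \<subseteq> K" "\<not> K \<subseteq> M" using d_dvd_sub[OF M(1) K] d_dvd_sub[OF K M(1)] M(2) dK by auto
  have "gcd (d M) (d K) = 1" using M(2) dK by (elim disjE) (simp_all add: gcd_non_0_nat)
  then have tri: "d (M \<inter> K) = 1" using Int_dvd[OF M(1) K] by (simp del: gcd_greatest_iff)
  have notF1: "\<not> (F 1 \<subseteq> M \<and> F 1 \<subseteq> K)"
    using d_mono[of "F 1" "M \<inter> K"] FS[of 1] tri Int_S subfD(1)[OF M(1)] subfD(1)[OF K] by auto
  have MF5: "M \<subseteq> F 5" if "stable M (F 5)" using stable_F_contains[OF M(1) _ that] FS[of 5] by auto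
  show False
  proof (cases "d K = 4")
    case True
    have pq: "q = 3 \<or> 5 \<le> q" "p < 4"
      using quartic_pairs2[OF V(13) C(2,6,4,5)] cnt(1) True by simp_all
    have F1K: "F 1 \<subseteq> K" using critical_pair_less[OF C(1)] Fle[of 1 p] V pq True by auto
    have F3: "F 3 = K" if "q = 3"
      using critical_pair_less'[OF C(1)] that True d_eq[of "F 3" K] FS[of 3] subfD(1)[OF K] by auto
    have MF5: "M \<subseteq> F 5" "stable M (F 5) \<or> M \<subseteq> F 2" using cub notF1 F1K Fle[of 2 5] MF5 by auto
    show False
    proof (cases "q = 3")
      case True
      have "\<not> M \<subseteq> F 2" using F3[OF True] Fle[of 2 3] notMK by auto
      then have "stable M (F 5)" using MF5 by auto
      then have "3 * d K \<le> d (F 5)"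
        using compositum_le(1)[OF M(1) K _ FS(1)[of 5]] F3[OF True] Fle[of 3 5] M(2) \<open>d K = 4\<close>
        by (auto simp: coprime_iff_gcd_eq_1 gcd_non_0_nat)
      then show False using FS(2)[of 5] \<open>d K = 4\<close> by simp
    next
      case False
      then have "M \<subseteq> F p \<bullet> F q" using pq MF5(1) Fle[of 5 q] V n12 by auto
      then have "3 * d K \<le> d (F p \<bullet> F q)" using compositum_F[OF M K _ V(9)] V dK by auto
      then show False using V(10) C(6) True by simp
    qed
  next
    case False
    then have K2: "d K = 2" using dK by simp
    have pq: "p = 1 \<or> (p = 3 \<and> q = 7)"
      using quadratic_pairs[OF V(13) C(2,6,4,5)] cnt(1) K2 by simp
    have F1: "F 1 = K" if "p = 1"
      using critical_pair_less[OF C(1)] that K2 d_eq[of "F 1" K] FS[of 1] subfD(1)[OF K] by auto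
    have F37: "stable K (F 3)" "stable K (F 7)" "10 \<le> d (F 3 \<bullet> F 7)" if "p \<noteq> 1"
      using critical_pair_full[OF C(1)] critical_pair_full'[OF C(1)] cnt(4) that pq K2 by auto
    have KF3: "K \<subseteq> F 3"
      using F1 F37 stable_F_contains[OF K, of "F 3"] FS[of 3] Fle[of 1 3] by (cases "p = 1") auto
    consider "F 2 = M" | "F 1 \<subseteq> M" "stable M (F 8)" | "stable M (F 5)" "9 \<le> d (F 4 \<bullet> F 5)" using cub by blast
    then show False
    proof cases
      case 1
      show False
      proof (cases "p = 1")
        case True
        then show False using F1 1 Fle[of 1 2] notMK by auto
      next
        case False
        have "3 * d K \<le> d (F 3)"
          using compositum_F[OF M K dK FS(1)[of 3]] F37[OF False] 1 Fle[of 2 3] by auto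
        then show False using FS(2)[of 3] K2 by simp
      qed
    next
      case 2
      show False
      proof (cases "p = 1")
        case True
        then show False using F1 2 notMK by auto
      next
        case False
        note s = F37[OF False]
        note kk = subfD[OF K]
        have "\<not> F 1 \<subseteq> K"
          using notF1 2 by auto
        have P: "K \<bullet> F 1 \<in> S" "stable K (K \<bullet> F 1)" "K \<subseteq> K \<bullet> F 1" "F 1 \<subseteq> K \<bullet> F 1"
          using prod_S[OF kk(3) FS(4)[of 1]] stable_prod[OF kk(3,3) FS(4)[of 1] kk(5)]
            subset_prod'[OF FS(3)[of 1] kk(3)] subset_prod[OF kk(4,3)] FS(4)[of 1] by simp_all
        have "K \<noteq> K \<bullet> F 1" using P(4) \<open>\<not> F 1 \<subseteq> K\<close> by auto
        then have "d K < d (K \<bullet> F 1)" using d_strict[OF kk(1) P(1)] P(3) by auto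
        moreover have "d K dvd d (K \<bullet> F 1)" using d_dvd[OF K P(1,2)] .
        ultimately have "4 \<le> d (K \<bullet> F 1)" using K2 dvd_less_add_le[of 2 2 "d (K \<bullet> F 1)"] by simp
        moreover have "K \<bullet> F 1 \<subseteq> F 3"
          using s(1) Fle[of 1 3] FS(1)[of 3] by (intro prod_least) (auto simp: stable_def)
        ultimately have eq: "K \<bullet> F 1 = F 3" using d_eq[OF P(1) FS(1)[of 3]] FS(2)[of 3] by auto
        \<comment> \<open>Since \<open>F 3\<close> is \<open>K \<bullet> F 1\<close> and
          \<open>K\<close> already acts on the product with \<open>F 7\<close>, \<open>F 1\<close>
          may replace \<open>F 3\<close>. But \<open>F 1\<close> lies in \<open>M\<close>, which
          stabilizes \<open>F 8\<close>, so the product has dimension at most 9 instead of the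
          required 10.\<close>
        have "stable K (F 1 \<bullet> F 7)"
          using stable_prod[OF kk(3) FS(4)[of 7] FS(4)[of 1] s(2)] prod_comm[OF FS(4)[of 7] FS(4)[of 1]] by simp
        then have "F 3 \<bullet> F 7 = F 1 \<bullet> F 7"
          using prod_assoc_stable[OF kk(3) FS(4)[of 1] FS(4)[of 7]] kk eq by simp
        also have "\<dots> \<subseteq> F 8"
          using 2 Fle[of 7 8] FS(1)[of 8] by (intro prod_least) (auto simp: stable_def)
        finally have "d (F 3 \<bullet> F 7) \<le> d (F 8)"
          using d_mono prod_S[OF FS(4)[of 3] FS(4)[of 7]] FS(1)[of 8] by auto
        then show False using s FS(2)[of 8] by simp
      qed
    next
      case 3
      \<comment> \<open>\<open>F 5\<close> turns out to be the compositum of \<open>M\<close> and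
        \<open>K\<close>. It is then closed under multiplication, and
        \<open>F 4 \<bullet> F 5\<close> cannot reach dimension 9.\<close>
      have KF5: "K \<subseteq> F 5" using KF3 Fle[of 3 5] by auto
      have cop: "coprime (d M) (d K)" using M(2) K2 by simp
      note c = compositum_le[OF M(1) K cop FS(1)[of 5] 3(1) KF5]
      have MK: "subf (M \<bullet> K)" using prod_subf[OF M(1) K] .
      have "d M * d K \<le> d (M \<bullet> K)"
        using compositum_le(1)[OF M(1) K cop subfD(1)[OF MK]] subfD[OF M(1)] subfD[OF K]
          stable_prod[of M M K] subset_prod[of M K] by auto
      then have "M \<bullet> K = F 5" using d_eq[OF subfD(1)[OF MK] FS(1)[of 5] c(2)] FS(2)[of 5] M(2) K2 by simp
      then have "subf (F 5)" using MK by simp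
      then have "F 4 \<bullet> F 5 \<subseteq> F 5" using Fle[of 4 5] FS(1)[of 5] subfD(8)[of "F 5"] by (intro prod_least) auto
      then have "d (F 4 \<bullet> F 5) \<le> 6"
        using d_mono[OF prod_S[OF FS(4)[of 4] FS(4)[of 5]] FS(1)[of 5]] FS(2)[of 5] by simp
      then show False using 3(2) by simp
    qed
  qed
qed

end

section \<open>Mixed radix arithmetic and tower types\<close>

text \<open>Addition of digits without passing on carries, which is the group law of the tower group
  read on indices.\<close>

fun tadd :: "nat list \<Rightarrow> nat \<Rightarrow> nat \<Rightarrow> nat" where
  "tadd [] i j = 0"
| "tadd (m # ms) i j = (i mod m + j mod m) mod m + m * tadd ms (i div m) (j div m)"

fun no_carry :: "nat list \<Rightarrow> nat \<Rightarrow> nat \<Rightarrow> bool" where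
  "no_carry [] i j = True"
| "no_carry (m # ms) i j = (i mod m + j mod m < m \<and> no_carry ms (i div m) (j div m))"

lemma prod_list_pos: "\<forall>m\<in>set ns. (0::nat) < m \<Longrightarrow> 0 < prod_list ns"
  by (induction ns) auto

lemma tadd_less: "\<forall>m\<in>set ns. 0 < m \<Longrightarrow> tadd ns i j < prod_list ns"
proof (induction ns arbitrary: i j)
  case (Cons m ms)
  then have "tadd ms (i div m) (j div m) + 1 \<le> prod_list ms" by (simp add: Suc_le_eq)
  then have "m * (tadd ms (i div m) (j div m) + 1) \<le> m * prod_list ms" by (rule mult_le_mono2)
  moreover have "(i mod m + j mod m) mod m < m" using Cons by simp
  ultimately show ?case by simp
qed simp

lemma no_carry_tadd:
  "\<forall>m\<in>set ns. 0 < m \<Longrightarrow> i < prod_list ns \<Longrightarrow> j < prod_list ns \<Longrightarrow> no_carry ns i j \<Longrightarrow> tadd ns i j = i + j"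
proof (induction ns arbitrary: i j)
  case (Cons m ms)
  then have "i div m < prod_list ms" "j div m < prod_list ms"
    by (auto simp: less_mult_imp_div_less mult.commute)
  with Cons have "tadd ms (i div m) (j div m) = i div m + j div m" by auto
  moreover have "i = i mod m + m * (i div m)" "j = j mod m + m * (j div m)" by simp_all
  ultimately show ?case using Cons by (auto simp: algebra_simps)
qed simp

text \<open>This translates carries of digits into overflow of residues modulo the partial products,
  the form in which a stabilizer of dimension \<open>m\<close> produces a carry modulo
  \<open>m\<close>.\<close>

lemma no_carry_iff:
  "\<forall>m\<in>set ns. 0 < m \<Longrightarrow> no_carry ns i j \<longleftrightarrow>
    (\<forall>s\<le>length ns. i mod prod_list (take s ns) + j mod prod_list (take s ns) < prod_list (take s ns))"
proof (induction ns arbitrary: i j)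
  case (Cons m ms)
  have m: "0 < m" using Cons by auto
  let ?P = "\<lambda>s. prod_list (take s ms)"
  have step: "i mod (m * M) + j mod (m * M) < m * M \<longleftrightarrow> (i div m) mod M + (j div m) mod M < M"
    if low: "i mod m + j mod m < m" for M
  proof -
    have "i mod (m * M) = i mod m + m * ((i div m) mod M)" "j mod (m * M) = j mod m + m * ((j div m) mod M)"
      by (simp_all add: mod_mult2_eq)
    then have eq: "i mod (m * M) + j mod (m * M) = (i mod m + j mod m) + m * ((i div m) mod M + (j div m) mod M)"
      by (simp add: algebra_simps)
    show ?thesis
    proof
      assume "i mod (m * M) + j mod (m * M) < m * M"
      then have "m * ((i div m) mod M + (j div m) mod M) < m * M" using eq by linarith
      then show "(i div m) mod M + (j div m) mod M < M" by (simp only: mult_less_cancel1)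
    next
      assume "(i div m) mod M + (j div m) mod M < M"
      then have "m * ((i div m) mod M + (j div m) mod M + 1) \<le> m * M" by (intro mult_le_mono2) simp
      then show "i mod (m * M) + j mod (m * M) < m * M" using eq low by simp
    qed
  qed
  have split: "(\<forall>s\<le>length (m # ms). Q s) \<longleftrightarrow> Q 0 \<and> (\<forall>s\<le>length ms. Q (Suc s))" for Q
    using All_less_Suc2[of "Suc (length ms)" Q] by (simp add: less_Suc_eq_le)
  show ?case
  proof (cases "i mod m + j mod m < m")
    case True
    then show ?thesis unfolding split using Cons step[OF True] by simp
  next
    case False
    moreover have "\<not> (\<forall>s\<le>length (m # ms). i mod prod_list (take s (m # ms)) + j mod prod_list (take s (m # ms)) < prod_list (take s (m # ms)))"
      using False by (intro notI) (drule spec[of _ "Suc 0"], simp)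
    ultimately show ?thesis by simp
  qed
qed simp

text \<open>A sum with carries is dominated by one without: below the highest carry, all digits of the
  sum are replaced by their maximal values, which are attained by decreasing one of the summands.\<close>

lemma tadd_dominated:
  "\<forall>m\<in>set ns. 0 < m \<Longrightarrow> \<exists>i'\<le>i. \<exists>j'\<le>j. no_carry ns i' j' \<and> tadd ns i j \<le> i' + j'"
proof (induction ns arbitrary: i j)
  case (Cons m ms)
  have m: "0 < m" using Cons by auto
  obtain I J where IJ: "I \<le> i div m" "J \<le> j div m" "no_carry ms I J" "tadd ms (i div m) (j div m) \<le> I + J"
    using Cons(1)[of "i div m" "j div m"] Cons(2) by auto
  have "m * tadd ms (i div m) (j div m) \<le> m * (I + J)" using IJ by simp
  moreover have "(i mod m + j mod m) mod m \<le> m - 1" using m by (metis Suc_leI Suc_pred' less_Suc_eq_le mod_less_divisor)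
  ultimately have le: "tadd (m # ms) i j \<le> m * I + m * J + (m - 1)" by (simp add: algebra_simps)
  have ij: "i = m * (i div m) + i mod m" "j = m * (j div m) + j mod m" by simp_all
  have "i mod m < m" "j mod m < m" using m by auto
  have nc: "no_carry (m # ms) (m * I + a) (m * J + b)" if "a + b < m" for a b
    using that IJ(3) by simp
  consider "I < i div m" | "J < j div m" | "I = i div m" "J = j div m" using IJ by linarith
  then show ?case
  proof cases
    case 1
    \<comment> \<open>A decrease in the higher digits of \<open>i\<close> frees a full
      \<open>m\<close>, so the lowest digit can be raised to \<open>m - 1\<close> without exceeding
      \<open>i\<close>.\<close>
    then have "m * (I + 1) \<le> m * (i div m)" by (intro mult_le_mono2) simp
    then have "m * I + m \<le> m * (i div m)" by simp
    then have "m * I + (m - 1) \<le> i" using ij(1) m by linarith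
    moreover have "m * J \<le> j" using IJ mult_le_mono2[OF IJ(2), of m] ij by linarith
    moreover have "no_carry (m # ms) (m * I + (m - 1)) (m * J)" using nc[of "m - 1" 0] m by simp
    moreover have "tadd (m # ms) i j \<le> (m * I + (m - 1)) + m * J" using le by linarith
    ultimately show ?thesis by blast
  next
    case 2
    then have "m * (J + 1) \<le> m * (j div m)" by (intro mult_le_mono2) simp
    then have "m * J + m \<le> m * (j div m)" by simp
    then have "m * J + (m - 1) \<le> j" using ij(2) m by linarith
    moreover have "m * I \<le> i" using IJ mult_le_mono2[OF IJ(1), of m] ij by linarith
    moreover have "no_carry (m # ms) (m * I) (m * J + (m - 1))" using nc[of 0 "m - 1"] m by simp
    moreover have "tadd (m # ms) i j \<le> m * I + (m * J + (m - 1))" using le by linarith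
    ultimately show ?thesis by blast
  next
    case 3
    show ?thesis
    proof (cases "i mod m + j mod m < m")
      case True
      have "tadd (m # ms) i j = i mod m + j mod m + m * tadd ms (i div m) (j div m)"
        using True by simp
      also have "\<dots> \<le> i + j"
        using mult_le_mono2[OF IJ(4), of m] ij unfolding 3 distrib_left by linarith
      finally show ?thesis using True 3 IJ by auto
    next
      case False
      then have "m * J + (m - 1 - i mod m) \<le> j" unfolding 3 using ij(2) by linarith
      moreover have "no_carry (m # ms) i (m * J + (m - 1 - i mod m))"
        using nc[of "i mod m" "m - 1 - i mod m"] \<open>i mod m < m\<close> ij(1) 3(1) by simp
      moreover have "tadd (m # ms) i j \<le> i + (m * J + (m - 1 - i mod m))"
        using le ij(1) \<open>i mod m < m\<close> unfolding 3 by linarith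
      ultimately show ?thesis by blast
    qed
  qed
qed auto

section \<open>The group of a tower type\<close>

lemma radix_digit_Cons:
  "radix_digit (m # ms) i 0 = i mod m" "radix_digit (m # ms) i (Suc s) = radix_digit ms (i div m) s"
  by (simp_all add: radix_digit_def div_mult2_eq)

lemma radix_digit_tadd:
  "\<forall>m\<in>set ns. 0 < m \<Longrightarrow> s < length ns \<Longrightarrow>
    radix_digit ns (tadd ns i j) s = (radix_digit ns i s + radix_digit ns j s) mod (ns ! s)"
proof (induction ns arbitrary: i j s)
  case (Cons m ms)
  then show ?case by (cases s) (auto simp: radix_digit_Cons)
qed simp

lemma radix_digit_inj:
  "\<forall>m\<in>set ns. 0 < m \<Longrightarrow> i < prod_list ns \<Longrightarrow> j < prod_list ns \<Longrightarrow>
    (\<And>s. s < length ns \<Longrightarrow> radix_digit ns i s = radix_digit ns j s) \<Longrightarrow> i = j"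
proof (induction ns arbitrary: i j)
  case (Cons m ms)
  have "i div m < prod_list ms" "j div m < prod_list ms"
    using Cons by (auto simp: less_mult_imp_div_less mult.commute)
  moreover have "radix_digit ms (i div m) s = radix_digit ms (j div m) s" if "s < length ms" for s
    using Cons(5)[of "Suc s"] that by (simp add: radix_digit_Cons)
  ultimately have "i div m = j div m" using Cons by auto
  moreover have "i mod m = j mod m" using Cons(5)[of 0] by (simp add: radix_digit_Cons)
  ultimately show ?case by (metis mod_div_mult_eq)
qed simp

lemma radix_digit_less: "\<forall>m\<in>set ns. 0 < m \<Longrightarrow> s < length ns \<Longrightarrow> radix_digit ns i s < ns ! s"
  by (simp add: radix_digit_def)

lemma comm_group_tower: "comm_group (tower_group ns)"
proof (rule group.group_comm_groupI)
  show "group (tower_group ns)" unfolding tower_group_def by (intro product_group) simp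
qed (auto simp: tower_group_def add.commute)

lemma tower_gen_pow:
  assumes "\<forall>m\<in>set ns. 1 < m" "s < length ns"
  shows "tower_gen ns s [^]\<^bsub>tower_group ns\<^esub> (k::nat) = (\<lambda>r\<in>{..<length ns}. if r = s then int k mod int (ns ! s) else 0)"
proof (induction k)
  case 0
  then show ?case by (auto simp: tower_group_def intro!: restrict_ext)
next
  case (Suc k)
  have "1 < ns ! s" using assms by simp
  show ?case unfolding nat_pow_Suc Suc.IH
    by (auto simp: tower_group_def tower_gen_def mod_simps add.commute intro!: restrict_ext)
qed

lemma tower_elem_eq:
  assumes ns: "\<forall>m\<in>set ns. 1 < m"
  shows "tower_elem ns i = (\<lambda>r\<in>{..<length ns}. int (radix_digit ns i r))"
proof -
  interpret comm_group "tower_group ns" by (rule comm_group_tower)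
  have gen: "(\<lambda>r\<in>{..<length ns}. if r = s then int k mod int (ns ! s) else 0) \<in> carrier (tower_group ns)"
    if "s < length ns" for s k
  proof -
    have "\<forall>r<length ns. 0 < ns ! r" using ns by (meson nth_mem less_trans zero_less_one)
    then show ?thesis using that by (auto simp: tower_group_def carrier_integer_mod_group)
  qed
  have "finprod (tower_group ns) (\<lambda>s. tower_gen ns s [^]\<^bsub>tower_group ns\<^esub> radix_digit ns i s) A
      = (\<lambda>r\<in>{..<length ns}. if r \<in> A then int (radix_digit ns i r) else 0)" if "A \<subseteq> {..<length ns}" for A
    using finite_subset[OF that finite_lessThan] that
  proof (induction A rule: finite_induct)
    case empty
    show ?case unfolding finprod_empty by (auto simp: tower_group_def intro!: restrict_ext)
  next
    case (insert s A)
    have s: "s < length ns" using insert by auto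
    have dig: "radix_digit ns i r < ns ! r" if "r < length ns" for r
      using that ns by (intro radix_digit_less) auto
    have "finprod (tower_group ns) (\<lambda>s. tower_gen ns s [^]\<^bsub>tower_group ns\<^esub> radix_digit ns i s) (insert s A)
       = tower_gen ns s [^]\<^bsub>tower_group ns\<^esub> radix_digit ns i s \<otimes>\<^bsub>tower_group ns\<^esub>
         finprod (tower_group ns) (\<lambda>s. tower_gen ns s [^]\<^bsub>tower_group ns\<^esub> radix_digit ns i s) A"
      using insert s gen tower_gen_pow[OF ns] by (intro finprod_insert) (auto simp: subset_iff)
    also have "\<dots> = (\<lambda>r\<in>{..<length ns}. if r = s then int (radix_digit ns i s) mod int (ns ! s) else 0) \<otimes>\<^bsub>tower_group ns\<^esub>
         (\<lambda>r\<in>{..<length ns}. if r \<in> A then int (radix_digit ns i r) else 0)"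
      using insert.IH insert.prems by (simp only: tower_gen_pow[OF ns s] insert_subset simp_thms)
    also have "\<dots> = (\<lambda>r\<in>{..<length ns}. if r \<in> insert s A then int (radix_digit ns i r) else 0)"
      using insert(2) dig s by (auto simp: tower_group_def intro!: restrict_ext)
    finally show ?case .
  qed
  from this[of "{..<length ns}"] show ?thesis unfolding tower_elem_def by (auto intro!: restrict_ext)
qed

lemma tower_elem_mult:
  assumes "\<forall>m\<in>set ns. 1 < m"
  shows "tower_elem ns i \<otimes>\<^bsub>tower_group ns\<^esub> tower_elem ns j = tower_elem ns (tadd ns i j)"
proof -
  have "\<forall>m\<in>set ns. 0 < m" using assms by auto
  then show ?thesis unfolding tower_elem_eq[OF assms]
    by (auto simp: tower_group_def radix_digit_tadd zmod_int intro!: restrict_ext)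
qed

lemma tower_elem_carrier: "\<forall>m\<in>set ns. 1 < m \<Longrightarrow> tower_elem ns i \<in> carrier (tower_group ns)"
proof -
  assume ns: "\<forall>m\<in>set ns. 1 < m"
  then have "\<forall>m\<in>set ns. 0 < m" by auto
  then have "radix_digit ns i s < ns ! s" if "s < length ns" for s using that radix_digit_less by blast
  then show ?thesis using ns by (auto simp: tower_elem_eq tower_group_def carrier_integer_mod_group)
qed

lemma tower_elem_bij:
  assumes "\<forall>m\<in>set ns. 1 < m"
  shows "bij_betw (tower_elem ns) {..<prod_list ns} (carrier (tower_group ns))"
proof -
  have pos: "\<forall>m\<in>set ns. 0 < m" using assms by auto
  have inj: "inj_on (tower_elem ns) {..<prod_list ns}"
  proof (rule inj_onI)
    fix i j assume ij: "i \<in> {..<prod_list ns}" "j \<in> {..<prod_list ns}" "tower_elem ns i = tower_elem ns j"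
    have "radix_digit ns i s = radix_digit ns j s" if "s < length ns" for s
      using fun_cong[OF ij(3), of s] that unfolding tower_elem_eq[OF assms] by simp
    then show "i = j" using radix_digit_inj[OF pos] ij by auto
  qed
  have nz: "ns ! r \<noteq> 0" if "r < length ns" for r using that pos by force
  have "carrier (tower_group ns) = (\<Pi>\<^sub>E r\<in>{..<length ns}. {0..<int (ns ! r)})"
    unfolding tower_group_def carrier_product_group
    by (rule PiE_cong) (use nz in \<open>simp add: carrier_integer_mod_group\<close>)
  moreover have "card (\<Pi>\<^sub>E r\<in>{..<length ns}. {0..<int (ns ! r)}) = prod_list ns"
    by (simp add: card_PiE prod.list_conv_set_nth atLeast0LessThan)
  moreover have "finite (\<Pi>\<^sub>E r\<in>{..<length ns}. {0..<int (ns ! r)})" by (intro finite_PiE) auto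
  moreover have "tower_elem ns ` {..<prod_list ns} \<subseteq> carrier (tower_group ns)"
    using tower_elem_carrier[OF assms] by auto
  moreover have "card (tower_elem ns ` {..<prod_list ns}) = prod_list ns" using inj by (simp add: card_image)
  ultimately have "tower_elem ns ` {..<prod_list ns} = carrier (tower_group ns)"
    by (intro card_subset_eq) auto
  then show ?thesis using inj by (simp add: bij_betw_def)
qed

lemma tower_elem_0: "\<forall>m\<in>set ns. 1 < m \<Longrightarrow> tower_elem ns 0 = \<one>\<^bsub>tower_group ns\<^esub>"
  by (simp add: tower_elem_eq tower_group_def radix_digit_def)

section \<open>Flags given by an enumeration of a finite commutative group\<close>

locale enum_group = comm_group G for G (structure) +
  fixes n :: nat and e :: "nat \<Rightarrow> 'a"
  assumes n2: "n \<ge> 2"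
    and e_carrier: "e i \<in> carrier G"
    and e_bij: "bij_betw e {..<n} (carrier G)"
    and e_0: "e 0 = \<one>"
begin

definition FT :: "nat \<Rightarrow> nat \<Rightarrow> nat" where
  "FT = group_flag_type G (\<lambda>i. e ` {..i})"

lemma e_inj: "i < n \<Longrightarrow> j < n \<Longrightarrow> e i = e j \<longleftrightarrow> i = j"
  using e_bij by (auto simp: bij_betw_def inj_on_def)

lemma e_mem: "i < n \<Longrightarrow> k < n \<Longrightarrow> e i \<in> e ` {..k} \<longleftrightarrow> i \<le> k"
  using e_inj by (fastforce simp: image_iff)

lemma e_full: "n - 1 \<le> k \<Longrightarrow> e ` {..k} = carrier G"
proof -
  assume "n - 1 \<le> k"
  then have "{..<n} \<subseteq> {..k}" using n2 by auto
  then have "carrier G \<subseteq> e ` {..k}" using e_bij unfolding bij_betw_def by blast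
  then show ?thesis using e_carrier by auto
qed

definition below :: "nat \<Rightarrow> nat \<Rightarrow> nat \<Rightarrow> bool" where
  "below i j k \<longleftrightarrow> e ` {..i} <#> e ` {..j} \<subseteq> e ` {..k}"

lemma FT_def': "FT i j = (LEAST k. below i j k)"
  by (simp add: FT_def group_flag_type_def below_def)

lemma below_full: "below i j (n - 1)"
  unfolding below_def using e_full[of "n - 1"] e_carrier by (auto simp: set_mult_def)

lemma FT_below: "below i j (FT i j)" "FT i j < n" "below i j k \<Longrightarrow> FT i j \<le> k"
proof -
  show "below i j (FT i j)" unfolding FT_def' using below_full by (rule LeastI)
  have "FT i j \<le> n - 1" unfolding FT_def' using below_full by (rule Least_le)
  then show "FT i j < n" using n2 by simp
  show "below i j k \<Longrightarrow> FT i j \<le> k" unfolding FT_def' by (rule Least_le)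
qed

lemma FT_upper: "i' \<le> i \<Longrightarrow> j' \<le> j \<Longrightarrow> e i' \<otimes> e j' \<in> e ` {..FT i j}"
  using FT_below(1)[of i j] unfolding below_def set_mult_def by auto

text \<open>By minimality the last element of the segment containing all products is itself a
  product.\<close>

lemma FT_attained: "\<exists>i'\<le>i. \<exists>j'\<le>j. e i' \<otimes> e j' = e (FT i j)"
proof (cases "FT i j")
  case 0
  have "e 0 \<otimes> e 0 = e 0" using e_0 by simp
  then show ?thesis using 0 by auto
next
  case (Suc k)
  then have "\<not> below i j k" using FT_below(3)[of i j k] by auto
  then obtain i' j' where ij: "i' \<le> i" "j' \<le> j" "e i' \<otimes> e j' \<notin> e ` {..k}"
    unfolding below_def set_mult_def by auto
  then have "e i' \<otimes> e j' = e (Suc k)" using FT_upper[OF ij(1,2)] Suc by (auto simp: atMost_Suc)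
  then show ?thesis using ij Suc by auto
qed

lemma FT_0: assumes "i < n" shows "FT i 0 = i"
proof -
  have eq: "e ` {..i} <#> e ` {..0} = e ` {..i}"
    using e_0 e_carrier by (auto simp: set_mult_def)
  have "below i 0 i" unfolding below_def eq ..
  then have "FT i 0 \<le> i" using FT_below(3) by auto
  moreover have "e i \<in> e ` {..FT i 0}" using FT_upper[of i i 0 0] e_0 e_carrier by auto
  ultimately show ?thesis using e_mem[OF assms FT_below(2)] by auto
qed

lemma FT_commute: "FT i j = FT j i"
proof -
  have "e ` {..i} <#> e ` {..j} = e ` {..j} <#> e ` {..i}" for i j
  proof -
    have "e a \<otimes> e b = e b \<otimes> e a" for a b using m_comm e_carrier by simp
    then show ?thesis by (auto simp: set_mult_def)
  qed
  then show ?thesis by (simp add: FT_def' below_def)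
qed

lemma FT_flag_type: "flag_type n FT"
proof -
  have "FT i j \<le> FT (Suc i) j" for i j
  proof -
    have "e ` {..i} <#> e ` {..j} \<subseteq> e ` {..Suc i} <#> e ` {..j}" by (intro mono_set_mult image_mono) auto
    then have "below i j (FT (Suc i) j)" using FT_below(1)[of "Suc i" j] unfolding below_def by blast
    then show ?thesis by (rule FT_below(3))
  qed
  then show ?thesis unfolding flag_type_def using FT_below(2) FT_commute FT_0 by auto
qed

lemma order_eq: "order G = n" "finite (carrier G)"
  using bij_betw_same_card[OF e_bij] bij_betw_finite[OF e_bij] by (auto simp: order_def)

text \<open>Realizability refers to groups on a prescribed type. An infinite type has a subset of
  the right size, to which the group is transported by a bijection.\<close>

lemma realizable_FT:
  assumes inf: "infinite (UNIV :: 'c set)" shows "realizable TYPE('c) n FT"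
proof -
  obtain B :: "'c set" where B: "finite B" "card B = card (carrier G)"
    using infinite_arbitrarily_large[OF inf] by metis
  then obtain f where f: "bij_betw f (carrier G) B"
    using finite_same_card_bij[OF order_eq(2) B(1)] by auto
  define g where "g = inv_into (carrier G) f"
  have fi: "f x = f y \<longleftrightarrow> x = y" if "x \<in> carrier G" "y \<in> carrier G" for x y
    using f that by (auto simp: bij_betw_def inj_on_def)
  have gf: "g (f x) = x" if "x \<in> carrier G" for x
    unfolding g_def using f that by (simp add: bij_betw_def)
  have BB: "B = f ` carrier G" using f by (simp add: bij_betw_def)
  define M where "M = \<lparr>carrier = B, monoid.mult = (\<lambda>x y. f (g x \<otimes> g y)), one = f \<one>\<rparr>"
  have M: "carrier M = B" "\<one>\<^bsub>M\<^esub> = f \<one>" "\<And>x y. x \<otimes>\<^bsub>M\<^esub> y = f (g x \<otimes> g y)" by (auto simp: M_def)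
  have cg: "comm_group M"
  proof (rule comm_groupI)
    fix x assume "x \<in> carrier M"
    then obtain a where a: "a \<in> carrier G" "x = f a" using M BB by auto
    then show "\<exists>y\<in>carrier M. y \<otimes>\<^bsub>M\<^esub> x = \<one>\<^bsub>M\<^esub>"
      by (intro bexI[of _ "f (inv a)"]) (auto simp: M gf BB)
  qed (auto simp: M BB gf m_ac)
  define F where "F i = f ` e ` {..i}" for i
  have fe: "f (e i) = f (e j) \<longleftrightarrow> i = j" if "i < n" "j < n" for i j
    using fi e_carrier e_inj that by auto
  have "group_flag M n F"
    unfolding group_flag_def
  proof (intro conjI allI impI)
    show "F 0 = {\<one>\<^bsub>M\<^esub>}" by (simp add: F_def e_0 M)
    show "F (n - 1) = carrier M" by (simp add: F_def e_full M BB)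
    fix i assume i: "i < n"
    have "card (f ` e ` {..i}) = card {..i}"
      unfolding image_image by (rule card_image) (use i fe in \<open>auto simp: inj_on_def\<close>)
    then show "card (F i) = i + 1" by (simp add: F_def)
  next
    fix i assume i: "Suc i < n"
    have "f (e (Suc i)) \<notin> F i" using fe i by (auto simp: F_def)
    then show "F i \<subset> F (Suc i)" by (auto simp: F_def atMost_Suc)
  qed
  moreover have "group_flag_type M F i j = FT i j" for i j
  proof -
    have "F i <#>\<^bsub>M\<^esub> F j = f ` (e ` {..i} <#> e ` {..j})"
      using e_carrier by (force simp: F_def set_mult_def M gf)
    moreover have "f ` V \<subseteq> f ` W \<longleftrightarrow> V \<subseteq> W" if "V \<subseteq> carrier G" "W \<subseteq> carrier G" for V W
    proof
      have inj: "inj_on f (carrier G)" using f by (simp add: bij_betw_def)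
      assume "f ` V \<subseteq> f ` W"
      then show "V \<subseteq> W" using inj_on_image_mem_iff[OF inj _ that(2)] that(1) by blast
    qed (rule image_mono)
    moreover have "e ` {..i} <#> e ` {..j} \<subseteq> carrier G" "\<And>k. e ` {..k} \<subseteq> carrier G"
      using e_carrier by (auto simp: set_mult_def)
    ultimately have "F i <#>\<^bsub>M\<^esub> F j \<subseteq> F k \<longleftrightarrow> below i j k" for k
      unfolding below_def F_def by auto
    then show ?thesis unfolding FT_def' group_flag_type_def by simp
  qed
  moreover have "order M = n" "finite (carrier M)" using B order_eq by (auto simp: order_def M)
  ultimately have "group_realizable TYPE('c) n FT"
    unfolding group_realizable_def using cg by (intro exI[of _ M] exI[of _ F]) auto
  then show ?thesis unfolding realizable_def using FT_flag_type by simp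
qed

end

lemma tower_enum:
  assumes "tower_type n ns" "n \<ge> 2"
  shows "enum_group (tower_group ns) n (tower_elem ns)"
proof -
  have ns: "\<forall>m\<in>set ns. 1 < m" "prod_list ns = n" using assms by (auto simp: tower_type_def)
  interpret comm_group "tower_group ns" by (rule comm_group_tower)
  show ?thesis
    by unfold_locales
       (use ns assms(2) tower_elem_carrier[OF ns(1)] tower_elem_bij[OF ns(1)] tower_elem_0[OF ns(1)] in auto)
qed

lemma tower_realizable:
  assumes "tower_type n ns" "n \<ge> 2" "infinite (UNIV :: 'b set)"
  shows "realizable TYPE('b) n (tower_flag_type ns)"
proof -
  interpret enum_group "tower_group ns" n "tower_elem ns" by (rule tower_enum[OF assms(1,2)])
  have "FT = tower_flag_type ns" unfolding FT_def tower_flag_type_def tower_flag_def ..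
  then show ?thesis using realizable_FT[OF assms(3)] by simp
qed

text \<open>If \<open>i + j\<close> has no carry, the flag type at \<open>(i, j)\<close> is at least
  \<open>i + j\<close>, and monotonicity of \<open>x\<close> gives the inequality. Conversely, the
  flag type is attained at indices below \<open>i\<close> and \<open>j\<close>, and by
  \<open>tadd_dominated\<close> it is at most a sum without carry of still smaller indices.\<close>

lemma tower_polyhedron:
  assumes "tower_type n ns" "n \<ge> 2"
  shows "x \<in> flag_polyhedron n (tower_flag_type ns) \<longleftrightarrow>
    x \<in> {1..<n} \<rightarrow>\<^sub>E UNIV \<and> (\<forall>i\<in>{1..<n}. 0 \<le> x i) \<and>
    (\<forall>i j. 1 \<le> i \<and> i \<le> j \<and> j < n \<longrightarrow> x i \<le> x j) \<and>
    (\<forall>i j. 1 \<le> i \<and> 1 \<le> j \<and> i + j < n \<and> no_carry ns i j \<longrightarrow> x (i + j) \<le> x i + x j)"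
    (is "_ \<longleftrightarrow> ?base \<and> ?nonneg \<and> ?mono \<and> ?nc")
proof -
  interpret enum_group "tower_group ns" n "tower_elem ns" by (rule tower_enum[OF assms])
  have T: "tower_flag_type ns = FT" unfolding FT_def tower_flag_type_def tower_flag_def ..
  have ns: "\<forall>m\<in>set ns. 1 < m" "\<forall>m\<in>set ns. 0 < m" "prod_list ns = n" using assms by (auto simp: tower_type_def)
  have mult: "tower_elem ns i \<otimes>\<^bsub>tower_group ns\<^esub> tower_elem ns j = tower_elem ns (tadd ns i j)" for i j
    by (rule tower_elem_mult[OF ns(1)])
  have lt: "tadd ns i j < n" for i j using tadd_less[OF ns(2)] ns(3) by simp
  have le: "tadd ns i' j' \<le> FT i j" if "i' \<le> i" "j' \<le> j" for i j i' j'
    using FT_upper[OF that] e_mem[OF lt FT_below(2)] mult by simp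
  have "(\<forall>i\<in>{1..<n}. \<forall>j\<in>{1..<n}. x (FT i j) \<le> x i + x j) \<longleftrightarrow> ?nc" if mono: ?mono and nonneg: ?nonneg
  proof
    assume a: "\<forall>i\<in>{1..<n}. \<forall>j\<in>{1..<n}. x (FT i j) \<le> x i + x j"
    show ?nc
    proof (intro allI impI, elim conjE)
      fix i j assume ij: "1 \<le> i" "1 \<le> j" "i + j < n" "no_carry ns i j"
      have "tadd ns i j = i + j" using no_carry_tadd[OF ns(2)] ij ns(3) by simp
      then have "i + j \<le> FT i j" using le[of i i j j] by simp
      then have "x (i + j) \<le> x (FT i j)" using mono ij FT_below(2)[of i j] by auto
      also have "\<dots> \<le> x i + x j" using a ij by auto
      finally show "x (i + j) \<le> x i + x j" .
    qed
  next
    assume nc: ?nc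
    show "\<forall>i\<in>{1..<n}. \<forall>j\<in>{1..<n}. x (FT i j) \<le> x i + x j"
    proof (intro ballI)
      fix i j assume ij: "i \<in> {1..<n}" "j \<in> {1..<n}"
      obtain i1 j1 where 1: "i1 \<le> i" "j1 \<le> j" "tower_elem ns (tadd ns i1 j1) = tower_elem ns (FT i j)"
        using FT_attained[of i j] mult by auto
      have FTeq: "FT i j = tadd ns i1 j1" using 1 e_inj[OF lt FT_below(2)] by simp
      obtain i2 j2 where 2: "i2 \<le> i1" "j2 \<le> j1" "no_carry ns i2 j2" "tadd ns i1 j1 \<le> i2 + j2"
        using tadd_dominated[OF ns(2)] by blast
      \<comment> \<open>The coordinates of \<open>x\<close>, and hence its monotonicity, start at
        index 1.\<close>
      have "1 \<le> FT i j" using le[of i i 0 j] no_carry_tadd[OF ns(2), of i 0] FT_0[of i]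
          le[of i i 0 0] ij FT_upper[of i i 0 j] e_0 e_mem[of i "FT i j"] FT_below(2)[of i j] e_carrier by auto
      have s: "i2 + j2 < n" using no_carry_tadd[OF ns(2) _ _ 2(3)] 1 2 ij ns(3) lt[of i2 j2] by simp
      have x2: "x (FT i j) \<le> x (i2 + j2)" using mono \<open>1 \<le> FT i j\<close> 2(4) s FTeq by auto
      have nn: "0 \<le> x i" "0 \<le> x j" using nonneg ij by auto
      consider "i2 = 0" | "j2 = 0" | "1 \<le> i2" "1 \<le> j2" by linarith
      then show "x (FT i j) \<le> x i + x j"
      proof cases
        case 1
        have "j2 \<noteq> 0" using 1 2(4) FTeq \<open>1 \<le> FT i j\<close> by auto
        then have "x j2 \<le> x j" using mono 2 \<open>j1 \<le> j\<close> ij by auto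
        then show ?thesis using x2 1 nn by simp
      next
        case 2
        have "i2 \<noteq> 0" using 2 \<open>tadd ns i1 j1 \<le> i2 + j2\<close> FTeq \<open>1 \<le> FT i j\<close> by auto
        then have "x i2 \<le> x i" using mono \<open>i2 \<le> i1\<close> \<open>i1 \<le> i\<close> ij by auto
        then show ?thesis using x2 2 nn by simp
      next
        case 3
        have "x (i2 + j2) \<le> x i2 + x j2" using nc 3 s 2(3) by blast
        moreover have "x i2 \<le> x i" "x j2 \<le> x j" using mono 3 2 \<open>i1 \<le> i\<close> \<open>j1 \<le> j\<close> ij by auto
        ultimately show ?thesis using x2 by simp
      qed
    qed
  qed
  then show ?thesis unfolding flag_polyhedron_def T by blast
qed

text \<open>The elements of the tower group, listed by increasing weight, form a flag, and
  \<open>x i\<close> is the weight at position \<open>i\<close>. Subadditivity of the weight puts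
  \<open>x\<close> into the polyhedron of that flag. The last conclusion reduces comparisons of
  coordinates to counting sublevel sets.\<close>

lemma weight_point:
  fixes w :: "nat \<Rightarrow> real"
  assumes ns: "tower_type n ns" "n \<ge> 2" and inf: "infinite (UNIV :: 'b set)"
    and w0: "w 0 = 0" and wpos: "\<And>i. 0 < i \<Longrightarrow> i < n \<Longrightarrow> 0 < w i"
    and wadd: "\<And>i j. i < n \<Longrightarrow> j < n \<Longrightarrow> w (tadd ns i j) \<le> w i + w j"
  obtains T x where "realizable TYPE('b) n T" "x \<in> flag_polyhedron n T"
    "\<And>i r. 1 \<le> i \<Longrightarrow> i < n \<Longrightarrow> x i \<le> r \<longleftrightarrow> i < card {j. j < n \<and> w j \<le> r}"
proof -
  interpret t: enum_group "tower_group ns" n "tower_elem ns" by (rule tower_enum[OF ns])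
  have ns': "\<forall>m\<in>set ns. 1 < m" "\<forall>m\<in>set ns. 0 < m" "prod_list ns = n" using ns by (auto simp: tower_type_def)
  define l where "l = sort_key w [0..<n]"
  have l: "length l = n" "set l = {0..<n}" "distinct l" "sorted (map w l)" by (simp_all add: l_def)
  have lmono: "w (l ! i) \<le> w (l ! j)" if "i \<le> j" "j < n" for i j
    using sorted_nth_mono[OF l(4) that(1)] that l(1) by simp
  have lmem: "l ! i < n" if "i < n" for i using nth_mem[of i l] l that by auto
  have linj: "l ! i = l ! j \<longleftrightarrow> i = j" if "i < n" "j < n" for i j using nth_eq_iff_index_eq[OF l(3)] l(1) that by simp
  have lex: "\<exists>i<n. l ! i = a" if "a < n" for a using that l in_set_conv_nth[of a l] by auto
  have l0: "l ! 0 = 0"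
  proof (rule ccontr)
    assume "l ! 0 \<noteq> 0"
    then have "0 < w (l ! 0)" using wpos lmem ns by simp
    moreover obtain i where "i < n" "l ! i = 0" using lex ns(2) by (metis less_le_trans pos2)
    ultimately show False using lmono[of 0 i] w0 by simp
  qed
  \<comment> \<open>The identity is a default value from \<open>n\<close> on, since
    \<open>enum_group\<close> asks for all values of \<open>e\<close> to lie in the carrier.\<close>
  define e where "e i = (if i < n then tower_elem ns (l ! i) else tower_elem ns 0)" for i
  have lbij: "bij_betw ((!) l) {..<n} {..<n}"
    using bij_betw_nth[OF l(3), of "{..<n}" "{..<n}"] l by (simp add: lessThan_atLeast0)
  have "bij_betw (tower_elem ns \<circ> (!) l) {..<n} (carrier (tower_group ns))"
    using bij_betw_trans[OF lbij t.e_bij] .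
  then have ebij: "bij_betw e {..<n} (carrier (tower_group ns))"
    by (rule bij_betw_cong[THEN iffD1, rotated]) (simp add: e_def)
  interpret g: enum_group "tower_group ns" n e
    by unfold_locales (use ns t.e_carrier ebij t.e_0 l0 in \<open>auto simp: e_def\<close>)
  define x where "x = (\<lambda>i\<in>{1..<n}. w (l ! i))"
  have step: "x (g.FT i j) \<le> x i + x j" if ij: "i \<in> {1..<n}" "j \<in> {1..<n}" for i j
  proof -
    obtain a b where ab: "a \<le> i" "b \<le> j" "e a \<otimes>\<^bsub>tower_group ns\<^esub> e b = e (g.FT i j)" using g.FT_attained by blast
    have lt: "a < n" "b < n" "g.FT i j < n" using ab ij g.FT_below(2) by auto
    then have "tower_elem ns (tadd ns (l ! a) (l ! b)) = tower_elem ns (l ! g.FT i j)"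
      using ab tower_elem_mult[OF ns'(1)] by (simp add: e_def)
    then have eq: "tadd ns (l ! a) (l ! b) = l ! g.FT i j"
      using t.e_inj[of "tadd ns (l ! a) (l ! b)" "l ! g.FT i j"] tadd_less[OF ns'(2)] ns'(3) lmem lt by simp
    have "w (l ! g.FT i j) \<le> w (l ! a) + w (l ! b)" using wadd[of "l ! a" "l ! b"] lmem lt eq by simp
    also have "\<dots> \<le> w (l ! i) + w (l ! j)" using lmono ab ij by (intro add_mono) auto
    finally have *: "w (l ! g.FT i j) \<le> w (l ! i) + w (l ! j)" .
    have "i \<le> g.FT i j"
      using g.FT_upper[of i i 0 j] g.e_0 g.e_carrier g.e_mem[of i "g.FT i j"] lt ij by auto
    then have "g.FT i j \<in> {1..<n}" using ij lt by auto
    then show ?thesis using * ij by (simp add: x_def)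
  qed
  have wnn: "0 \<le> w i" if "i < n" for i using w0 wpos[of i] that by (cases "i = 0") auto
  have "x \<in> flag_polyhedron n g.FT"
    unfolding flag_polyhedron_def using step lmono wnn lmem by (auto simp: x_def)
  moreover have "x i \<le> r \<longleftrightarrow> i < card {j. j < n \<and> w j \<le> r}" if i: "1 \<le> i" "i < n" for i r
  proof -
    let ?I = "{k. k < n \<and> w (l ! k) \<le> r}"
    have "{j. j < n \<and> w j \<le> r} = (!) l ` ?I" using lex lmem by (force simp: image_iff)
    moreover have "inj_on ((!) l) ?I" using linj by (auto simp: inj_on_def)
    ultimately have c: "card {j. j < n \<and> w j \<le> r} = card ?I" by (simp add: card_image)
    have xi: "x i = w (l ! i)" using i by (simp add: x_def)
    show ?thesis
    proof
      assume "x i \<le> r"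
      then have "w (l ! k) \<le> r" if "k \<le> i" for k using lmono[OF that i(2)] xi by simp
      then have "{..i} \<subseteq> ?I" using i by auto
      then have "card {..i} \<le> card ?I" by (intro card_mono) auto
      then show "i < card {j. j < n \<and> w j \<le> r}" using c by simp
    next
      assume less: "i < card {j. j < n \<and> w j \<le> r}"
      show "x i \<le> r"
      proof (rule ccontr)
        assume "\<not> x i \<le> r"
        then have "r < w (l ! k)" if "i \<le> k" "k < n" for k using lmono[OF that] xi by simp
        then have "?I \<subseteq> {..<i}" by (auto simp: not_less[symmetric])
        then have "card ?I \<le> card {..<i}" by (intro card_mono) auto
        then show False using less c by simp
      qed
    qed
  qed
  ultimately show ?thesis using that g.realizable_FT[OF inf] by blast
qed

section \<open>Towers for the degrees in the list\<close>

lemma (in flag_group) tower_exists: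
  assumes "(\<exists>p k. Factorial_Ring.prime p \<and> k \<ge> 1 \<and> n = p ^ k) \<or>
         (\<exists>p q. Factorial_Ring.prime p \<and> Factorial_Ring.prime q \<and> p \<noteq> q \<and> n = p * q) \<or> n = 12"
  shows "\<exists>ns. tower_type n ns \<and> (\<forall>i j. violation i j \<longrightarrow> \<not> no_carry ns i j)"
  using assms
proof (elim disjE exE conjE)
  fix p k assume p: "Factorial_Ring.prime p" "k \<ge> 1" "n = p ^ k"
  have p1: "1 < p" using p(1) prime_gt_1_nat by blast
  \<comment> \<open>Its partial products are all divisors of \<open>n\<close>, so a carry modulo any
    stabilizer dimension is seen.\<close>
  let ?ns = "replicate k p"
  have "tower_type n ?ns" using p p1 by (simp add: tower_type_def)
  moreover have "\<not> no_carry ?ns i j" if "violation i j" for i j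
  proof
    assume nc: "no_carry ?ns i j"
    obtain e where e: "e \<le> k" "p ^ e \<le> i mod p ^ e + j mod p ^ e"
      using prime_power_case[OF p(1,3) \<open>violation i j\<close>] by auto
    have "\<forall>m\<in>set ?ns. 0 < m" using p1 by auto
    then have "i mod prod_list (take e ?ns) + j mod prod_list (take e ?ns) < prod_list (take e ?ns)"
      using nc e(1) by (simp add: no_carry_iff)
    then show False using e by (simp add: min_absorb1)
  qed
  ultimately show ?thesis by blast
next
  fix p q assume pq: "Factorial_Ring.prime p" "Factorial_Ring.prime q" "p \<noteq> q" "n = p * q"
  have "1 < p" "1 < q" using pq prime_gt_1_nat by blast+
  then have tt: "tower_type n [p, q]" "tower_type n [q, p]" using pq by (simp_all add: tower_type_def)
  show ?thesis
  proof (rule ccontr)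
    assume not: "\<not> ?thesis"
    then obtain i j where ij: "violation i j" "no_carry [q, p] i j" using tt by blast
    from not obtain k l where kl: "violation k l" "no_carry [p, q] k l" using tt by blast
    show False using two_primes_case[OF pq ij(1) _ kl(1)] ij(2) kl(2) by simp
  qed
next
  assume n12: "n = 12"
  have tt: "tower_type n [2,2,3]" "tower_type n [2,3,2]" "tower_type n [3,2,2]"
    using n12 by (simp_all add: tower_type_def)
  have nc: "i mod a + j mod a < a" "i mod (a * b) + j mod (a * b) < a * b"
    if "no_carry [a, b, c] i j" "0 < a" "0 < b" "0 < c" for a b c i j
  proof -
    have "\<forall>m\<in>set [a, b, c]. 0 < m" using that by simp
    then have *: "\<And>s. s \<le> 3 \<Longrightarrow> i mod prod_list (take s [a, b, c]) + j mod prod_list (take s [a, b, c]) < prod_list (take s [a, b, c])"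
      using that(1) no_carry_iff[of "[a, b, c]" i j] by simp
    show "i mod a + j mod a < a" using *[of 1] by simp
    show "i mod (a * b) + j mod (a * b) < a * b" using *[of 2] by (simp add: numeral_2_eq_2)
  qed
  show ?thesis
  proof (rule ccontr)
    assume not: "\<not> ?thesis"
    then obtain i1 j1 where 1: "violation i1 j1" "no_carry [2,2,3] i1 j1" using tt by blast
    from not obtain i2 j2 where 2: "violation i2 j2" "no_carry [2,3,2] i2 j2" using tt by blast
    from not obtain i3 j3 where 3: "violation i3 j3" "no_carry [3,2,2] i3 j3" using tt by blast
    show False
      by (rule twelve_case[OF n12 1(1) _ _ 2(1) _ _ 3(1)])
         (use nc[OF 1(2)] nc[OF 2(2)] nc[OF 3(2)] in simp_all)
  qed
qed

lemma (in flag_group) tower_point: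
  assumes good: "(\<exists>p k. Factorial_Ring.prime p \<and> k \<ge> 1 \<and> m = p ^ k) \<or>
         (\<exists>p q. Factorial_Ring.prime p \<and> Factorial_Ring.prime q \<and> p \<noteq> q \<and> m = p * q) \<or> m = 12"
    and m: "n = m" "m \<ge> 2" and x: "x \<in> flag_polyhedron m T"
  shows "\<exists>ns. tower_type m ns \<and> x \<in> flag_polyhedron m (tower_flag_type ns)"
proof -
  obtain ns where ns: "tower_type m ns" "\<forall>i j. violation i j \<longrightarrow> \<not> no_carry ns i j"
    using tower_exists[unfolded m(1), OF good] by blast
  have "x (i + j) \<le> x i + x j" if "1 \<le> i" "1 \<le> j" "i + j < m" "no_carry ns i j" for i j
    using that ns(2) m unfolding violation_def by (meson not_le)
  then have "x \<in> flag_polyhedron m (tower_flag_type ns)"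
    unfolding tower_polyhedron[OF ns(1) m(2)] using x unfolding flag_polyhedron_def by blast
  then show ?thesis using ns by blast
qed

section \<open>Flags of finite groups\<close>

lemma chain_mono:
  assumes "\<And>i. Suc i < n \<Longrightarrow> F i \<subset> F (Suc i)" "i \<le> j" "j < n" shows "F i \<subseteq> F j"
  using assms(2,3)
proof (induction j)
  case (Suc j)
  then show ?case using assms(1)[of j] by (cases "i = Suc j") auto
qed simp

lemma dim_group_Pow:
  assumes "comm_group G" "finite (carrier G)"
  shows "dim_group G (Pow (carrier G)) card"
proof -
  interpret comm_group G by fact
  have fin: "finite V" if "V \<subseteq> carrier G" for V using that assms(2) finite_subset by blast
  have sp: "\<Inter>{Z \<in> Pow (carrier G). V \<subseteq> Z} = V" if "V \<subseteq> carrier G" for V using that by blast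
  show ?thesis
  proof
    fix g V assume g: "g \<in> carrier G" "V \<in> Pow (carrier G)"
    show "g <#\<^bsub>G\<^esub> V \<in> Pow (carrier G)" using g by (auto simp: l_coset_def)
    have "g <#\<^bsub>G\<^esub> V = (\<otimes>\<^bsub>G\<^esub>) g ` V" by (auto simp: l_coset_def)
    moreover have "inj_on ((\<otimes>\<^bsub>G\<^esub>) g) V" using g by (auto simp: inj_on_def subset_iff)
    ultimately show "card (g <#\<^bsub>G\<^esub> V) = card V" by (simp add: card_image)
  next
    fix V W assume "V \<in> Pow (carrier G)" "W \<in> Pow (carrier G)"
    then have s: "V \<subseteq> carrier G" "W \<subseteq> carrier G" "V \<union> W \<subseteq> carrier G" by auto
    show "card (V \<inter> W) + card (\<Inter>{Z \<in> Pow (carrier G). V \<union> W \<subseteq> Z}) = card V + card W"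
      unfolding sp[OF s(3)] using card_Un_Int[OF fin[OF s(1)] fin[OF s(2)]] by simp
    assume "V \<subset> W"
    then show "card V < card W" using psubset_card_mono fin s by blast
  next
    have "{\<one>\<^bsub>G\<^esub>} \<subseteq> carrier G" by simp
    from sp[OF this] show "card (\<Inter>{Z \<in> Pow (carrier G). {\<one>\<^bsub>G\<^esub>} \<subseteq> Z}) = 1" by simp
  qed auto
qed

lemma group_flag_group:
  assumes G: "comm_group G" "finite (carrier G)" "order G = n" and F: "group_flag G n F" and n2: "n \<ge> 2"
    and T: "flag_type n T" "\<forall>i<n. \<forall>j<n. T i j = group_flag_type G F i j" and x: "x \<in> flag_polyhedron n T"
  shows "flag_group G (Pow (carrier G)) card F x"
proof -
  interpret dim_group G "Pow (carrier G)" card by (rule dim_group_Pow[OF G(1,2)])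
  have n: "card (carrier G) = n" using G by (simp add: order_def)
  have F': "F 0 = {\<one>\<^bsub>G\<^esub>}" "F (n - 1) = carrier G" "\<And>i. Suc i < n \<Longrightarrow> F i \<subset> F (Suc i)" "\<And>i. i < n \<Longrightarrow> card (F i) = i + 1"
    using F unfolding group_flag_def by auto
  have Fm: "F i \<subseteq> F j" if "i \<le> j" "j < n" for i j using chain_mono[of n F i j] F'(3) that by blast
  have Fc: "F i \<subseteq> carrier G" if "i < n" for i using Fm[of i "n - 1"] that F'(2) by simp
  show ?thesis
  proof (unfold_locales; (unfold n)?)
    show "F i \<in> Pow (carrier G)" if "i < n" for i using Fc[OF that] by simp
    show "card (F i) = i + 1" if "i < n" for i using F' that by simp
    show "F i \<subseteq> F j" if "i \<le> j" "j < n" for i j using Fm that .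
    show "\<one>\<^bsub>G\<^esub> \<in> F 0" using F' by simp
    show "x i \<le> x j" if "1 \<le> i" "i \<le> j" "j < n" for i j using x that unfolding flag_polyhedron_def by blast
    show "\<exists>k<n. (\<forall>a\<in>F i. \<forall>b\<in>F j. a \<otimes>\<^bsub>G\<^esub> b \<in> F k) \<and> x k \<le> x i + x j"
      if ij: "1 \<le> i" "i < n" "1 \<le> j" "j < n" for i j
    proof (intro exI[of _ "T i j"] conjI ballI)
      show "T i j < n" using T(1) ij by (simp add: flag_type_def)
      show "x (T i j) \<le> x i + x j" using x ij unfolding flag_polyhedron_def by auto
      have "F i <#>\<^bsub>G\<^esub> F j \<subseteq> F (n - 1)" unfolding F'(2) using set_mult_closed[OF Fc Fc] ij by blast
      then have "F i <#>\<^bsub>G\<^esub> F j \<subseteq> F (T i j)"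
        using T(2) ij unfolding group_flag_type_def by (metis (mono_tags, lifting) LeastI)
      then show "a \<otimes>\<^bsub>G\<^esub> b \<in> F (T i j)" if "a \<in> F i" "b \<in> F j" for a b using that by (auto simp: set_mult_def)
    qed
  qed
qed

section \<open>Groups and field extensions as instances\<close>

locale finite_extension = field L for L (structure) +
  fixes K :: "'a set" and m :: nat
  assumes K: "subfield K L" and dim_L: "dimension m K (carrier L)"
begin

definition sub :: "'a set \<Rightarrow> bool" where "sub V \<longleftrightarrow> subalgebra K V L"

definition dm :: "'a set \<Rightarrow> nat" where "dm A = (dim over K) (insert \<zero> A)"

definition SS :: "'a set set" where "SS = {A. \<zero> \<notin> A \<and> sub (insert \<zero> A)}"

lemma K_carrier: "K \<subseteq> carrier L" "\<zero> \<in> K" "\<one> \<in> K"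
  using subringE[OF subfieldE(1)[OF K]] by auto

lemma subD: assumes "sub V"
  shows "V \<subseteq> carrier L" "\<zero> \<in> V" "\<And>x y. x \<in> V \<Longrightarrow> y \<in> V \<Longrightarrow> x \<oplus> y \<in> V" "\<And>k x. k \<in> K \<Longrightarrow> x \<in> V \<Longrightarrow> k \<otimes> x \<in> V"
    "subgroup V (add_monoid L)" "finite_dimension K V" "dimension ((dim over K) V) K V" "insert \<zero> (V - {\<zero>}) = V"
proof -
  have s: "subalgebra K V L" using assms by (simp add: sub_def)
  show 1: "V \<subseteq> carrier L" by (rule subalgebra_in_carrier[OF s])
  show sg: "subgroup V (add_monoid L)" using s by (rule subalgebra.axioms(1))
  show 0: "\<zero> \<in> V" "\<And>x y. x \<in> V \<Longrightarrow> y \<in> V \<Longrightarrow> x \<oplus> y \<in> V"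
    using subgroup.one_closed[OF sg] subgroup.m_closed[OF sg] by auto
  show "\<And>k x. k \<in> K \<Longrightarrow> x \<in> V \<Longrightarrow> k \<otimes> x \<in> V" by (rule subalgebra.smult_closed[OF s])
  show f: "finite_dimension K V"
    by (rule subalbegra_incl_imp_finite_dimension[OF K finite_dimensionI[OF dim_L] s 1])
  show "dimension ((dim over K) V) K V" by (rule finite_dimensionE[OF K f])
  show "insert \<zero> (V - {\<zero>}) = V" using 0 by auto
qed

lemma subI:
  assumes "V \<subseteq> carrier L" "\<zero> \<in> V" "\<And>x y. x \<in> V \<Longrightarrow> y \<in> V \<Longrightarrow> x \<oplus> y \<in> V" "\<And>k x. k \<in> K \<Longrightarrow> x \<in> V \<Longrightarrow> k \<otimes> x \<in> V"
  shows "sub V"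
proof -
  have neg: "\<ominus> x \<in> V" if "x \<in> V" for x
  proof -
    have "\<ominus> \<one> \<in> K" using K_carrier(3) subringE(5)[OF subfieldE(1)[OF K]] by blast
    then have "(\<ominus> \<one>) \<otimes> x \<in> V" using assms(4) that by blast
    moreover have "x \<in> carrier L" using that assms(1) by blast
    ultimately show ?thesis by (simp add: l_minus)
  qed
  have "subgroup V (add_monoid L)"
    by (rule add.subgroupI) (use assms neg in \<open>auto simp: a_inv_def\<close>)
  then show ?thesis unfolding sub_def subalgebra_def subalgebra_axioms_def using assms(4) by blast
qed

lemma dim_strict:
  assumes "sub V" "sub W" "V \<subset> W" shows "(dim over K) V < (dim over K) W"
proof -
  obtain Us where Us: "set Us \<subseteq> carrier L" "independent K Us" "length Us = (dim over K) V" "Span K Us = V"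
    using exists_base[OF K subD(7)[OF assms(1)]] by auto
  obtain w where w: "w \<in> W" "w \<notin> V" using assms(3) by auto
  have "independent K (w # Us)" using w Us subD(1)[OF assms(2)] by (intro li_Cons) auto
  moreover have "set (w # Us) \<subseteq> W" using w Us Span_base_incl[OF K Us(1)] assms(3) by auto
  ultimately have "length (w # Us) \<le> (dim over K) W"
    by (rule independent_length_le_dimension[OF K subD(7)[OF assms(2)]])
  then show ?thesis using Us by simp
qed

lemma sub_carrier: "sub (carrier L)"
  by (rule subI) (use K_carrier in auto)

lemma sub_zero: "sub {\<zero>}" "(dim over K) {\<zero>} = 0"
proof -
  show "sub {\<zero>}" by (rule subI) (use K_carrier in auto)
  show "(dim over K) {\<zero>} = 0" by (rule dimI[OF K zero_dim])
qed

lemma sub_K: "sub K" "(dim over K) K = 1"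
proof -
  show "sub K" by (rule subI) (use K_carrier subringE[OF subfieldE(1)[OF K]] in auto)
  show "(dim over K) K = 1" using dimI[OF K dimension_one[OF K]] .
qed

lemma SS_I: "sub V \<Longrightarrow> V - {\<zero>} \<in> SS" "sub V \<Longrightarrow> dm (V - {\<zero>}) = (dim over K) V"
  unfolding SS_def dm_def using subD(8)[of V] by auto

lemma SS_D: assumes "A \<in> SS" shows "sub (insert \<zero> A)" "\<zero> \<notin> A" "A \<subseteq> carrier L" "dm A = (dim over K) (insert \<zero> A)"
  using assms subD(1)[of "insert \<zero> A"] by (auto simp: SS_def dm_def)

lemma sub_Int: "sub V \<Longrightarrow> sub W \<Longrightarrow> sub (V \<inter> W)"
  unfolding sub_def by (rule subalgebra_inter)

lemma scale:
  assumes "g \<in> carrier L - {\<zero>}" "sub V"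
  shows "sub ((\<otimes>) g ` V)" "(dim over K) ((\<otimes>) g ` V) = (dim over K) V"
proof -
  note V = subD[OF assms(2)]
  have g: "g \<in> carrier L" "g \<noteq> \<zero>" using assms by auto
  show "sub ((\<otimes>) g ` V)"
  proof (rule subI)
    show "(\<otimes>) g ` V \<subseteq> carrier L" using V g by auto
    show "\<zero> \<in> (\<otimes>) g ` V" using V(2) g by (intro image_eqI[of _ _ \<zero>]) auto
  next
    fix x y assume "x \<in> (\<otimes>) g ` V" "y \<in> (\<otimes>) g ` V"
    then obtain a b where ab: "a \<in> V" "b \<in> V" "x = g \<otimes> a" "y = g \<otimes> b" by auto
    then have "x \<oplus> y = g \<otimes> (a \<oplus> b)" using V(1) g r_distr by (metis subsetD)
    then show "x \<oplus> y \<in> (\<otimes>) g ` V" using V(3) ab by blast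
  next
    fix k x assume k: "k \<in> K" "x \<in> (\<otimes>) g ` V"
    then obtain a where a: "a \<in> V" "x = g \<otimes> a" by auto
    have "k \<in> carrier L" "a \<in> carrier L" using k a V K_carrier by auto
    then have "k \<otimes> x = g \<otimes> (k \<otimes> a)" using a g by (simp add: m_lcomm)
    then show "k \<otimes> x \<in> (\<otimes>) g ` V" using V(4) a k by blast
  qed
  \<comment> \<open>Multiplication by \<open>g\<close> maps a line extension to a line extension.
    The scalars are generalized to \<open>K'\<close> for rule induction on
    \<open>dimension\<close>.\<close>
  have "dimension j K ((\<otimes>) g ` E)" if "dimension j K' E" "K' = K" for j E K'
    using that
  proof (induction rule: dimension.induct)
    case (zero_dim K')
    have "(\<otimes>) g ` {\<zero>} = {\<zero>}" using g by simp
    then show ?case using dimension.zero_dim by simp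
  next
    case (Suc_dim v E j K')
    have Ec: "E \<subseteq> carrier L" using space_subgroup_props(1)[OF K] Suc_dim(3,5) by blast
    have "g \<otimes> v \<notin> (\<otimes>) g ` E"
    proof
      assume "g \<otimes> v \<in> (\<otimes>) g ` E"
      then obtain u where "u \<in> E" "g \<otimes> v = g \<otimes> u" by auto
      then show False using m_lcancel[OF g(2,1) Suc_dim(1)] Ec Suc_dim(2) by auto
    qed
    then have "dimension (Suc j) K (line_extension K (g \<otimes> v) ((\<otimes>) g ` E))"
      using Suc_dim g by (intro dimension.Suc_dim) auto
    moreover have "line_extension K (g \<otimes> v) ((\<otimes>) g ` E) = (\<otimes>) g ` line_extension K v E"
    proof -
      have "k \<otimes> (g \<otimes> v) \<oplus> g \<otimes> u = g \<otimes> (k \<otimes> v \<oplus> u)" if "k \<in> K" "u \<in> E" for k u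
      proof -
        have "k \<in> carrier L" "u \<in> carrier L" using that K_carrier Ec by auto
        then show ?thesis using g Suc_dim(1) by (simp add: r_distr m_lcomm)
      qed
      then show ?thesis
        by (force simp: line_extension_mem_iff image_iff)
    qed
    ultimately show ?case using Suc_dim(5) by simp
  qed
  from dimI[OF K this[OF V(7) refl]] show "(dim over K) ((\<otimes>) g ` V) = (dim over K) V" .
qed

lemma comm_group_mult: "comm_group (Multiplicative_Group.mult_of L)"
  by (rule group.group_comm_groupI[OF field_mult_group]) (simp add: m_comm)

lemma insert_coset: "g \<in> carrier L - {\<zero>} \<Longrightarrow> A \<subseteq> carrier L \<Longrightarrow> insert \<zero> (l_coset (Multiplicative_Group.mult_of L) g A) = (\<otimes>) g ` insert \<zero> A"
  by (auto simp: l_coset_def)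

lemma SS_Inter: assumes "M \<noteq> {}" "M \<subseteq> SS" shows "\<Inter>M \<in> SS"
proof -
  have A: "sub (insert \<zero> A)" "\<zero> \<notin> A" if "A \<in> M" for A using that assms SS_D by auto
  have "sub (insert \<zero> (\<Inter>M))"
  proof (rule subI)
    show "insert \<zero> (\<Inter>M) \<subseteq> carrier L" using assms A subD(1) by fastforce
  next
    fix x y assume xy: "x \<in> insert \<zero> (\<Inter>M)" "y \<in> insert \<zero> (\<Inter>M)"
    have "x \<oplus> y \<in> insert \<zero> A" if "A \<in> M" for A
      using subD(3)[OF A(1)[OF that]] xy that by blast
    then show "x \<oplus> y \<in> insert \<zero> (\<Inter>M)" by blast
  next
    fix k x assume kx: "k \<in> K" "x \<in> insert \<zero> (\<Inter>M)"
    have "k \<otimes> x \<in> insert \<zero> A" if "A \<in> M" for A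
      using subD(4)[OF A(1)[OF that]] kx that by blast
    then show "k \<otimes> x \<in> insert \<zero> (\<Inter>M)" by blast
  qed simp
  then show ?thesis using assms A by (auto simp: SS_def)
qed

lemma SS_modular:
  assumes "A \<in> SS" "B \<in> SS"
  shows "dm (A \<inter> B) + dm (\<Inter>{Z \<in> SS. A \<union> B \<subseteq> Z}) = dm A + dm B"
proof -
  define V W where "V = insert \<zero> A" and "W = insert \<zero> B"
  have V: "sub V" "sub W" using SS_D assms unfolding V_def W_def by auto
  note v = subD[OF V(1)] and w = subD[OF V(2)]
  define E where "E = V <+>\<^bsub>L\<^esub> W"
  have E: "E = {a \<oplus> b | a b. a \<in> V \<and> b \<in> W}" unfolding E_def set_add_def' by auto
  have fin: "finite_dimension K E" "(dim over K) E = (dim over K) V + (dim over K) W - (dim over K) (V \<inter> W)"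
    unfolding E_def using sum_space_dim[OF K v(6) w(6)] by auto
  have subE: "sub E" unfolding sub_def by (rule finite_dimension_imp_subalgebra[OF K fin(1)])
  have sub2: "V \<subseteq> E" "W \<subseteq> E"
  proof -
    have "a = a \<oplus> \<zero>" if "a \<in> V" for a using that v(1) by auto
    then show "V \<subseteq> E" unfolding E using w(2) by blast
    have "b = \<zero> \<oplus> b" if "b \<in> W" for b using that w(1) by auto
    then show "W \<subseteq> E" unfolding E using v(2) by blast
  qed
  have "\<Inter>{Z \<in> SS. A \<union> B \<subseteq> Z} = E - {\<zero>}"
  proof
    have "E - {\<zero>} \<in> SS" using SS_I subE by simp
    moreover have "A \<union> B \<subseteq> E - {\<zero>}" using sub2 SS_D(2) assms unfolding V_def W_def by auto
    ultimately show "\<Inter>{Z \<in> SS. A \<union> B \<subseteq> Z} \<subseteq> E - {\<zero>}" by blast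
    show "E - {\<zero>} \<subseteq> \<Inter>{Z \<in> SS. A \<union> B \<subseteq> Z}"
    proof (rule Inter_greatest)
      fix Z assume "Z \<in> {Z \<in> SS. A \<union> B \<subseteq> Z}"
      then have Z: "sub (insert \<zero> Z)" "A \<subseteq> Z" "B \<subseteq> Z" using SS_D by auto
      show "E - {\<zero>} \<subseteq> Z"
        using subD(3)[OF Z(1)] Z(2,3) unfolding E V_def W_def by blast
    qed
  qed
  then have "dm (\<Inter>{Z \<in> SS. A \<union> B \<subseteq> Z}) = (dim over K) E" using SS_I(2)[OF subE] by simp
  moreover have "insert \<zero> (A \<inter> B) = V \<inter> W" unfolding V_def W_def by auto
  then have "dm (A \<inter> B) = (dim over K) (V \<inter> W)" by (simp add: dm_def)
  \<comment> \<open>The dimension of the sum was obtained with truncated subtraction; this bound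
    makes the difference exact.\<close>
  moreover have "(dim over K) (V \<inter> W) \<le> (dim over K) V"
    using dim_strict[OF sub_Int[OF V] V(1)] by (cases "V \<inter> W = V") (auto simp: psubset_eq)
  ultimately show ?thesis using fin(2) by (simp add: dm_def V_def W_def)
qed

lemma dim_group_field: "dim_group (Multiplicative_Group.mult_of L) SS dm"
proof -
  interpret M: comm_group "Multiplicative_Group.mult_of L" by (rule comm_group_mult)
  show ?thesis
  proof
    show "V \<subseteq> carrier (Multiplicative_Group.mult_of L)" if "V \<in> SS" for V using SS_D[OF that] by auto
    show "carrier (Multiplicative_Group.mult_of L) \<in> SS" using SS_I(1)[OF sub_carrier] by simp
    show "{} \<in> SS" using SS_I(1)[OF sub_zero(1)] by simp
    show "\<Inter>M \<in> SS" if "M \<noteq> {}" "M \<subseteq> SS" for M using SS_Inter[OF that] .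
    show "l_coset (Multiplicative_Group.mult_of L) g V \<in> SS" "dm (l_coset (Multiplicative_Group.mult_of L) g V) = dm V"
      if "g \<in> carrier (Multiplicative_Group.mult_of L)" "V \<in> SS" for g V
    proof -
      have g: "g \<in> carrier L - {\<zero>}" using that by simp
      note e = insert_coset[OF g SS_D(3)[OF that(2)]] and s = scale[OF g SS_D(1)[OF that(2)]]
      have "\<zero> \<notin> l_coset (Multiplicative_Group.mult_of L) g V"
      proof
        assume "\<zero> \<in> l_coset (Multiplicative_Group.mult_of L) g V"
        then obtain y where y: "y \<in> V" "\<zero> = g \<otimes> y" by (auto simp: l_coset_def)
        moreover have "y \<in> carrier L" using y SS_D(3)[OF that(2)] by blast
        ultimately have "y = \<zero>" using integral[of g y] g by auto
        then show False using y SS_D(2)[OF that(2)] by simp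
      qed
      then show "l_coset (Multiplicative_Group.mult_of L) g V \<in> SS" using e s by (simp add: SS_def)
      show "dm (l_coset (Multiplicative_Group.mult_of L) g V) = dm V" unfolding dm_def e using s by simp
    qed
    show "dm {} = 0" using sub_zero by (simp add: dm_def)
    show "dm V < dm W" if "V \<in> SS" "W \<in> SS" "V \<subset> W" for V W
    proof -
      have "insert \<zero> V \<noteq> insert \<zero> W"
        using that insert_ident[OF SS_D(2)[OF that(1)] SS_D(2)[OF that(2)]] by auto
      then have "insert \<zero> V \<subset> insert \<zero> W" using that(3) by (auto simp: psubset_eq)
      then show ?thesis unfolding dm_def using that by (intro dim_strict SS_D(1))
    qed
    show "dm (V \<inter> W) + dm (\<Inter>{Z \<in> SS. V \<union> W \<subseteq> Z}) = dm V + dm W" if "V \<in> SS" "W \<in> SS" for V W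
      by (rule SS_modular[OF that])
    have "\<Inter>{Z \<in> SS. {\<one>} \<subseteq> Z} = K - {\<zero>}"
    proof
      show "\<Inter>{Z \<in> SS. {\<one>} \<subseteq> Z} \<subseteq> K - {\<zero>}" using SS_I(1)[OF sub_K(1)] K_carrier by auto
      show "K - {\<zero>} \<subseteq> \<Inter>{Z \<in> SS. {\<one>} \<subseteq> Z}"
      proof (intro Inter_greatest subsetI)
        fix Z k assume Z: "Z \<in> {Z \<in> SS. {\<one>} \<subseteq> Z}" and k: "k \<in> K - {\<zero>}"
        then have "k \<otimes> \<one> \<in> insert \<zero> Z" using subD(4)[OF SS_D(1)] by auto
        then show "k \<in> Z" using k K_carrier by auto
      qed
    qed
    then show "dm (\<Inter>{Z \<in> SS. {\<one>\<^bsub>Multiplicative_Group.mult_of L\<^esub>} \<subseteq> Z}) = 1" using SS_I(2)[OF sub_K(1)] sub_K by simp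
  qed
qed

lemma dm_carrier: "dm (carrier (Multiplicative_Group.mult_of L)) = m"
  using SS_I(2)[OF sub_carrier] dimI[OF K dim_L] by simp

lemma field_flag_group:
  assumes F: "field_flag K L m F" and m2: "m \<ge> 2"
    and T: "flag_type m T" "\<forall>i<m. \<forall>j<m. T i j = field_flag_type K L F i j" and x: "x \<in> flag_polyhedron m T"
  shows "flag_group (Multiplicative_Group.mult_of L) SS dm (\<lambda>i. F i - {\<zero>}) x"
proof -
  interpret M: dim_group "Multiplicative_Group.mult_of L" SS dm by (rule dim_group_field)
  have F': "F 0 = K" "F (m - 1) = carrier L" "\<And>i. Suc i < m \<Longrightarrow> F i \<subset> F (Suc i)" "\<And>i. i < m \<Longrightarrow> dimension (i + 1) K (F i)"
    using F unfolding field_flag_def by auto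
  have Fm: "F i \<subseteq> F j" if "i \<le> j" "j < m" for i j using chain_mono[of m F i j] F'(3) that by blast
  have Fs: "sub (F i)" if "i < m" for i
    unfolding sub_def by (rule finite_dimension_imp_subalgebra[OF K finite_dimensionI[OF F'(4)[OF that]]])
  show ?thesis
  proof (unfold_locales; (unfold dm_carrier)?)
    show "F i - {\<zero>} \<in> SS" if "i < m" for i using SS_I(1)[OF Fs[OF that]] .
    show "dm (F i - {\<zero>}) = i + 1" if "i < m" for i using SS_I(2)[OF Fs[OF that]] dimI[OF K F'(4)[OF that]] by simp
    show "F i - {\<zero>} \<subseteq> F j - {\<zero>}" if "i \<le> j" "j < m" for i j using Fm[OF that] by auto
    show "\<one>\<^bsub>Multiplicative_Group.mult_of L\<^esub> \<in> F 0 - {\<zero>}" using F' K_carrier by simp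
    show "x i \<le> x j" if "1 \<le> i" "i \<le> j" "j < m" for i j using x that unfolding flag_polyhedron_def by blast
    show "\<exists>k<m. (\<forall>a\<in>F i - {\<zero>}. \<forall>b\<in>F j - {\<zero>}. a \<otimes>\<^bsub>Multiplicative_Group.mult_of L\<^esub> b \<in> F k - {\<zero>}) \<and> x k \<le> x i + x j"
      if ij: "1 \<le> i" "i < m" "1 \<le> j" "j < m" for i j
    proof (intro exI[of _ "T i j"] conjI ballI)
      show "T i j < m" using T(1) ij by (simp add: flag_type_def)
      show "x (T i j) \<le> x i + x j" using x ij unfolding flag_polyhedron_def by auto
      have Fc: "F i \<subseteq> carrier L" "F j \<subseteq> carrier L" using subD(1)[OF Fs] ij by auto
      have mc: "F i <#>\<^bsub>L\<^esub> F j \<subseteq> carrier L" using Fc by (auto simp: set_mult_def)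
      have "span_set K L (F i <#>\<^bsub>L\<^esub> F j) \<subseteq> F (m - 1)"
        unfolding F'(2) span_set_def using Span_in_carrier[OF K_carrier(1)] mc by (auto simp: lists_eq_set)
      then have sp: "span_set K L (F i <#>\<^bsub>L\<^esub> F j) \<subseteq> F (T i j)"
        using T(2) ij unfolding field_flag_type_def by (metis (mono_tags, lifting) LeastI)
      fix a b assume ab: "a \<in> F i - {\<zero>}" "b \<in> F j - {\<zero>}"
      then have mem: "a \<otimes> b \<in> F i <#>\<^bsub>L\<^esub> F j" by (auto simp: set_mult_def)
      then have "a \<otimes> b \<in> Span K [a \<otimes> b]" using Span_base_incl[OF K, of "[a \<otimes> b]"] mc by auto
      then have "a \<otimes> b \<in> span_set K L (F i <#>\<^bsub>L\<^esub> F j)" unfolding span_set_def using mem by (intro UN_I[of "[a \<otimes> b]"]) auto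
      moreover have "a \<otimes> b \<noteq> \<zero>" using ab Fc integral by blast
      ultimately show "a \<otimes>\<^bsub>Multiplicative_Group.mult_of L\<^esub> b \<in> F (T i j) - {\<zero>}" using sp by auto
    qed
  qed
qed

end

lemma realizable_tower:
  assumes good: "(\<exists>p k. Factorial_Ring.prime p \<and> k \<ge> 1 \<and> n = p ^ k) \<or>
         (\<exists>p q. Factorial_Ring.prime p \<and> Factorial_Ring.prime q \<and> p \<noteq> q \<and> n = p * q) \<or> n = 12"
    and n2: "n \<ge> 2" and T: "realizable TYPE('a) n T" and x: "x \<in> flag_polyhedron n T"
  shows "\<exists>ns. tower_type n ns \<and> x \<in> flag_polyhedron n (tower_flag_type ns)"
proof -
  have ft: "flag_type n T" using T by (simp add: realizable_def)
  consider "group_realizable TYPE('a) n T" | "field_realizable TYPE('a) n T" using T by (auto simp: realizable_def)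
  then show ?thesis
  proof cases
    case 1
    then obtain G :: "'a monoid" and F where G: "comm_group G" "finite (carrier G)" "order G = n" "group_flag G n F"
      "\<forall>i<n. \<forall>j<n. T i j = group_flag_type G F i j" unfolding group_realizable_def by blast
    interpret flag_group G "Pow (carrier G)" card F x
      by (rule group_flag_group[OF G(1-4) n2 ft G(5) x])
    show ?thesis by (rule tower_point[OF good _ n2 x]) (use G in \<open>simp add: order_def\<close>)
  next
    case 2
    then obtain L :: "'a ring" and K F where L: "field L" "subfield K L" "ring.dimension L n K (carrier L)" "field_flag K L n F"
      "\<forall>i<n. \<forall>j<n. T i j = field_flag_type K L F i j" unfolding field_realizable_def by blast
    interpret finite_extension L K n
      using L by (simp add: finite_extension_def finite_extension_axioms_def)
    interpret flag_group "Multiplicative_Group.mult_of L" SS dm "\<lambda>i. F i - {\<zero>\<^bsub>L\<^esub>}" x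
      by (rule field_flag_group[OF L(4) n2 ft L(5) x])
    show ?thesis by (rule tower_point[OF good dm_carrier n2 x])
  qed
qed

section \<open>Weights that violate every tower\<close>

definition partial_prod :: "nat list \<Rightarrow> nat \<Rightarrow> nat" where
  "partial_prod ns s = prod_list (take s ns)"

lemma partial_prod_dvd: "r \<le> s \<Longrightarrow> partial_prod ns r dvd partial_prod ns s"
proof -
  assume "r \<le> s"
  then have "take s ns = take r ns @ take (s - r) (drop r ns)"
    by (metis le_add_diff_inverse take_add)
  then show ?thesis by (simp add: partial_prod_def)
qed

text \<open>The partial products of one tower form a divisor chain. The counterexamples exploit that
  two incomparable divisors cannot both occur.\<close>

lemma partial_prod_comparable: "partial_prod ns r dvd partial_prod ns s \<or> partial_prod ns s dvd partial_prod ns r"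
  using partial_prod_dvd nat_le_linear by blast

lemma partial_prod_dvd_n: "tower_type n ns \<Longrightarrow> partial_prod ns s dvd n"
  using partial_prod_dvd[of s "max s (length ns)" ns] by (auto simp: tower_type_def partial_prod_def)

lemma tower_violation:
  assumes "tower_type n ns" "n \<ge> 2" "x \<in> flag_polyhedron n (tower_flag_type ns)"
    and "1 \<le> i" "1 \<le> j" "i + j < n" "x i + x j < x (i + j)"
  obtains s where "partial_prod ns s dvd n" "partial_prod ns s \<le> i mod partial_prod ns s + j mod partial_prod ns s"
proof -
  have pos: "\<forall>m\<in>set ns. 0 < m" using assms(1) by (auto simp: tower_type_def)
  have "\<not> no_carry ns i j" using assms tower_polyhedron[OF assms(1,2)] by (auto simp: not_le[symmetric])
  then show ?thesis using that partial_prod_dvd_n[OF assms(1)] no_carry_iff[OF pos] by (auto simp: partial_prod_def not_less)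
qed

text \<open>If \<open>m\<close> is not a partial product, let \<open>i\<close> be the largest
  partial product below \<open>m\<close>. Adding \<open>i\<close> and \<open>m - i\<close> gives no
  carry: \<open>i\<close> vanishes modulo the partial products up to it, and all later ones exceed
  \<open>m\<close>. So the tower demands \<open>x m \<le> x i + x (m - i)\<close>.\<close>

lemma tower_forced:
  assumes tt: "tower_type n ns" "n \<ge> 2" and x: "x \<in> flag_polyhedron n (tower_flag_type ns)"
    and m: "1 < m" "m < n" and gap: "\<And>i j. 1 \<le> i \<Longrightarrow> 1 \<le> j \<Longrightarrow> i + j = m \<Longrightarrow> x i + x j < x m"
  obtains s where "partial_prod ns s = m"
proof (rule ccontr)
  assume "\<not> thesis"
  then have none: "partial_prod ns s \<noteq> m" for s using that by auto
  have pos: "\<forall>m\<in>set ns. 0 < m" using tt by (auto simp: tower_type_def)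
  let ?Q = "\<lambda>s. s \<le> length ns \<and> partial_prod ns s < m"
  have "?Q 0" using m by (simp add: partial_prod_def)
  then obtain s where s: "?Q s" "\<forall>r. ?Q r \<longrightarrow> r \<le> s"
    using ex_has_greatest_nat[of ?Q 0 "\<lambda>s. s" "length ns + 1"] by (metis less_Suc_eq_le Suc_eq_plus1)
  have P0: "0 < partial_prod ns r" for r
    unfolding partial_prod_def using pos by (intro prod_list_pos) (auto dest: in_set_takeD)
  define i j where "i = partial_prod ns s" and "j = m - partial_prod ns s"
  have ij: "1 \<le> i" "1 \<le> j" "i + j = m" using s P0[of s] by (auto simp: i_def j_def)
  have "no_carry ns i j" unfolding no_carry_iff[OF pos]
  proof (intro allI impI)
    fix r assume r: "r \<le> length ns"
    have "i mod partial_prod ns r + j mod partial_prod ns r < partial_prod ns r"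
    proof (cases "r \<le> s")
      case True
      then have "i mod partial_prod ns r = 0" unfolding i_def using partial_prod_dvd by (simp add: dvd_imp_mod_0)
      then show ?thesis using P0[of r] by simp
    next
      case False
      then have "\<not> partial_prod ns r < m" using s(2) r by auto
      then have "m < partial_prod ns r" using none[of r] by simp
      then show ?thesis using ij by simp
    qed
    then show "i mod prod_list (take r ns) + j mod prod_list (take r ns) < prod_list (take r ns)"
      by (simp add: partial_prod_def)
  qed
  then have "x m \<le> x i + x j" using x m ij tower_polyhedron[OF tt] by auto
  then show False using gap[OF ij] by simp
qed

lemma digits3:
  fixes a b k q p :: nat
  assumes "a < q" "b < p"
  shows "(a + q * (b + p * k)) mod q = a" "(a + q * (b + p * k)) div q mod p = b" "(a + q * (b + p * k)) div q div p = k"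
  using assms by (simp_all add: div_mult2_eq[symmetric])

lemma tadd3:
  assumes "i < q * (p * c)" "j < q * (p * c)"
  shows "tadd [q, p, c] i j = (i mod q + j mod q) mod q +
     q * ((i div q mod p + j div q mod p) mod p + p * ((i div q div p + j div q div p) mod c))"
proof -
  have "i div q div p < c" "j div q div p < c"
    using assms by (auto simp: less_mult_imp_div_less mult.commute mult.left_commute)
  then show ?thesis by simp
qed

text \<open>
  The weight on \<open>C\<^sub>q \<times> C\<^sub>p \<times> C\<^sub>c\<close> singles out \<open>C\<^sub>p\<close> (weight \<open>1\<close>) and \<open>C\<^sub>q \<times> C\<^sub>p\<close> (weight \<open>3\<close>), which forces \<open>p\<close>
  and \<open>pq\<close> to be partial products of the tower. Further up, each coset of \<open>C\<^sub>q \<times> C\<^sub>p\<close> is entered through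
  a coset of \<open>C\<^sub>q\<close> (weight \<open>7 k\<close>), which produces a carry modulo \<open>q\<close> but not modulo \<open>p\<close>.
\<close>

definition weight_three :: "nat \<Rightarrow> nat \<Rightarrow> nat \<Rightarrow> nat" where
  "weight_three z f k = (if 1 \<le> k then 7 * k + (if f = 0 then 0 else 1)
     else if z = 0 \<and> f = 0 then 0 else if z = 0 then 1 else 3)"

text \<open>On the layer \<open>k = 0\<close> the sublevel sets are subgroups. In general,
  \<open>7 * k\<close> plus the indicator of \<open>f \<noteq> 0\<close> bounds the weight from
  below, equals it for \<open>k \<ge> 1\<close>, and is subadditive. A sum that falls back to the
  layer 0 from a higher one has weight at most 3, less than the 7 already paid.\<close>

lemma weight_three_add:
  assumes "z < q" "z' < q" "f < p" "f' < p"
  shows "weight_three ((z + z') mod q) ((f + f') mod p) ((k + k') mod c) \<le> weight_three z f k + weight_three z' f' k'"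
proof -
  have low: "7 * k + (if f = 0 then 0 else 1) \<le> weight_three z f k" for z f k by (auto simp: weight_three_def)
  have f: "(f + f') mod p \<noteq> 0 \<Longrightarrow> f \<noteq> 0 \<or> f' \<noteq> 0" and z: "(z + z') mod q \<noteq> 0 \<Longrightarrow> z \<noteq> 0 \<or> z' \<noteq> 0"
    by (metis add_0 mod_0)+
  have K: "(k + k') mod c \<le> k + k'" by simp
  consider "1 \<le> (k + k') mod c" | "(k + k') mod c = 0" "k = 0" "k' = 0" | "(k + k') mod c = 0" "1 \<le> k + k'" by linarith
  then show ?thesis
  proof cases
    case 1
    then have "weight_three ((z + z') mod q) ((f + f') mod p) ((k + k') mod c) = 7 * ((k + k') mod c) + (if (f + f') mod p = 0 then 0 else 1)"
      by (simp add: weight_three_def)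
    also have "\<dots> \<le> (7 * k + (if f = 0 then 0 else 1)) + (7 * k' + (if f' = 0 then 0 else 1))"
      using f K by (simp split: if_splits; linarith?)
    also have "\<dots> \<le> weight_three z f k + weight_three z' f' k'" using low by (rule add_mono) (rule low)
    finally show ?thesis .
  next
    case 2
    then show ?thesis using f z by (auto simp: weight_three_def)
  next
    case 3
    have "weight_three ((z + z') mod q) ((f + f') mod p) ((k + k') mod c) \<le> 3" using 3 by (simp add: weight_three_def)
    also have "3 \<le> 7 * k + 7 * k'" using 3 by linarith
    also have "\<dots> \<le> weight_three z f k + weight_three z' f' k'"
      using add_leD1[OF low[of k f z]] add_leD1[OF low[of k' f' z']] by (rule add_mono)
    finally show ?thesis .
  qed
qed

text \<open>Since 3 > 1 + 1 and 7 > 3 + 3, both \<open>p\<close> and \<open>D = p * q\<close> must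
  be partial products, and all partial products beyond \<open>D\<close> are multiples of it. The
  coordinates at \<open>D + p\<close> and \<open>D + (q - p)\<close> are at most 7, that at their
  sum \<open>2 * D + q\<close> exceeds 14, and the only possible carry is modulo
  \<open>2 * D\<close>. If \<open>2 * D\<close> is a partial product, \<open>D + p\<close> and
  \<open>2 * D + (q - p)\<close> violate likewise with sum \<open>3 * D + q\<close>, and their only
  possible carry is modulo \<open>3 * D\<close>, which is incomparable with
  \<open>2 * D\<close>.\<close>

lemma counterexample_three:
  assumes inf: "infinite (UNIV :: 'a set)"
    and p: "Factorial_Ring.prime p" and q: "Factorial_Ring.prime q" and pq: "p < q"
    and c: "3 \<le> c" and n: "n = p * q * c"
  obtains T x where "realizable TYPE('a) n T" "x \<in> flag_polyhedron n T"
    "\<And>ns. tower_type n ns \<Longrightarrow> x \<notin> flag_polyhedron n (tower_flag_type ns)"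
proof -
  have p2: "2 \<le> p" and q2: "2 \<le> q" using p q prime_ge_2_nat by auto
  have n': "n = q * (p * c)" using n by (simp add: algebra_simps)
  have pqn: "3 * (p * q) \<le> n" using n mult_le_mono2[OF c, of "p * q"] by (simp add: mult.commute)
  have qpq: "2 * q \<le> p * q" using p2 by simp
  have n2: "n \<ge> 2" using pqn qpq q2 by linarith
  define w where "w i = real (weight_three (i mod q) (i div q mod p) (i div q div p))" for i
  have tt: "tower_type n [q, p, c]" using n' p2 q2 c by (simp add: tower_type_def)
  have w0: "w 0 = 0" by (simp add: w_def weight_three_def)
  have wpos: "0 < w i" if "0 < i" "i < n" for i
  proof (rule ccontr)
    assume "\<not> 0 < w i"
    then have "i mod q = 0" "i div q mod p = 0" "i div q div p = 0"
      unfolding w_def weight_three_def by (auto split: if_splits)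
    then have "i = 0" by (metis add_0 div_mult_mod_eq mult_0 mult_is_0 add_cancel_right_left)
    then show False using that by simp
  qed
  have wadd: "w (tadd [q, p, c] i j) \<le> w i + w j" if "i < n" "j < n" for i j
  proof -
    define a where "a = (i mod q + j mod q) mod q"
    define b where "b = (i div q mod p + j div q mod p) mod p"
    define k where "k = (i div q div p + j div q div p) mod c"
    have ab: "a < q" "b < p" using p2 q2 by (simp_all add: a_def b_def)
    have t: "tadd [q, p, c] i j = a + q * (b + p * k)"
      using tadd3[of i q p c j] that n' unfolding a_def b_def k_def by simp
    have "weight_three a b k \<le> weight_three (i mod q) (i div q mod p) (i div q div p) + weight_three (j mod q) (j div q mod p) (j div q div p)"
      unfolding a_def b_def k_def using p2 q2 by (intro weight_three_add) auto
    then show ?thesis unfolding w_def t digits3[OF ab] by linarith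
  qed
  obtain T x where T: "realizable TYPE('a) n T" "x \<in> flag_polyhedron n T"
    and x: "\<And>i r. 1 \<le> i \<Longrightarrow> i < n \<Longrightarrow> x i \<le> r \<longleftrightarrow> i < card {j. j < n \<and> w j \<le> r}"
    using weight_point[OF tt n2 inf w0 wpos wadd] by blast
  have block: "j div q div p = 0 \<longleftrightarrow> j < p * q" for j
    using p2 q2 by (simp add: div_mult2_eq[symmetric] div_eq_0_iff mult.commute)
  have small: "{j. j < n \<and> w j \<le> r} = (\<lambda>f. q * f) ` {..<p}" if "r = 1 \<or> r = 2" for r :: real
  proof -
    have "w j \<le> r \<longleftrightarrow> j < p * q \<and> j mod q = 0" for j
      using that block[of j] by (auto simp: w_def weight_three_def)
    moreover have "f * q < n" if "f < p" for f
      using mult_less_mono1[OF that, of q] q2 pqn by linarith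
    then have "{j. j < n \<and> (j < p * q \<and> j mod q = 0)} = (\<lambda>f. q * f) ` {..<p}"
      using q2 by (auto simp: mult.commute image_iff elim!: dvdE)
    ultimately show ?thesis by simp
  qed
  have card_small: "card {j. j < n \<and> w j \<le> r} = p" if "r = 1 \<or> r = 2" for r :: real
    unfolding small[OF that] using q2 by (subst card_image) (auto simp: inj_on_def)
  have mid: "{j. j < n \<and> w j \<le> r} = {..<p * q}" if "r = 3 \<or> r = 6" for r :: real
  proof -
    have "w j \<le> r \<longleftrightarrow> j < p * q" for j
      using that block[of j] by (auto simp: w_def weight_three_def)
    moreover have "j < n" if "j < p * q" for j using pqn that by linarith
    ultimately show ?thesis by auto
  qed
  \<comment> \<open>Below this level are \<open>k\<close> full cosets of C_q x C_p and the first
    coset of C_q in the next one, that is, \<open>k * (p * q) + q\<close> elements.\<close>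
  have big: "{j. j < n \<and> w j \<le> 7 * real k} = {j. j < n \<and> j < k * (p * q) + q}" if "1 \<le> k" for k
  proof -
    have "w j \<le> 7 * real k \<longleftrightarrow> j < k * (p * q) + q" for j
    proof -
      define f l where "f = j div q mod p" and "l = j div q div p"
      have f: "f < p" "j div q = f + p * l" using p2 by (simp_all add: f_def l_def)
      have "j < k * (p * q) + q \<longleftrightarrow> j < (k * p + 1) * q" by (simp add: algebra_simps)
      also have "\<dots> \<longleftrightarrow> j div q < k * p + 1" using q2 by (simp add: div_less_iff_less_mult)
      also have "\<dots> \<longleftrightarrow> f + p * l \<le> p * k" using f by (simp add: mult.commute less_Suc_eq_le)
      also have "\<dots> \<longleftrightarrow> l < k \<or> (l = k \<and> f = 0)"
      proof
        assume a: "f + p * l \<le> p * k"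
        then have "p * l \<le> p * k" by linarith
        then have "l \<le> k" using p2 by simp
        then show "l < k \<or> (l = k \<and> f = 0)" using a by auto
      next
        assume "l < k \<or> (l = k \<and> f = 0)"
        moreover have "p * (l + 1) \<le> p * k" if "l < k" using that by (intro mult_le_mono2) simp
        ultimately show "f + p * l \<le> p * k" using f by auto
      qed
      also have "\<dots> \<longleftrightarrow> weight_three (j mod q) f l \<le> 7 * k" using that by (auto simp: weight_three_def)
      also have "\<dots> \<longleftrightarrow> w j \<le> 7 * real k"
        unfolding w_def f_def l_def using of_nat_le_iff[of _ "7 * k", where 'a = real] by simp
      finally show ?thesis by simp
    qed
    then show ?thesis by simp
  qed
  have xle: "x i \<le> 7 * real k" if "1 \<le> k" "k * (p * q) + q \<le> n" "1 \<le> i" "i < k * (p * q) + q" for i k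
  proof -
    have "{j. j < n \<and> j < k * (p * q) + q} = {..<k * (p * q) + q}" using that by auto
    then show ?thesis using x[of i "7 * real k"] that big[OF that(1)] by simp
  qed
  have xgt: "7 * real k < x (k * (p * q) + q)" if "1 \<le> k" "k * (p * q) + q < n" for k
  proof -
    have "{j. j < n \<and> j < k * (p * q) + q} = {..<k * (p * q) + q}" using that by auto
    then show ?thesis using x[of "k * (p * q) + q" "7 * real k"] that big[OF that(1)] q2 by (simp add: not_le[symmetric])
  qed
  have "x \<notin> flag_polyhedron n (tower_flag_type ns)" if ns: "tower_type n ns" for ns
  proof
    assume xt: "x \<in> flag_polyhedron n (tower_flag_type ns)"
    have pn: "p < n" "p * q < n" "1 < p * q" using pqn qpq pq q2 by linarith+
    obtain s1 where s1: "partial_prod ns s1 = p"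
    proof (rule tower_forced[OF ns n2 xt, of p])
      fix i j assume ij: "1 \<le> i" "1 \<le> j" "i + j = p"
      have "x i \<le> 1" "x j \<le> 1" using x[of i 1] x[of j 1] card_small[of 1] ij pn by simp_all
      moreover have "\<not> x p \<le> 2" using x[of p 2] card_small[of 2] p2 pn by simp
      ultimately show "x i + x j < x p" by simp
    qed (use p2 pn in auto)
    obtain s2 where s2: "partial_prod ns s2 = p * q"
    proof (rule tower_forced[OF ns n2 xt, of "p * q"])
      fix i j assume ij: "1 \<le> i" "1 \<le> j" "i + j = p * q"
      have "x i \<le> 3" "x j \<le> 3" using x[of i 3] x[of j 3] mid[of 3] ij pn by simp_all
      moreover have "\<not> x (p * q) \<le> 6" using x[of "p * q" 6] mid[of 6] p2 q2 pn by simp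
      ultimately show "x i + x j < x (p * q)" by simp
    qed (rule pn(3,2))+
    have cmp: "M = 1 \<or> M = p \<or> M = p * q \<or> (\<exists>e\<ge>2. M = p * q * e)" if M: "M = partial_prod ns s" "M dvd n" for M s
    proof -
      have "M dvd p * q \<or> p * q dvd M" using partial_prod_comparable[of ns s s2] s2 M by simp
      moreover have "M dvd p \<or> p dvd M" using partial_prod_comparable[of ns s s1] s1 M by simp
      moreover have "M = 1 \<or> M = p" if "M dvd p" using that p prime_nat_iff by blast
      moreover have "M = p \<or> M = p * q" if h: "p dvd M" "M dvd p * q"
      proof -
        obtain b where b: "M = p * b" using h(1) by (rule dvdE)
        then have "b dvd q" using h(2) p2 by simp
        then have "b = 1 \<or> b = q" using q prime_nat_iff by blast
        then show ?thesis using b by auto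
      qed
      moreover have "M = p * q \<or> (\<exists>e\<ge>2. M = p * q * e)" if h: "p * q dvd M"
      proof -
        obtain e where e: "M = p * q * e" using h by (rule dvdE)
        have "M \<noteq> 0" using M(2) n2 by (metis dvd_0_left not_numeral_le_zero)
        then have "e \<noteq> 0" using e by auto
        then consider "e = 1" | "2 \<le> e" by linarith
        then show ?thesis by cases (use e in auto)
      qed
      ultimately show ?thesis by blast
    qed
    define D where "D = p * q"
    have D: "p < D" "q < D" "q - p < D" "p + (q - p) < D" "D * 3 \<le> n" using qpq pq q2 pqn unfolding D_def by linarith+
    show False
    proof (cases "\<exists>s. partial_prod ns s = 2 * D")
      case False
      have "x (D + p) + x (D + (q - p)) < x ((D + p) + (D + (q - p)))"
      proof -
        have "x (D + p) \<le> 7 * real 1" "x (D + (q - p)) \<le> 7 * real 1"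
          by (rule xle; use D pq p2 in \<open>simp add: D_def[symmetric]\<close>)+
        moreover have "7 * real 2 < x (2 * D + q)" using xgt[of 2] D pqn unfolding D_def by simp
        moreover have eq: "(D + p) + (D + (q - p)) = 2 * D + q" using pq by simp
        ultimately show ?thesis unfolding eq by linarith
      qed
      moreover have "1 \<le> D + p" "1 \<le> D + (q - p)" "(D + p) + (D + (q - p)) < n" using D p2 pq by linarith+
      ultimately obtain s where s: "partial_prod ns s dvd n" "partial_prod ns s \<le> (D + p) mod partial_prod ns s + (D + (q - p)) mod partial_prod ns s"
        using tower_violation[OF ns n2 xt, of "D + p" "D + (q - p)"] by blast
      from cmp[OF refl s(1)] show False
      proof (elim disjE exE conjE)
        assume "partial_prod ns s = 1" then show False using s by simp
      next
        assume M: "partial_prod ns s = p"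
        have "(D + p) mod p = 0" by (simp add: D_def)
        moreover have "(D + (q - p)) mod p < p" using p2 by simp
        ultimately show False using s M by simp
      next
        assume "partial_prod ns s = p * q"
        then show False using s D unfolding D_def[symmetric] by simp
      next
        fix e assume e: "2 \<le> e" "partial_prod ns s = p * q * e"
        have "e \<noteq> 2" using False e unfolding D_def by (auto simp: mult.commute)
        then have "D * 3 \<le> D * e" using e by (intro mult_le_mono2) simp
        then have "(D + p) + (D + (q - p)) < D * e" using D pq by linarith
        moreover have "(D + p) mod (D * e) \<le> D + p" "(D + (q - p)) mod (D * e) \<le> D + (q - p)" by simp_all
        ultimately show False using s(2) unfolding e(2) D_def[symmetric] by linarith
      qed
    next
      case True
      then obtain s3 where s3: "partial_prod ns s3 = 2 * D" by auto
      then have "2 * D dvd n" using partial_prod_dvd_n[OF ns] by metis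
      then obtain e where "n = 2 * D * e" by (auto elim: dvdE)
      moreover have "e \<noteq> 0" "e \<noteq> 1" using calculation D by auto
      ultimately have n4: "4 * D \<le> n" using mult_le_mono2[of 2 e "2 * D"] by simp
      have "x (D + p) + x (2 * D + (q - p)) < x ((D + p) + (2 * D + (q - p)))"
      proof -
        have "x (D + p) \<le> 7 * real 1"
          by (rule xle; use D pq p2 in \<open>simp add: D_def[symmetric]\<close>)
        moreover have "x (2 * D + (q - p)) \<le> 7 * real 2"
          by (rule xle; use D pq p2 in \<open>simp add: D_def[symmetric]\<close>)
        moreover have "7 * real 3 < x (3 * D + q)" using xgt[of 3] D n4 unfolding D_def by simp
        moreover have eq: "(D + p) + (2 * D + (q - p)) = 3 * D + q" using pq by simp
        ultimately show ?thesis unfolding eq by linarith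
      qed
      moreover have "1 \<le> D + p" "1 \<le> 2 * D + (q - p)" "(D + p) + (2 * D + (q - p)) < n" using D p2 pq n4 by linarith+
      ultimately obtain s where s: "partial_prod ns s dvd n" "partial_prod ns s \<le> (D + p) mod partial_prod ns s + (2 * D + (q - p)) mod partial_prod ns s"
        using tower_violation[OF ns n2 xt, of "D + p" "2 * D + (q - p)"] by blast
      from cmp[OF refl s(1)] show False
      proof (elim disjE exE conjE)
        assume "partial_prod ns s = 1" then show False using s by simp
      next
        assume M: "partial_prod ns s = p"
        have "(D + p) mod p = 0" by (simp add: D_def)
        moreover have "(2 * D + (q - p)) mod p < p" using p2 by simp
        ultimately show False using s M by simp
      next
        assume "partial_prod ns s = p * q"
        then show False using s D unfolding D_def[symmetric] by simp
      next
        fix e assume e: "2 \<le> e" "partial_prod ns s = p * q * e"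
        have "D * e dvd 2 * D \<or> 2 * D dvd D * e" using partial_prod_comparable[of ns s s3] s3 e unfolding D_def by simp
        then have "e dvd 2 \<or> 2 dvd e" using D by (auto simp: mult.commute)
        then consider "e = 2" | "4 \<le> e"
        proof
          assume "e dvd 2"
          then have "e = 2" using e(1) dvd_imp_le[of e 2] by simp
          then show ?thesis using that by simp
        next
          assume "2 dvd e"
          then obtain f where "e = 2 * f" by (auto elim: dvdE)
          then show ?thesis using that e(1) by (cases "f = 1") auto
        qed
        then show False
        proof cases
          case 1
          have "(D + p) mod (2 * D) = D + p" "(2 * D + (q - p)) mod (2 * D) = q - p" using D by simp_all
          then show False using s(2) D pq unfolding e(2) D_def[symmetric] 1 by (simp add: mult.commute)
        next
          case 2
          then have "D * 4 \<le> D * e" by (intro mult_le_mono2) simp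
          then have "(D + p) + (2 * D + (q - p)) < D * e" using D pq by linarith
          moreover have "(D + p) mod (D * e) \<le> D + p" "(2 * D + (q - p)) mod (D * e) \<le> 2 * D + (q - p)" by simp_all
          ultimately show False using s(2) unfolding e(2) D_def[symmetric] by linarith
        qed
      qed
    qed
  qed
  then show ?thesis using that T by blast
qed

text \<open>
  The weight on \<open>C\<^sub>q \<times> C\<^sub>2 \<times> C\<^sub>2\<close> is used with \<open>b = (q + 1) / 2\<close>. The union of three cosets of \<open>C\<^sub>q\<close> (weight
  at most \<open>9\<close>) forces \<open>q\<close> to be a partial product. Its sublevel sets \<open>{0, 1} \<times> C\<^sub>2\<close>, \<open>{0, \<dots>, b - 1} \<times> C\<^sub>2\<close>
  and \<open>{0, \<dots>, b} \<times> C\<^sub>2\<close> have \<open>4\<close>, \<open>q + 1\<close> and \<open>q + 3\<close> elements, so that \<open>x (q + 3) > x 3 + x q\<close>, which is a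
  carry modulo \<open>2\<close> but not modulo any multiple of \<open>q\<close>.
\<close>

definition weight_four :: "nat \<Rightarrow> nat \<Rightarrow> nat \<Rightarrow> nat \<Rightarrow> nat" where
  "weight_four b z f k = (if 1 \<le> k then 9 + (if f = 0 then 0 else 3)
     else if z = 0 \<and> f = 0 then 0 else if z = 1 \<and> f = 0 then 2 else if z \<le> 1 then 3
     else if z < b then 4 else if z = b then 6 else 8)"

text \<open>In the layer \<open>k = 0\<close>, two nontrivial summands weigh at least 2 each, which
  suffices for a sum with first digit \<open>y < b\<close>. For \<open>y = b\<close> one summand has
  first digit at least 2, giving 4 + 2. For \<open>y > b\<close> one has first digit at least
  \<open>b\<close>, giving 6 + 2, or both have at least 2, giving 4 + 4. A wrapped sum has
  \<open>y\<close> below both digits, so these bounds still hold. With \<open>k = 1\<close>,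
  reaching \<open>f \<noteq> 0\<close> costs 3 more, the least weight of an element with
  \<open>f \<noteq> 0\<close>.\<close>

lemma weight_four_add:
  assumes "z < q" "z' < q" "f < 2" "f' < 2" "k < 2" "k' < 2" and b: "3 \<le> b"
  shows "weight_four b ((z + z') mod q) ((f + f') mod 2) ((k + k') mod 2) \<le> weight_four b z f k + weight_four b z' f' k'"
proof (cases "k = 0 \<and> k' = 0")
  case False
  then consider "k = 1" "k' = 0" | "k = 0" "k' = 1" | "k = 1" "k' = 1" using assms by linarith
  then show ?thesis
  proof cases
    case 1
    have "3 \<le> weight_four b z' f' 0" if "f' \<noteq> 0" using that b by (simp add: weight_four_def)
    then show ?thesis using 1 assms(3,4) by (cases "f = 0"; cases "f' = 0") (auto simp: weight_four_def)
  next
    case 2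
    have "3 \<le> weight_four b z f 0" if "f \<noteq> 0" using that b by (simp add: weight_four_def)
    then show ?thesis using 2 assms(3,4) by (cases "f = 0"; cases "f' = 0") (auto simp: weight_four_def)
  next
    case 3
    then show ?thesis by (simp add: weight_four_def)
  qed
next
  case True
  show ?thesis
  proof (cases "(z = 0 \<and> f = 0) \<or> (z' = 0 \<and> f' = 0)")
    case True
    then show ?thesis using assms \<open>k = 0 \<and> k' = 0\<close> by auto
  next
    case False
    define y where "y = (z + z') mod q"
    have y: "y = z + z' \<or> (y < z \<and> y < z')"
    proof (cases "z + z' < q")
      case False
      then have "y = z + z' - q" unfolding y_def using assms by (simp add: mod_if)
      then show ?thesis using assms False by linarith
    qed (simp add: y_def)
    have two: "2 \<le> weight_four b z f 0" "2 \<le> weight_four b z' f' 0" using False by (auto simp: weight_four_def)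
    have four: "4 \<le> weight_four b x g 0" if "2 \<le> x" for x g using that by (simp add: weight_four_def)
    have six: "6 \<le> weight_four b x g 0" if "b \<le> x" for x g using that b by (simp add: weight_four_def)
    have eight: "8 \<le> weight_four b x g 0" if "b < x" for x g using that b by (simp add: weight_four_def)
    have small: "weight_four b y g 0 \<le> 4" if "y < b" for g using that by (simp add: weight_four_def)
    have mid: "weight_four b y g 0 \<le> 6" if "y = b" for g using that by (simp add: weight_four_def)
    have top: "weight_four b y g 0 \<le> 8" for g by (simp add: weight_four_def)
    consider "y < b" | "y = b" | "b < y" by linarith
    then have "weight_four b y ((f + f') mod 2) 0 \<le> weight_four b z f 0 + weight_four b z' f' 0"
    proof cases
      case 1
      then show ?thesis using small[OF 1, of "(f + f') mod 2"] two by linarith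
    next
      case 2
      then have "2 \<le> z \<or> 2 \<le> z'" using y b by linarith
      then show ?thesis using mid[OF 2, of "(f + f') mod 2"] two four[of z f] four[of z' f'] by linarith
    next
      case 3
      then have "b \<le> z \<or> b \<le> z' \<or> (2 \<le> z \<and> 2 \<le> z')" using y b by linarith
      then show ?thesis
        using top[of "(f + f') mod 2"] two four[of z f] four[of z' f'] six[of z f] six[of z' f'] by linarith
    qed
    then show ?thesis using \<open>k = 0 \<and> k' = 0\<close> by (simp add: y_def)
  qed
qed

text \<open>Sublevel counts give \<open>x 1 + x (3 * q - 1) \<le> 2 + 9 < x (3 * q)\<close>. A carry
  of this pair modulo a divisor \<open>M\<close> of \<open>4 * q\<close> means that \<open>M\<close>
  divides \<open>3 * q\<close>, so \<open>M = q\<close>. The second violation is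
  \<open>x 3 + x q \<le> 3 + 4 < x (3 + q)\<close>: modulo \<open>q\<close> only the residue 3
  remains, and \<open>3 + q\<close> is below every larger multiple of \<open>q\<close>.\<close>

lemma counterexample_four:
  assumes inf: "infinite (UNIV :: 'a set)" and q: "Factorial_Ring.prime q" and q5: "5 \<le> q" and n: "n = 4 * q"
  obtains T x where "realizable TYPE('a) n T" "x \<in> flag_polyhedron n T"
    "\<And>ns. tower_type n ns \<Longrightarrow> x \<notin> flag_polyhedron n (tower_flag_type ns)"
proof -
  have n': "n = q * (2 * 2)" using n by simp
  have n2: "n \<ge> 2" using n q5 by simp
  have "odd q" using q q5 prime_odd_nat by auto
  then obtain b where b: "q + 1 = 2 * b" by (metis even_plus_one_iff evenE)
  then have b3: "3 \<le> b" "b < q" using q5 by linarith+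
  define w where "w i = real (weight_four b (i mod q) (i div q mod 2) (i div q div 2))" for i
  have tt: "tower_type n [q, 2, 2]" using n' q5 by (simp add: tower_type_def)
  have w0: "w 0 = 0" by (simp add: w_def weight_four_def)
  have wpos: "0 < w i" if "0 < i" "i < n" for i
  proof (rule ccontr)
    assume "\<not> 0 < w i"
    then have "i mod q = 0" "i div q mod 2 = 0" "i div q div 2 = 0"
      unfolding w_def weight_four_def using b3 by (auto split: if_splits)
    then have "i = 0" by (metis add_0 div_mult_mod_eq mult_0 mult_is_0 add_cancel_right_left)
    then show False using that by simp
  qed
  have wadd: "w (tadd [q, 2, 2] i j) \<le> w i + w j" if "i < n" "j < n" for i j
  proof -
    define a where "a = (i mod q + j mod q) mod q"
    define f where "f = (i div q mod 2 + j div q mod 2) mod 2"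
    define k where "k = (i div q div 2 + j div q div 2) mod 2"
    have ab: "a < q" "f < 2" using q5 by (simp_all add: a_def f_def)
    have t: "tadd [q, 2, 2] i j = a + q * (f + 2 * k)"
      using tadd3[of i q 2 2 j] that n' unfolding a_def f_def k_def by simp
    have "i div q div 2 < 2" "j div q div 2 < 2"
      using that n by (auto simp: less_mult_imp_div_less mult.commute)
    then have "weight_four b a f k \<le> weight_four b (i mod q) (i div q mod 2) (i div q div 2) + weight_four b (j mod q) (j div q mod 2) (j div q div 2)"
      unfolding a_def f_def k_def using b3 q5 by (intro weight_four_add) auto
    then show ?thesis unfolding w_def t digits3[OF ab] by linarith
  qed
  obtain T x where T: "realizable TYPE('a) n T" "x \<in> flag_polyhedron n T"
    and x: "\<And>i r. 1 \<le> i \<Longrightarrow> i < n \<Longrightarrow> x i \<le> r \<longleftrightarrow> i < card {j. j < n \<and> w j \<le> r}"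
    using weight_point[OF tt n2 inf w0 wpos wadd] by blast
  have wlow: "w j = weight_four b j 0 0" if "j < q" for j using that by (simp add: w_def)
  have wmid: "w (q + z) = weight_four b z 1 0" if "z < q" for z
    using that digits3[of z q 1 2 0] by (simp add: w_def add.commute)
  have whigh: "9 \<le> w j" if "2 * q \<le> j" for j
  proof -
    have "2 \<le> j div q" using that q5 by (simp add: less_eq_div_iff_mult_less_eq)
    then show ?thesis by (simp add: w_def weight_four_def div_greater_zero_iff)
  qed
  have slice: "{j. j < n \<and> w j \<le> r} = {j. j < q \<and> weight_four b j 0 0 \<le> r} \<union> (\<lambda>z. q + z) ` {z. z < q \<and> weight_four b z 1 0 \<le> r}"
    if "r < 9" for r :: real
  proof (rule Set.set_eqI)
    fix j
    consider "j < q" | z where "j = q + z" "z < q" | "2 * q \<le> j"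
      by (metis add_less_cancel_left le_add_diff_inverse linorder_not_less mult_2)
    then show "j \<in> {j. j < n \<and> w j \<le> r} \<longleftrightarrow>
        j \<in> {j. j < q \<and> weight_four b j 0 0 \<le> r} \<union> (\<lambda>z. q + z) ` {z. z < q \<and> weight_four b z 1 0 \<le> r}"
    proof cases
      case 1 then show ?thesis using wlow n by auto
    next
      case 2 then show ?thesis using wmid n by auto
    next
      case 3 then show ?thesis using whigh[OF 3] that by auto
    qed
  qed
  have count: "card {j. j < n \<and> w j \<le> r} = u + v"
    if "r < 9" "{j. j < q \<and> real (weight_four b j 0 0) \<le> r} = {..<u}" "{z. z < q \<and> real (weight_four b z 1 0) \<le> r} = {..<v}" "u \<le> q"
    for r :: real and u v
    unfolding slice[OF that(1)] that(2,3)
    using that(4) by (subst card_Un_disjoint) (auto simp: card_image)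
  have c2: "card {j. j < n \<and> w j \<le> 2} = 2 + 0"
    by (rule count) (use b3 q5 in \<open>auto simp: weight_four_def\<close>)
  have c3: "card {j. j < n \<and> w j \<le> 3} = 2 + 2"
    by (rule count) (use b3 q5 in \<open>auto simp: weight_four_def\<close>)
  have c4: "card {j. j < n \<and> w j \<le> 4} = b + b"
    by (rule count) (use b3 q5 in \<open>auto simp: weight_four_def\<close>)
  have c7: "card {j. j < n \<and> w j \<le> 7} = (b + 1) + (b + 1)"
    by (rule count) (use b3 q5 in \<open>auto simp: weight_four_def\<close>)
  have c9: "card {j. j < n \<and> w j \<le> r} = 3 * q" if "r = 9 \<or> r = 11" for r :: real
  proof -
    have "w j \<le> r \<longleftrightarrow> j < 3 * q" if "j < n" for j
    proof -
      define l where "l = j div q"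
      have l: "l < 4" using that n by (simp add: l_def less_mult_imp_div_less mult.commute)
      have "j < 3 * q \<longleftrightarrow> l < 3" using q5 by (simp add: l_def div_less_iff_less_mult)
      moreover have "w j \<le> r \<longleftrightarrow> l < 3"
      proof -
        consider "l = 0" | "l = 1" | "l = 2" | "l = 3" using l by linarith
        then show ?thesis
          using \<open>r = 9 \<or> r = 11\<close> unfolding w_def l_def[symmetric] by cases (auto simp: weight_four_def)
      qed
      ultimately show ?thesis by simp
    qed
    then have "{j. j < n \<and> w j \<le> r} = {..<3 * q}" using n by auto
    then show ?thesis by simp
  qed
  have v1: "x 1 + x (3 * q - 1) < x (1 + (3 * q - 1))"
  proof -
    have "x 1 \<le> 2" using x[of 1 2] c2 n q5 by simp
    moreover have "x (3 * q - 1) \<le> 9" using x[of "3 * q - 1" 9] c9[of 9] n q5 by simp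
    moreover have "\<not> x (3 * q) \<le> 11" using x[of "3 * q" 11] c9[of 11] n q5 by simp
    ultimately show ?thesis using q5 by simp
  qed
  have v2: "x 3 + x q < x (3 + q)"
  proof -
    have "x 3 \<le> 3" using x[of 3 3] c3 n q5 by simp
    moreover have "x q \<le> 4" using x[of q 4] c4 b n q5 by simp
    moreover have "\<not> x (3 + q) \<le> 7" using x[of "3 + q" 7] c7 b n q5 by simp
    ultimately show ?thesis by simp
  qed
  have "x \<notin> flag_polyhedron n (tower_flag_type ns)" if ns: "tower_type n ns" for ns
  proof
    assume xt: "x \<in> flag_polyhedron n (tower_flag_type ns)"
    have le: "1 \<le> 3 * q - 1" "1 + (3 * q - 1) < n" "(1::nat) \<le> 3" "1 \<le> q" "3 + q < n" using n q5 by simp_all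
    obtain s where s: "partial_prod ns s dvd n" "partial_prod ns s \<le> 1 mod partial_prod ns s + (3 * q - 1) mod partial_prod ns s"
      by (rule tower_violation[OF ns n2 xt le_refl le(1,2) v1])
    obtain r where r: "partial_prod ns r dvd n" "partial_prod ns r \<le> 3 mod partial_prod ns r + q mod partial_prod ns r"
      by (rule tower_violation[OF ns n2 xt le(3,4,5) v2])
    have pos: "0 < partial_prod ns t" if "partial_prod ns t dvd n" for t using that n2 by (cases "partial_prod ns t") auto
    define M where "M = partial_prod ns s"
    have M: "0 < M" "M dvd 4 * q" "M \<le> 1 mod M + (3 * q - 1) mod M"
      using s pos[OF s(1)] n unfolding M_def by simp_all
    have "M \<noteq> 1" using M by auto
    then have "1 mod M = 1" using M(1) by simp
    then have "(3 * q - 1) mod M = M - 1" using M(1,3) mod_less_divisor[OF M(1), of "3 * q - 1"] by linarith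
    then have "(3 * q - 1 + 1) mod M = 0" using M \<open>M \<noteq> 1\<close> by (metis Suc_diff_1 mod_Suc Suc_eq_plus1)
    then have "M dvd 3 * q" using q5 by (simp add: dvd_eq_mod_eq_0)
    then have "M dvd 4 * q - 3 * q" using M by (intro dvd_diff_nat)
    then have "M dvd q" by simp
    then have Mq: "M = q" using \<open>M \<noteq> 1\<close> q prime_nat_iff by blast
    define N where "N = partial_prod ns r"
    have N: "0 < N" "N \<le> 3 mod N + q mod N" using r pos[OF r(1)] unfolding N_def by simp_all
    have "N dvd q \<or> q dvd N" using partial_prod_comparable[of ns r s] Mq unfolding N_def M_def by simp
    then have "q dvd N" using q prime_nat_iff N by (metis dvd_refl less_irrefl mod_by_1 add_0 not_one_le_zero)
    then obtain e where e: "N = q * e" by (auto elim: dvdE)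
    show False
    proof (cases "e = 1")
      case True
      then show False using N e q5 by simp
    next
      case False
      then have "2 \<le> e" using N e by (cases e) auto
      then have "q * 2 \<le> N" using e by (simp del: mult_2_right)
      then have "3 + q < N" using q5 by linarith
      then show False using N by simp
    qed
  qed
  then show ?thesis using that T by blast
qed

text \<open>If \<open>n\<close> is not a prime power it is divisible by two primes
  \<open>p < q\<close>, and the cofactor \<open>c\<close> is not 1. For \<open>c = 2\<close> and
  \<open>p = 2\<close> the degree is \<open>4 * q\<close>, with \<open>q = 3\<close> excluded as 12;
  for \<open>c = 2\<close> and odd \<open>p\<close> one takes the primes 2 and \<open>p\<close> with
  cofactor \<open>q\<close>.\<close>

lemma no_counterexample_shape:
  fixes n :: nat
  assumes "n \<ge> 2" and npp: "\<nexists>p k. Factorial_Ring.prime p \<and> k \<ge> 1 \<and> n = p ^ k"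
    and npq: "\<nexists>p q. Factorial_Ring.prime p \<and> Factorial_Ring.prime q \<and> p \<noteq> q \<and> n = p * q" and n12: "n \<noteq> 12"
  shows "(\<exists>p q c. Factorial_Ring.prime p \<and> Factorial_Ring.prime q \<and> p < q \<and> 3 \<le> c \<and> n = p * q * c) \<or>
    (\<exists>q. Factorial_Ring.prime q \<and> 5 \<le> q \<and> n = 4 * q)"
proof -
  obtain p where p: "Factorial_Ring.prime p" "p dvd n" using assms(1) prime_factor_nat[of n] by auto
  have "\<not> is_unit p" "n \<noteq> 0" using p(1) not_prime_unit assms(1) by auto
  then obtain m where m: "n = p ^ multiplicity p n * m" "\<not> p dvd m"
    using multiplicity_decompose'[of n p] by blast
  have "multiplicity p n \<noteq> 0" using m p(2) by (metis mult_1 power_0)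
  then have "multiplicity p n \<ge> 1" by simp
  then have "m \<noteq> 1" using npp p m by auto
  then obtain q where q: "Factorial_Ring.prime q" "q dvd m" using prime_factor_nat by blast
  have pq: "p \<noteq> q" using m q by auto
  have "q dvd n" using q m(1) by (metis dvd_mult)
  then have "p * q dvd n" using p q pq by (intro divides_mult) (auto simp: primes_coprime)
  have *: "\<exists>p q. Factorial_Ring.prime p \<and> Factorial_Ring.prime q \<and> p < q \<and> p * q dvd n"
  proof (cases "p < q")
    case True then show ?thesis using p q \<open>p * q dvd n\<close> by blast
  next
    case False then show ?thesis using p q pq \<open>p * q dvd n\<close> by (metis mult.commute nat_neq_iff)
  qed
  then obtain p q where pq: "Factorial_Ring.prime p" "Factorial_Ring.prime q" "p < q" "p * q dvd n" by auto
  then obtain c where c: "n = p * q * c" by (auto elim: dvdE)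
  have "c \<noteq> 0" using c assms(1) by (cases c) simp_all
  moreover have "c \<noteq> 1"
  proof
    assume "c = 1"
    then have "n = p * q" using c by simp
    moreover have "p \<noteq> q" using pq(3) by simp
    ultimately show False using npq pq(1,2) by blast
  qed
  ultimately consider "3 \<le> c" | "c = 2" by linarith
  then show ?thesis
  proof cases
    case 1
    then show ?thesis using pq c by blast
  next
    case 2
    show ?thesis
    proof (cases "p = 2")
      case True
      then have "n = 4 * q" using c 2 by simp
      moreover have "q \<noteq> 3" using n12 \<open>n = 4 * q\<close> by auto
      moreover have "q \<noteq> 4" using pq(2) by auto
      ultimately show ?thesis using pq True by (intro disjI2 exI[of _ q]) auto
    next
      case False
      then have "2 < p" using pq(1) prime_ge_2_nat[of p] by simp
      then have "2 < p \<and> 3 \<le> q \<and> n = 2 * p * q" using pq c 2 by simp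
      then show ?thesis using pq two_is_prime_nat by blast
    qed
  qed
qed

text \<open>Towers are realizable for every \<open>n\<close>, so one inclusion always holds;
  infiniteness of the type gives room for a copy of each group of order \<open>n\<close>.\<close>

theorem theorem1p18:
  fixes n :: nat
  assumes "infinite (UNIV :: 'a set)"
    and "n \<ge> 2"
  shows "(\<Union>T\<in>{T. realizable TYPE('a) n T}. flag_polyhedron n T)
           = (\<Union>ns\<in>{ns. tower_type n ns}. flag_polyhedron n (tower_flag_type ns))
         \<longleftrightarrow>
         (\<exists>p k. Factorial_Ring.prime p \<and> k \<ge> 1 \<and> n = p ^ k) \<or>
         (\<exists>p q. Factorial_Ring.prime p \<and> Factorial_Ring.prime q \<and> p \<noteq> q \<and> n = p * q) \<or>
         n = 12"
proof
  let ?good = "(\<exists>p k. Factorial_Ring.prime p \<and> k \<ge> 1 \<and> n = p ^ k) \<or>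
     (\<exists>p q. Factorial_Ring.prime p \<and> Factorial_Ring.prime q \<and> p \<noteq> q \<and> n = p * q) \<or> n = 12"
  assume eq: "(\<Union>T\<in>{T. realizable TYPE('a) n T}. flag_polyhedron n T)
           = (\<Union>ns\<in>{ns. tower_type n ns}. flag_polyhedron n (tower_flag_type ns))"
  show ?good
  proof (rule ccontr)
    assume bad: "\<not> ?good"
    then consider p q c where "Factorial_Ring.prime p" "Factorial_Ring.prime q" "p < q" "3 \<le> c" "n = p * q * c"
      | q where "Factorial_Ring.prime q" "5 \<le> q" "n = 4 * q"
      using no_counterexample_shape[OF assms(2)] by blast
    then obtain T x where "realizable TYPE('a) n T" "x \<in> flag_polyhedron n T"
      "\<And>ns. tower_type n ns \<Longrightarrow> x \<notin> flag_polyhedron n (tower_flag_type ns)"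
    proof cases
      case 1
      show ?thesis by (rule counterexample_three[OF assms(1) 1]) (rule that)
    next
      case 2
      show ?thesis by (rule counterexample_four[OF assms(1) 2]) (rule that)
    qed
    then show False using eq by blast
  qed
next
  assume good: "(\<exists>p k. Factorial_Ring.prime p \<and> k \<ge> 1 \<and> n = p ^ k) \<or>
     (\<exists>p q. Factorial_Ring.prime p \<and> Factorial_Ring.prime q \<and> p \<noteq> q \<and> n = p * q) \<or> n = 12"
  show "(\<Union>T\<in>{T. realizable TYPE('a) n T}. flag_polyhedron n T)
           = (\<Union>ns\<in>{ns. tower_type n ns}. flag_polyhedron n (tower_flag_type ns))"
    using realizable_tower[OF good assms(2)] tower_realizable[OF _ assms(2,1)] by blast
qed

end
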